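(* Let $n\ge1$ and let $Q$ be the probability distribution of a continuous random variable on $PD_n$ (with the Lebesgue $\sigma$-algebra), with density $f_Q$. (1) For all $\epsilon\in\{\pm1\}^n$, the transfer probabilities under $Q_\epsilon^{LPM}$ and $Q_\epsilon^{TPM}$ equal those under $Q$; i.e. for all measurable $\mathscr A\subseteq LPM_n(\epsilon)$, $$\mathbb{P}^{LPM}_{\epsilon,Q}(\mathbf M=L\mathbb{D}_\epsilon L^T\in\mathscr A)=\mathbb{P}_Q\big(\Phi_{\mathrm{Id}_n}\circ\Phi_{\mathbb{D}_\epsilon}^{-1}(\mathbf M)=LL^T\in\Phi_{\mathrm{Id}_n}\circ\Phi_{\mathbb{D}_\epsilon}^{-1}(\mathscr A)\big).$$ Moreover, at any point $L\in\mathbf{L}_n$ the Jacobian matrix of $\Phi_{\mathbb{D}_\epsilon}(L)$ with respect to $L$ is lower triangular (coordinates in lexicographic order), and the absolute value of its determinant is $2^n\prod_{j=1}^nl_{jj}^{n+1-j}$. (2) Let $Q=W_n(\Sigma,N)$ be any Wishart distribution, where $\Sigma\in PD_n$ and $N\ge n\ge1$. Write the Cholesky decomposition $\Sigma=L_\circ L_\circ^T$ ($L_\circ\in\mathbf{L}_n$) and the Bartlett decomposition of $\mathbf M_1\sim W_n(\Sigma,N)$ as $\mathbf M_1=L_\circ K_1K_1^TL_\circ^T$ ($K_1\in\mathbf{L}_n$ random). Then $\mathbf M:=L_\circ K_1\mathbb{D}_\epsilon K_1^TL_\circ^T$ has the Wishart distribution $W_{\epsilon,n}^{LPM}(\Sigma,N)$.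 (3) Similar results hold for $Q_\epsilon^{TPM}$: for all measurable $\mathscr B\subseteq TPM_n(\epsilon)$, $\mathbb{P}^{TPM}_{\epsilon,Q}(\mathscr B)=\mathbb{P}_Q\big(\Phi^{\mathrm{Id}_n}\circ(\Phi^{\mathbb{D}_{\overleftarrow\epsilon}})^{-1}(\mathscr B)\big)$; and in the notation of (2), $\overleftarrow{L_\circ}^{\,T}\,\overleftarrow{K_1}^{\,T}\,\mathbb{D}_{\overleftarrow\epsilon}\,\overleftarrow{K_1}\,\overleftarrow{L_\circ}\sim W_{\epsilon,n}^{TPM}(\overleftarrow\Sigma,N)$. (4) For all integers $N\ge n\ge1$ and $\Sigma\in PD_n$, $$\mathbf M\sim W_{\epsilon,n}^{LPM}(\Sigma,N)\iff\overleftarrow{\mathbf M}\sim W_{\epsilon,n}^{TPM}(\overleftarrow\Sigma,N).$$ (5) Suppose $g:\mathbb{R}\to\mathbb{R}$ is Lebesgue measurable and the distributional statements in (4) hold for $\mathbf M$. Then $\mathbb{E}[g(\overleftarrow{\mathbf M})]=\overleftarrow{\mathbb{E}[g(\mathbf M)]}$, if either side exists.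
   Context: $PD_n$: real positive definite $n\times n$ matrices. $LPM_n(\epsilon)$ (resp. $TPM_n(\epsilon)$): real symmetric $n\times n$ matrices whose leading (resp. trailing) principal $k\times k$ minor is nonzero of sign $\epsilon_k$, $1\le k\le n$. $\mathbf{L}_n$: real lower triangular matrices with positive diagonal. $\mathbb{D}_\epsilon=\mathrm{diag}(\epsilon_1,\epsilon_1\epsilon_2,\dots,\epsilon_{n-1}\epsilon_n)$. $P_n$: anti-diagonal permutation matrix. Reversal of a real matrix: $\overleftarrow A=(P_nAP_n)^T$. Reversal of a sign pattern: $\overleftarrow\epsilon=(\epsilon_n\epsilon_{n-1},\epsilon_n\epsilon_{n-2},\dots,\epsilon_n\epsilon_1,\epsilon_n)$ (and $\overleftarrow\epsilon=\epsilon$ for $n=1$); then $\mathbb{D}_{\overleftarrow\epsilon}=P_n\mathbb{D}_\epsilon P_n\in TPM_n(\epsilon)$. The maps $\Phi_{\mathbb{D}_\epsilon}:\mathbf{L}_n\to LPM_n(\epsilon)$, $L\mapsto L\mathbb{D}_\epsilon L^T$, and $\Phi^{\mathbb{D}_{\overleftarrow\epsilon}}:\mathbf{L}_n\to TPM_n(\epsilon)$, $K\mapsto K^T\mathbb{D}_{\overleftarrow\epsilon}K$, are smooth diffeomorphisms; $\Phi_{\mathrm{Id}_n}(L)=LL^T$ and $\Phi^{\mathrm{Id}_n}(K)=K^TK$ (both onto $PD_n$). Densities are with respect to Lebesgue measure on symmetric matrices in the coordinates $(a_{ij})_{i\ge j}$. The transfer distributions $Q^{LPM}_\epsilon$ on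 $LPM_n(\epsilon)$ and $Q^{TPM}_\epsilon$ on $TPM_n(\epsilon)$ have densities $f^{LPM}_{\epsilon,Q}(L\mathbb{D}_\epsilon L^T)=f_Q(LL^T)$ and $f^{TPM}_{\epsilon,Q}(K^T\mathbb{D}_{\overleftarrow\epsilon}K)=f_Q(K^TK)$. Lexicographic order of coordinates: $(l_{11};l_{21},l_{22};\dots;l_{n1},\dots,l_{nn})$ and likewise for $a_{ij}$, $i\ge j$. $W_n(\Sigma,N)$ has density on $PD_n$: $\dfrac{\det(\mathbf M_1)^{(N-n-1)/2}\exp(-\mathrm{tr}(\Sigma^{-1}\mathbf M_1)/2)}{2^{nN/2}\Gamma_n(N/2)\det(\Sigma)^{N/2}}$, $\Gamma_n$ the multivariate gamma function. $W^{LPM}_{\epsilon,n}(\Sigma,N)$ and $W^{TPM}_{\epsilon,n}(\Sigma,N)$ are its transfers. For real symmetric $A=UDU^T$ with $U$ orthogonal and $D$ diagonal, $g(A)=Ug(D)U^T$ (functional calculus); expectations of matrices are entrywise. *)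

theory Defs
  imports
    "HOL-Probability.Probability"
    "Jordan_Normal_Form.Gauss_Jordan_Elimination"
    "Jordan_Normal_Form.Determinant"
begin

text \<open>
  Matrices are those of \<^theory>\<open>Jordan_Normal_Form.Matrix\<close>, so that the dimension \<open>n\<close> is an
  ordinary natural number. Their entries are indexed from 0; sign patterns
  \<open>\<epsilon> = (\<epsilon> 1, \<dots>, \<epsilon> n)\<close> are functions on \<^typ>\<open>nat\<close> of which only the values on \<open>{1..n}\<close> matter.
\<close>

subsection \<open>Cones of matrices\<close>

definition sign_patterns :: "nat \<Rightarrow> (nat \<Rightarrow> real) set" where
  "sign_patterns n = {1..n} \<rightarrow> {-1, 1}"

definition sym_mats :: "nat \<Rightarrow> real mat set" where
  "sym_mats n = {A \<in> carrier_mat n n. transpose_mat A = A}"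

definition PD :: "nat \<Rightarrow> real mat set" where
  "PD n = {A \<in> sym_mats n. \<forall>v \<in> carrier_vec n. v \<noteq> 0\<^sub>v n \<longrightarrow> v \<bullet> (A *\<^sub>v v) > 0}"

definition leading_minor :: "nat \<Rightarrow> real mat \<Rightarrow> real" where
  "leading_minor k A = Determinant.det (Matrix.mat k k (\<lambda>(i, j). A $$ (i, j)))"

definition trailing_minor :: "nat \<Rightarrow> nat \<Rightarrow> real mat \<Rightarrow> real" where
  "trailing_minor n k A = Determinant.det (Matrix.mat k k (\<lambda>(i, j). A $$ (n - k + i, n - k + j)))"

text \<open>As \<open>\<epsilon> k\<close> is \<open>1\<close> or \<open>-1\<close>, \<open>sgn x = \<epsilon> k\<close> includes \<open>x \<noteq> 0\<close>.\<close>

definition LPM :: "nat \<Rightarrow> (nat \<Rightarrow> real) \<Rightarrow> real mat set" where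
  "LPM n \<epsilon> = {A \<in> sym_mats n. \<forall>k \<in> {1..n}. sgn (leading_minor k A) = \<epsilon> k}"

definition TPM :: "nat \<Rightarrow> (nat \<Rightarrow> real) \<Rightarrow> real mat set" where
  "TPM n \<epsilon> = {A \<in> sym_mats n. \<forall>k \<in> {1..n}. sgn (trailing_minor n k A) = \<epsilon> k}"

definition lower_pos :: "nat \<Rightarrow> real mat set" where
  "lower_pos n = {L \<in> carrier_mat n n.
     (\<forall>i<n. L $$ (i, i) > 0) \<and> (\<forall>i<n. \<forall>j<n. i < j \<longrightarrow> L $$ (i, j) = 0)}"

definition sign_diag :: "nat \<Rightarrow> (nat \<Rightarrow> real) \<Rightarrow> real mat" where
  "sign_diag n \<epsilon> = mat_diag n (\<lambda>i. if i = 0 then \<epsilon> 1 else \<epsilon> i * \<epsilon> (i + 1))"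

subsection \<open>Reversal\<close>

definition anti_diag :: "nat \<Rightarrow> real mat" where
  "anti_diag n = Matrix.mat n n (\<lambda>(i, j). if i + j + 1 = n then 1 else 0)"

definition rev_mat :: "nat \<Rightarrow> real mat \<Rightarrow> real mat" where
  "rev_mat n A = transpose_mat (anti_diag n * A * anti_diag n)"

definition rev_pattern :: "nat \<Rightarrow> (nat \<Rightarrow> real) \<Rightarrow> nat \<Rightarrow> real" where
  "rev_pattern n \<epsilon> k = (if k = n then \<epsilon> n else \<epsilon> n * \<epsilon> (n - k))"

subsection \<open>Cholesky-type parametrizations\<close>

definition Phi_low :: "real mat \<Rightarrow> real mat \<Rightarrow> real mat" where
  "Phi_low D L = L * D * transpose_mat L"

definition Phi_up :: "real mat \<Rightarrow> real mat \<Rightarrow> real mat" where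
  "Phi_up D K = transpose_mat K * D * K"

definition LPM_to_PD :: "nat \<Rightarrow> (nat \<Rightarrow> real) \<Rightarrow> real mat \<Rightarrow> real mat" where
  "LPM_to_PD n \<epsilon> =
     Phi_low (1\<^sub>m n) \<circ> the_inv_into (lower_pos n) (Phi_low (sign_diag n \<epsilon>))"

definition TPM_to_PD :: "nat \<Rightarrow> (nat \<Rightarrow> real) \<Rightarrow> real mat \<Rightarrow> real mat" where
  "TPM_to_PD n \<epsilon> =
     Phi_up (1\<^sub>m n) \<circ> the_inv_into (lower_pos n) (Phi_up (sign_diag n (rev_pattern n \<epsilon>)))"

subsection \<open>Lebesgue measure and transfer distributions\<close>

definition tri :: "nat \<Rightarrow> (nat \<times> nat) set" where
  "tri n = {(i, j). j \<le> i \<and> i < n}"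

definition sym_of_coords :: "nat \<Rightarrow> (nat \<times> nat \<Rightarrow> real) \<Rightarrow> real mat" where
  "sym_of_coords n x = Matrix.mat n n (\<lambda>(i, j). x (max i j, min i j))"

text \<open>
  Lebesgue measure on symmetric matrices in the coordinates \<open>(a\<^sub>i\<^sub>j)\<close>, \<open>i \<ge> j\<close>; the completion
  makes its \<open>\<sigma>\<close>-algebra the Lebesgue, not just the Borel, \<open>\<sigma>\<close>-algebra.
\<close>

definition sym_lebesgue :: "nat \<Rightarrow> real mat measure" where
  "sym_lebesgue n =
     embed_measure (completion (\<Pi>\<^sub>M ij \<in> tri n. (lborel :: real measure))) (sym_of_coords n)"

definition sym_lebesgue_on :: "nat \<Rightarrow> real mat set \<Rightarrow> real mat measure" where
  "sym_lebesgue_on n S = restrict_space (sym_lebesgue n) S"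

definition is_density_of ::
    "nat \<Rightarrow> real mat set \<Rightarrow> (real mat \<Rightarrow> real) \<Rightarrow> real mat measure \<Rightarrow> bool" where
  "is_density_of n S f Q \<longleftrightarrow>
     f \<in> borel_measurable (sym_lebesgue_on n S) \<and> (\<forall>A \<in> S. 0 \<le> f A) \<and>
     Q = density (sym_lebesgue_on n S) (\<lambda>A. ennreal (f A)) \<and> prob_space Q"

definition LPM_density ::
    "nat \<Rightarrow> (nat \<Rightarrow> real) \<Rightarrow> (real mat \<Rightarrow> real) \<Rightarrow> real mat \<Rightarrow> real" where
  "LPM_density n \<epsilon> f A = f (LPM_to_PD n \<epsilon> A)"

definition TPM_density ::
    "nat \<Rightarrow> (nat \<Rightarrow> real) \<Rightarrow> (real mat \<Rightarrow> real) \<Rightarrow> real mat \<Rightarrow> real" where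
  "TPM_density n \<epsilon> f A = f (TPM_to_PD n \<epsilon> A)"

definition LPM_transfer ::
    "nat \<Rightarrow> (nat \<Rightarrow> real) \<Rightarrow> (real mat \<Rightarrow> real) \<Rightarrow> real mat measure" where
  "LPM_transfer n \<epsilon> f =
     density (sym_lebesgue_on n (LPM n \<epsilon>)) (\<lambda>A. ennreal (LPM_density n \<epsilon> f A))"

definition TPM_transfer ::
    "nat \<Rightarrow> (nat \<Rightarrow> real) \<Rightarrow> (real mat \<Rightarrow> real) \<Rightarrow> real mat measure" where
  "TPM_transfer n \<epsilon> f =
     density (sym_lebesgue_on n (TPM n \<epsilon>)) (\<lambda>A. ennreal (TPM_density n \<epsilon> f A))"

text \<open>\<open>X\<close> is an \<open>S\<close>-valued random matrix on the probability space \<open>P\<close> with density \<open>f\<close>.\<close>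

definition has_density ::
    "'w measure \<Rightarrow> nat \<Rightarrow> real mat set \<Rightarrow> ('w \<Rightarrow> real mat) \<Rightarrow> (real mat \<Rightarrow> real) \<Rightarrow> bool" where
  "has_density P n S X f \<longleftrightarrow> distributed P (sym_lebesgue_on n S) X (\<lambda>A. ennreal (f A))"

subsection \<open>Jacobian matrix in lexicographic coordinates\<close>

definition lex_coords :: "nat \<Rightarrow> (nat \<times> nat) list" where
  "lex_coords n = concat (map (\<lambda>i. map (\<lambda>j. (i, j)) [0..<Suc i]) [0..<n])"

definition upd_entry :: "real mat \<Rightarrow> nat \<times> nat \<Rightarrow> real \<Rightarrow> real mat" where
  "upd_entry A kl t =
     Matrix.mat (dim_row A) (dim_col A) (\<lambda>ij. if ij = kl then t else A $$ ij)"

text \<open>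
  \<open>J\<close> is the matrix of partial derivatives at \<open>L\<close>: row \<open>p\<close> belongs to the \<open>p\<close>-th coordinate of
  the value of \<open>F\<close>, column \<open>q\<close> to the \<open>q\<close>-th coordinate of its lower triangular argument.
\<close>

definition is_jacobian :: "nat \<Rightarrow> (real mat \<Rightarrow> real mat) \<Rightarrow> real mat \<Rightarrow> real mat \<Rightarrow> bool" where
  "is_jacobian n F L J \<longleftrightarrow>
     (let c = lex_coords n; m = length c in
        J \<in> carrier_mat m m \<and>
        (\<forall>p<m. \<forall>q<m.
           ((\<lambda>t. F (upd_entry L (c ! q) t) $$ (c ! p)) has_real_derivative J $$ (p, q))
             (at (L $$ (c ! q)))))"

definition is_lower_triangular :: "real mat \<Rightarrow> bool" where
  "is_lower_triangular A \<longleftrightarrow>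
     (\<forall>i < dim_row A. \<forall>j < dim_col A. i < j \<longrightarrow> A $$ (i, j) = 0)"

subsection \<open>Wishart distributions\<close>

definition multivariate_Gamma :: "nat \<Rightarrow> real \<Rightarrow> real" where
  "multivariate_Gamma n x =
     pi powr (real n * (real n - 1) / 4) * (\<Prod>j = 1..n. Gamma (x - (real j - 1) / 2))"

definition mat_tr :: "real mat \<Rightarrow> real" where
  "mat_tr A = (\<Sum>i < dim_row A. A $$ (i, i))"

definition wishart_density :: "nat \<Rightarrow> real mat \<Rightarrow> nat \<Rightarrow> real mat \<Rightarrow> real" where
  "wishart_density n \<Sigma> N A =
     Determinant.det A powr ((real N - real n - 1) / 2)
       * exp (- mat_tr (the (mat_inverse \<Sigma>) * A) / 2)
     / (2 powr (real n * real N / 2) * multivariate_Gamma n (real N / 2)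
          * Determinant.det \<Sigma> powr (real N / 2))"

definition wishart ::
    "'w measure \<Rightarrow> nat \<Rightarrow> real mat \<Rightarrow> nat \<Rightarrow> ('w \<Rightarrow> real mat) \<Rightarrow> bool" where
  "wishart P n \<Sigma> N X \<longleftrightarrow> has_density P n (PD n) X (wishart_density n \<Sigma> N)"

definition wishart_LPM ::
    "'w measure \<Rightarrow> nat \<Rightarrow> (nat \<Rightarrow> real) \<Rightarrow> real mat \<Rightarrow> nat \<Rightarrow> ('w \<Rightarrow> real mat) \<Rightarrow> bool" where
  "wishart_LPM P n \<epsilon> \<Sigma> N X \<longleftrightarrow>
     has_density P n (LPM n \<epsilon>) X (LPM_density n \<epsilon> (wishart_density n \<Sigma> N))"

definition wishart_TPM ::
    "'w measure \<Rightarrow> nat \<Rightarrow> (nat \<Rightarrow> real) \<Rightarrow> real mat \<Rightarrow> nat \<Rightarrow> ('w \<Rightarrow> real mat) \<Rightarrow> bool" where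
  "wishart_TPM P n \<epsilon> \<Sigma> N X \<longleftrightarrow>
     has_density P n (TPM n \<epsilon>) X (TPM_density n \<epsilon> (wishart_density n \<Sigma> N))"

subsection \<open>Functional calculus and entrywise expectation\<close>

text \<open>
  For symmetric \<open>A\<close> a spectral decomposition exists and \<open>B\<close> does not depend on its choice.
\<close>

definition fun_calc :: "nat \<Rightarrow> (real \<Rightarrow> real) \<Rightarrow> real mat \<Rightarrow> real mat" where
  "fun_calc n g A = (THE B. \<exists>U d. U \<in> carrier_mat n n \<and>
     U * transpose_mat U = 1\<^sub>m n \<and> transpose_mat U * U = 1\<^sub>m n \<and>
     A = U * mat_diag n d * transpose_mat U \<and>
     B = U * mat_diag n (\<lambda>i. g (d i)) * transpose_mat U)"

definition has_mat_expectation :: "'w measure \<Rightarrow> nat \<Rightarrow> ('w \<Rightarrow> real mat) \<Rightarrow> bool" where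
  "has_mat_expectation P n X \<longleftrightarrow> (\<forall>i<n. \<forall>j<n. integrable P (\<lambda>\<omega>. X \<omega> $$ (i, j)))"

definition mat_expectation :: "'w measure \<Rightarrow> nat \<Rightarrow> ('w \<Rightarrow> real mat) \<Rightarrow> real mat" where
  "mat_expectation P n X = Matrix.mat n n (\<lambda>(i, j). \<integral>\<omega>. X \<omega> $$ (i, j) \<partial>P)"

end

theory Submission
  imports Defs "Jordan_Normal_Form.Spectral_Radius"
begin

text \<open>
  In coordinates, the map sending \<open>L * diag d * L\<^sup>T\<close> to \<open>L * diag e * L\<^sup>T\<close> is
  \<open>b\<^sub>i\<^sub>j = e\<^sub>j d\<^sub>j (a\<^sub>i\<^sub>j - (\<Sum>k<j. d\<^sub>k l\<^sub>i\<^sub>k l\<^sub>j\<^sub>k)) + (\<Sum>k<j. e\<^sub>k l\<^sub>i\<^sub>k l\<^sub>j\<^sub>k)\<close>. The entries of \<open>L\<close> that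
  occur here depend only on earlier entries of \<open>a\<close>, so every coordinate undergoes a sign change
  and a shift by a function of earlier coordinates. Extending the formulas for \<open>L\<close> to all
  coordinate vectors (with the total functions \<open>sqrt\<close> and \<open>/\<close>) gives a bijection of the whole
  space of symmetric matrices, and by Fubini it preserves Lebesgue measure; no change of variables
  with Jacobians is needed. Reversal permutes the coordinates, is an anti-automorphism of the
  matrix algebra, and exchanges \<open>LPM\<close> with \<open>TPM\<close>, which reduces the statements on \<open>TPM\<close> to
  those on \<open>LPM\<close>.
\<close>

subsection \<open>Measure isomorphisms\<close>

text \<open>The absolute Jacobian determinant in (1) does not involve \<epsilon>. Hence changing the
  sign pattern while keeping the Cholesky factor should preserve Lebesgue measure, and the
  coefficients e_j d_j, which are 1 or -1, show this without derivatives. What stands in the way is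
  the domain: the cones are not products, and Fubini on them would have to follow all their
  sections. Outside the cones the recursion takes roots of negative numbers and divides by 0, but
  this does no harm: it sees a vector only through d_j times a difference that the transfer leaves
  unchanged, so it computes the same factor before and after, whatever that factor means.
  Restriction to the cones comes last. They are described by signs of pivots, which an LDL^T
  factorization links to leading minors. The spectral theorem has two uses: positive leading minors
  of positive definite matrices, and existence of the functional calculus.\<close>

definition measure_iso :: "'a measure \<Rightarrow> 'b measure \<Rightarrow> ('a \<Rightarrow> 'b) \<Rightarrow> ('b \<Rightarrow> 'a) \<Rightarrow> bool" where
  "measure_iso M N f g \<longleftrightarrow>
     f \<in> M \<rightarrow>\<^sub>M N \<and> g \<in> N \<rightarrow>\<^sub>M M \<and>
     (\<forall>x \<in> space M. g (f x) = x) \<and> (\<forall>y \<in> space N. f (g y) = y) \<and> distr M N f = N"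

lemma measure_isoD:
  assumes "measure_iso M N f g"
  shows "f \<in> M \<rightarrow>\<^sub>M N" "g \<in> N \<rightarrow>\<^sub>M M" "distr M N f = N"
    "\<And>x. x \<in> space M \<Longrightarrow> g (f x) = x" "\<And>y. y \<in> space N \<Longrightarrow> f (g y) = y"
    "\<And>x. x \<in> space M \<Longrightarrow> f x \<in> space N" "\<And>y. y \<in> space N \<Longrightarrow> g y \<in> space M"
  using assms by (auto simp: measure_iso_def dest: measurable_space)

lemma distr_id_on:
  assumes "\<And>x. x \<in> space M \<Longrightarrow> h x = x"
  shows "distr M M h = M"
proof -
  have "distr M M h = distr M M (\<lambda>x. x)"
    using assms by (intro distr_cong) auto
  then show ?thesis by (simp add: distr_id)
qed

lemma measure_iso_sym:
  assumes "measure_iso M N f g"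
  shows "measure_iso N M g f"
proof -
  note * = measure_isoD[OF assms]
  have "distr N M g = distr (distr M N f) M g" by (simp add: *)
  also have "\<dots> = distr M M (g \<circ> f)" using * by (intro distr_distr)
  also have "\<dots> = M" using * by (intro distr_id_on) simp
  finally show ?thesis using * by (simp add: measure_iso_def)
qed

lemma measure_iso_comp:
  assumes "measure_iso M N f g" "measure_iso N K f' g'"
  shows "measure_iso M K (f' \<circ> f) (g \<circ> g')"
proof -
  note 1 = measure_isoD[OF assms(1)] and 2 = measure_isoD[OF assms(2)]
  have "distr M K (f' \<circ> f) = distr (distr M N f) K f'"
    using 1 2 by (intro distr_distr[symmetric])
  then show ?thesis
    using 1 2 by (auto simp: measure_iso_def intro: measurable_comp)
qed

lemma measure_iso_cong:
  assumes "measure_iso M N f g"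
    and "\<And>x. x \<in> space M \<Longrightarrow> f' x = f x" "\<And>y. y \<in> space N \<Longrightarrow> g' y = g y"
  shows "measure_iso M N f' g'"
proof -
  note 1 = measure_isoD[OF assms(1)]
  have "distr M N f' = distr M N f" using assms by (intro distr_cong) auto
  moreover have "f' \<in> M \<rightarrow>\<^sub>M N" "g' \<in> N \<rightarrow>\<^sub>M M"
    using 1(1,2) assms(2,3) by (auto cong: measurable_cong)
  ultimately show ?thesis using 1 assms by (auto simp: measure_iso_def)
qed

text \<open>Between completions, measurability also requires preimages of null sets to be null, and
  preservation of the measure provides exactly this.\<close>

lemma measurable_completion_distr_eq:
  assumes "f \<in> M \<rightarrow>\<^sub>M N" "distr M N f = N"
  shows "f \<in> completion M \<rightarrow>\<^sub>M completion N" "distr (completion M) (completion N) f = completion N"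
proof -
  have f: "f \<in> completion M \<rightarrow>\<^sub>M N" using assms(1) by (rule measurable_completion)
  have d: "distr (completion M) N f = N" using assms by (simp add: distr_completion)
  show "f \<in> completion M \<rightarrow>\<^sub>M completion N"
    using f by (rule completion.measurable_completion2) (simp add: d)
  show "distr (completion M) (completion N) f = completion N"
    using completion.completion_distr_eq[OF f] by (simp add: d)
qed

lemma measure_iso_completion:
  assumes "measure_iso M N f g"
  shows "measure_iso (completion M) (completion N) f g"
proof -
  note 1 = measure_isoD[OF assms] and 2 = measure_isoD[OF measure_iso_sym[OF assms]]
  show ?thesis
    using 1 measurable_completion_distr_eq[OF 1(1,3)] measurable_completion_distr_eq[OF 2(1,3)]
    by (simp add: measure_iso_def)
qed

lemma measure_iso_embed:
  assumes "inj_on s (space M)"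
  shows "measure_iso M (embed_measure M s) s (the_inv_into (space M) s)"
proof -
  have "the_inv_into (space M) s \<in> embed_measure M s \<rightarrow>\<^sub>M M"
    using assms by (intro measurable_embed_measure1) (auto simp: the_inv_into_f_f cong: measurable_cong)
  then show ?thesis
    using assms embed_measure_eq_distr'[OF assms] measurable_embed_measure2'[OF assms]
    by (auto simp: measure_iso_def the_inv_into_f_f space_embed_measure f_the_inv_into_f)
qed

lemma measure_iso_restrict:
  assumes iso: "measure_iso M N f g" and S: "S \<in> sets M" and T: "T \<in> sets N"
    and fS: "\<And>x. x \<in> S \<Longrightarrow> f x \<in> T" and gT: "\<And>y. y \<in> T \<Longrightarrow> g y \<in> S"
  shows "measure_iso (restrict_space M S) (restrict_space N T) f g"
proof -
  note 1 = measure_isoD[OF iso]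
  have f: "f \<in> restrict_space M S \<rightarrow>\<^sub>M restrict_space N T"
    using 1 fS by (intro measurable_restrict_space3) auto
  have g: "g \<in> restrict_space N T \<rightarrow>\<^sub>M restrict_space M S"
    using 1 gT by (intro measurable_restrict_space3) auto
  have ST: "space (restrict_space M S) = S" "space (restrict_space N T) = T"
    using sets.sets_into_space[OF S] sets.sets_into_space[OF T] by (auto simp: space_restrict_space)
  have "distr (restrict_space M S) (restrict_space N T) f = restrict_space N T"
  proof (rule measure_eqI)
    fix A assume A: "A \<in> sets (distr (restrict_space M S) (restrict_space N T) f)"
    then have A': "A \<in> sets N" "A \<subseteq> T" using T by (auto simp: sets_restrict_space_iff)
    \<comment> \<open>As \<open>g\<close> maps \<open>T\<close> into \<open>S\<close>, a point that
      \<open>f\<close> sends into \<open>A\<close> already lies in \<open>S\<close>, so restricting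
      the source cuts off nothing.\<close>
    have eq: "f -` A \<inter> space (restrict_space M S) = f -` A \<inter> space M"
      using A' gT 1 sets.sets_into_space[OF S] by (auto simp: ST) (metis subsetD)
    have "emeasure (distr (restrict_space M S) (restrict_space N T) f) A
        = emeasure (restrict_space M S) (f -` A \<inter> space M)"
      using A f by (simp add: emeasure_distr eq)
    also have "\<dots> = emeasure M (f -` A \<inter> space M)"
      using S unfolding eq[symmetric] by (intro emeasure_restrict_space) (auto simp: ST)
    also have "\<dots> = emeasure (distr M N f) A" using 1(1) A' by (simp add: emeasure_distr)
    also have "\<dots> = emeasure (restrict_space N T) A"
      using A' T 1(3) by (simp add: emeasure_restrict_space)
    finally show "emeasure (distr (restrict_space M S) (restrict_space N T) f) A
        = emeasure (restrict_space N T) A" .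
  qed simp
  then show ?thesis
    using f g 1 ST fS gT sets.sets_into_space[OF S] sets.sets_into_space[OF T]
    by (auto simp: measure_iso_def)
qed

text \<open>No Jacobian factor appears, because \<open>f\<close> carries one base measure to the
  other.\<close>

lemma measure_iso_density:
  assumes iso: "measure_iso M N f g" and h: "h \<in> borel_measurable N"
  shows "distr (density M (\<lambda>x. h (f x))) N f = density N h"
proof -
  note 1 = measure_isoD[OF iso]
  show ?thesis
  proof (rule measure_eqI)
    fix A assume "A \<in> sets (distr (density M (\<lambda>x. h (f x))) N f)"
    then have A: "A \<in> sets N" by simp
    note [measurable] = A 1(1) h
    have "emeasure (distr (density M (\<lambda>x. h (f x))) N f) A
        = (\<integral>\<^sup>+x. h (f x) * indicator (f -` A \<inter> space M) x \<partial>M)"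
      by (subst emeasure_distr) (auto simp: emeasure_density)
    also have "\<dots> = (\<integral>\<^sup>+x. h (f x) * indicator A (f x) \<partial>M)"
      by (intro nn_integral_cong) (auto simp: indicator_def)
    also have "\<dots> = (\<integral>\<^sup>+y. h y * indicator A y \<partial>distr M N f)"
      by (subst nn_integral_distr) auto
    also have "\<dots> = emeasure (density N h) A" by (simp add: 1(3) emeasure_density)
    finally show "emeasure (distr (density M (\<lambda>x. h (f x))) N f) A = emeasure (density N h) A" .
  qed simp
qed

text \<open>Images under \<open>f\<close> are preimages under \<open>g\<close>. This is the reason
  why an isomorphism comes with an explicit measurable inverse.\<close>

lemma measure_iso_image_sets:
  assumes "measure_iso M N f g" "A \<in> sets M"
  shows "f ` A \<in> sets N"
proof -
  note 1 = measure_isoD[OF assms(1)]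
  have "f ` A = g -` A \<inter> space N"
    using 1(4-7) sets.sets_into_space[OF assms(2)] by (auto simp: image_iff) (metis subsetD)
  then show ?thesis using 1(2) assms(2) by simp
qed

lemma measure_iso_density_image:
  assumes iso: "measure_iso M N f g" and h: "h \<in> borel_measurable N" and A: "A \<in> sets M"
  shows "measure (density M (\<lambda>x. h (f x))) A = measure (density N h) (f ` A)"
proof -
  note 1 = measure_isoD[OF iso]
  have "f -` f ` A \<inter> space M = A"
    using sets.sets_into_space[OF A] 1(4) by auto (metis subsetD)
  moreover have "f \<in> density M (\<lambda>x. h (f x)) \<rightarrow>\<^sub>M N" using 1(1) by simp
  ultimately show ?thesis
    using measure_iso_image_sets[OF iso A] 
    by (subst measure_iso_density[OF iso h, symmetric]) (simp add: measure_distr)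
qed

lemma distributed_measure_iso:
  assumes iso: "measure_iso M N f g" and X: "distributed P M X h"
  shows "distributed P N (\<lambda>\<omega>. f (X \<omega>)) (\<lambda>y. h (g y))"
proof -
  note 1 = measure_isoD[OF iso]
  have Xm: "X \<in> P \<rightarrow>\<^sub>M M" and h: "h \<in> borel_measurable M" and d: "distr P M X = density M h"
    using X by (auto simp: distributed_def)
  have hg: "(\<lambda>y. h (g y)) \<in> borel_measurable N" using 1(2) h by (rule measurable_compose)
  \<comment> \<open>\<open>measure_iso_density\<close> expects a density that factors through
    \<open>f\<close>; \<open>g (f x) = x\<close> puts \<open>h\<close> into this form.\<close>
  have "density M h = density M (\<lambda>x. h (g (f x)))"
    using h by (intro density_cong measurable_compose[OF 1(1) hg]) (auto simp: 1)
  then have "distr (density M h) N f = density N (\<lambda>y. h (g y))"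
    using measure_iso_density[OF iso hg] by simp
  moreover have "distr P N (f \<circ> X) = distr (distr P M X) N f"
    using Xm 1(1) by (simp add: distr_distr)
  ultimately show ?thesis
    using Xm 1(1) hg d by (auto simp: distributed_def o_def intro: measurable_compose)
qed

lemma distributed_cong:
  assumes "\<And>\<omega>. \<omega> \<in> space P \<Longrightarrow> X \<omega> = Y \<omega>" "\<And>x. x \<in> space M \<Longrightarrow> h x = k x"
  shows "distributed P M X h \<longleftrightarrow> distributed P M Y k"
proof -
  have "h \<in> borel_measurable M \<longleftrightarrow> k \<in> borel_measurable M"
    using assms(2) by (rule measurable_cong)
  moreover have "X \<in> P \<rightarrow>\<^sub>M M \<longleftrightarrow> Y \<in> P \<rightarrow>\<^sub>M M"
    using assms(1) by (rule measurable_cong)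
  moreover have "distr P M X = distr P M Y"
    using assms(1) by (intro distr_cong) auto
  moreover have "density M h = density M k" if "h \<in> borel_measurable M" "k \<in> borel_measurable M"
    using assms(2) that by (intro density_cong) auto
  ultimately show ?thesis by (auto simp: distributed_def)
qed

section \<open>Triangular maps on products of the real line\<close>

lemma sigma_finite_lborel_product: "product_sigma_finite (\<lambda>_. lborel :: real measure)"
  by standard

text \<open>
  Fubini in the last coordinate, where the map is an affine isometry of the line.
\<close>

lemma distr_triangular:
  fixes r :: "'i \<Rightarrow> nat" and s :: "'i \<Rightarrow> real"
  assumes "finite I"
    and "\<And>i. i \<in> I \<Longrightarrow> \<bar>s i\<bar> = 1"
    and "\<And>i. i \<in> I \<Longrightarrow> h i \<in> borel_measurable (PiM I (\<lambda>_. lborel))"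
    and "\<And>i x y. i \<in> I \<Longrightarrow> (\<And>k. k \<in> I \<Longrightarrow> r k < r i \<Longrightarrow> x k = y k) \<Longrightarrow> h i x = h i y"
  shows "distr (PiM I (\<lambda>_. lborel)) (PiM I (\<lambda>_. lborel)) (\<lambda>x. \<lambda>i\<in>I. s i * x i + h i x)
    = PiM I (\<lambda>_. lborel :: real measure)"
  using assms
\<comment> \<open>The inserted index \<open>i\<close> has maximal rank, so the shifts of all other
  coordinates ignore coordinate \<open>i\<close>. The rule does not exclude
  \<open>i \<in> S\<close>, hence the case split.\<close>
proof (induction I rule: finite_ranking_induct[where f = r])
  case empty
  show ?case by (rule distr_id_on) (auto simp: space_PiM)
next
  case (insert i S)
  show ?case
  proof (cases "i \<in> S")
    case True
    then have eq: "insert i S = S" by auto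
    show ?thesis unfolding eq
      by (rule insert.IH; rule insert.prems[unfolded eq]; assumption)
  next
    case False
    interpret product_sigma_finite "\<lambda>_::'i. lborel :: real measure" by (rule sigma_finite_lborel_product)
    let ?M = "\<lambda>J. PiM J (\<lambda>_. lborel :: real measure)"
    let ?T = "\<lambda>J x. \<lambda>k\<in>J. s k * x k + h k x"
    \<comment> \<open>For \<open>k \<in> S\<close> the shift \<open>h k\<close> ignores coordinate
      \<open>i\<close>, so filling in 0 there derives measurability over \<open>S\<close> from
      measurability over \<open>insert i S\<close>.\<close>
    have upd0: "(\<lambda>x. x(i := 0)) \<in> ?M S \<rightarrow>\<^sub>M ?M (insert i S)"
      by (rule measurable_fun_upd[where J = S]) auto
    have hS: "h k \<in> borel_measurable (?M S)" if k: "k \<in> S" for k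
    proof -
      have "(\<lambda>x. h k (x(i := 0))) \<in> borel_measurable (?M S)"
        using k by (intro measurable_compose[OF upd0 insert.prems(2)]) simp
      moreover have "h k (x(i := 0)) = h k x" for x
        using k insert.hyps(2)[OF k] by (intro insert.prems(3)) auto
      ultimately show ?thesis by simp
    qed
    have hi: "h i (x(i := y)) = h i x" for x y
      by (rule insert.prems(3)) auto
    have IH: "distr (?M S) (?M S) (?T S) = ?M S"
    proof (rule insert.IH)
      fix k and x y :: "'i \<Rightarrow> real"
      assume k: "k \<in> S" and "\<And>j. j \<in> S \<Longrightarrow> r j < r k \<Longrightarrow> x j = y j"
      then show "h k x = h k y"
        using insert.hyps(2)[OF k] by (intro insert.prems(3)) auto
    qed (simp_all add: insert.prems(1) hS)
    have TS: "?T S \<in> ?M S \<rightarrow>\<^sub>M ?M S"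
      using hS by (intro measurable_restrict) (auto intro!: borel_measurable_add borel_measurable_times measurable_component_singleton)
    have T: "?T (insert i S) \<in> ?M (insert i S) \<rightarrow>\<^sub>M ?M (insert i S)"
      using insert.prems(2) by (intro measurable_restrict)
        (auto intro!: borel_measurable_add borel_measurable_times measurable_component_singleton)
    have T_upd: "?T (insert i S) (x(i := y)) = (?T S x)(i := h i x + s i * y)" for x y
    proof
      fix k
      have "h k (x(i := y)) = h k x" if "k \<in> S"
        using that insert.hyps(2)[OF that] by (intro insert.prems(3)) auto
      then show "?T (insert i S) (x(i := y)) k = ((?T S x)(i := h i x + s i * y)) k"
        using False hi by (auto simp: restrict_def)
    qed
    have si: "s i \<noteq> 0" "ennreal \<bar>s i\<bar> = 1" using insert.prems(1)[of i] by auto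
    show ?thesis
    proof (rule measure_eqI)
      fix A assume "A \<in> sets (distr (?M (insert i S)) (?M (insert i S)) (?T (insert i S)))"
      then have A[measurable]: "A \<in> sets (?M (insert i S))" by simp
      have upd[measurable]: "(\<lambda>y. x(i := y)) \<in> borel \<rightarrow>\<^sub>M ?M (insert i S)" if "x \<in> space (?M S)" for x
        using that by (intro measurable_fun_upd[where J = S]) auto
      have "emeasure (distr (?M (insert i S)) (?M (insert i S)) (?T (insert i S))) A
          = (\<integral>\<^sup>+x. indicator A (?T (insert i S) x) \<partial>?M (insert i S))"
        using T by (simp add: nn_integral_distr flip: nn_integral_indicator)
      also have "\<dots> = (\<integral>\<^sup>+x. (\<integral>\<^sup>+y. indicator A (?T (insert i S) (x(i := y))) \<partial>lborel) \<partial>?M S)"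
        using insert.hyps(1) False T by (subst product_nn_integral_insert) (auto intro: measurable_compose)
      also have "\<dots> = (\<integral>\<^sup>+x. (\<integral>\<^sup>+y. indicator A ((?T S x)(i := y)) \<partial>lborel) \<partial>?M S)"
      proof (rule nn_integral_cong)
        fix x assume x: "x \<in> space (?M S)"
        then have "?T S x \<in> space (?M S)" using TS by (rule measurable_space[rotated])
        note upd[OF this, measurable]
        show "(\<integral>\<^sup>+y. indicator A (?T (insert i S) (x(i := y))) \<partial>lborel)
            = (\<integral>\<^sup>+y. indicator A ((?T S x)(i := y)) \<partial>lborel)"
          unfolding T_upd
          by (subst (2) nn_integral_real_affine[where c = "s i" and t = "h i x"]) (auto simp: si)
      qed
      \<comment> \<open>With the last coordinate straightened, the integrand depends on
        \<open>x\<close> only through the map on \<open>S\<close>, whose image measure is known by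
        induction.\<close>
      also have "\<dots> = (\<integral>\<^sup>+x. (\<integral>\<^sup>+y. indicator A (x(i := y)) \<partial>lborel) \<partial>distr (?M S) (?M S) (?T S))"
        using TS by (subst nn_integral_distr) auto
      also have "\<dots> = (\<integral>\<^sup>+x. indicator A x \<partial>?M (insert i S))"
        unfolding IH using insert.hyps(1) False by (subst product_nn_integral_insert) auto
      finally show "emeasure (distr (?M (insert i S)) (?M (insert i S)) (?T (insert i S))) A
          = emeasure (?M (insert i S)) A" by simp
    qed simp
  qed
qed

subsection \<open>Generalized Cholesky factorization in coordinates\<close>

text \<open>The Cholesky recursion for \<open>a = L * diag d * L\<^sup>T\<close>, obtained by
  solving the equation of entry (i, j) for the entry of \<open>L\<close>. Division by
  \<open>d j\<close> is written as multiplication, which is the same for signs.\<close>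

function chol :: "(nat \<Rightarrow> real) \<Rightarrow> (nat \<times> nat \<Rightarrow> real) \<Rightarrow> nat \<Rightarrow> nat \<Rightarrow> real" where
  "chol d a i j =
     (if j < i then d j * (a (i, j) - (\<Sum>k<j. d k * chol d a i k * chol d a j k)) / chol d a j j
      else if j = i then sqrt (d i * (a (i, i) - (\<Sum>k<i. d k * chol d a i k * chol d a i k)))
      else 0)"
  by auto
termination by (relation "Wellfounded.measure (\<lambda>(d, a, i, j). i + j)") auto

declare chol.simps [simp del]

text \<open>The contribution of the columns before \<open>j\<close> to entry (i, j) of
  \<open>L * diag d * L\<^sup>T\<close>. For lower triangular \<open>L\<close> and
  \<open>j \<le> i\<close> only column \<open>j\<close> is missing.\<close>

definition gram :: "(nat \<Rightarrow> real) \<Rightarrow> (nat \<Rightarrow> nat \<Rightarrow> real) \<Rightarrow> nat \<Rightarrow> nat \<Rightarrow> real" where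
  "gram d l i j = (\<Sum>k<j. d k * l i k * l j k)"

text \<open>On the cone this is a diagonal entry of the middle factor when the outer factors are
  unit triangular, hence a quotient of consecutive leading minors.\<close>

definition pivot :: "(nat \<Rightarrow> real) \<Rightarrow> (nat \<times> nat \<Rightarrow> real) \<Rightarrow> nat \<Rightarrow> real" where
  "pivot d a i = a (i, i) - gram d (chol d a) i i"

lemma chol_below: "j < i \<Longrightarrow> chol d a i j = d j * (a (i, j) - gram d (chol d a) i j) / chol d a j j"
  by (subst chol.simps) (simp add: gram_def)

lemma chol_diag: "chol d a i i = sqrt (d i * pivot d a i)"
  by (subst chol.simps) (simp add: gram_def pivot_def)

lemma chol_above: "i < j \<Longrightarrow> chol d a i j = 0"
  by (subst chol.simps) simp

lemma gram_cong:
  assumes "\<And>k. k < j \<Longrightarrow> l i k = l' i k" "\<And>k. k < j \<Longrightarrow> l j k = l' j k"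
  shows "gram d l i j = gram d l' i j"
  using assms by (simp add: gram_def)

lemma tri_iff [simp]: "(i, j) \<in> tri n \<longleftrightarrow> j \<le> i \<and> i < n"
  by (simp add: tri_def)

lemma finite_tri [simp]: "finite (tri n)"
  by (rule finite_subset[of _ "{..<n} \<times> {..<n}"]) (auto simp: tri_def)

text \<open>Entry (i, j) calls (i, k) and (j, k) for k < j, and (j, j) if j < i. The bounds on
  \<open>p\<close> and \<open>q\<close> stay in the induction hypothesis so that the range condition
  \<open>i < n\<close> and the assumption of \<open>chol_cong\<close> pass to these calls.\<close>

lemma chol_induct [consumes 1, case_names less]:
  assumes "j \<le> i"
    and "\<And>i j. j \<le> i \<Longrightarrow> (\<And>p q. q \<le> p \<Longrightarrow> p \<le> i \<Longrightarrow> q \<le> j \<Longrightarrow> p + q < i + j \<Longrightarrow> P p q) \<Longrightarrow> P i j"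
  shows "P i (j::nat)"
  using assms(1)
proof (induction "i + j" arbitrary: i j rule: less_induct)
  case less
  show ?case by (rule assms(2)[OF less.prems less.hyps])
qed

lemma chol_cong:
  assumes "j \<le> i" "\<And>p q. q \<le> p \<Longrightarrow> p \<le> i \<Longrightarrow> q \<le> j \<Longrightarrow> a (p, q) = b (p, q)"
  shows "chol d a i j = chol d b i j"
  using assms
proof (induction i j rule: chol_induct)
  case (less i j)
  have "gram d (chol d a) i j = gram d (chol d b) i j"
    using less by (intro gram_cong) auto
  moreover have "chol d a j j = chol d b j j" if "j < i"
    using less that by auto
  ultimately show ?case
    using less.prems less.hyps by (cases "j < i") (auto simp: chol_below chol_diag pivot_def)
qed

definition signs :: "nat \<Rightarrow> (nat \<Rightarrow> real) \<Rightarrow> bool" where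
  "signs n d \<longleftrightarrow> (\<forall>k<n. d k = 1 \<or> d k = -1)"

lemma signs_square: "signs n d \<Longrightarrow> k < n \<Longrightarrow> d k * d k = 1"
  by (auto simp: signs_def)

lemma signs_abs: "signs n d \<Longrightarrow> k < n \<Longrightarrow> \<bar>d k\<bar> = 1"
  by (auto simp: signs_def)

lemma signs_mult_cancel: "signs n d \<Longrightarrow> k < n \<Longrightarrow> d k * (d k * x) = x"
  by (auto simp: signs_def)

lemma signs_sgn: "signs n d \<Longrightarrow> k < n \<Longrightarrow> 0 < d k * x \<longleftrightarrow> sgn x = d k"
  by (auto simp: signs_def sgn_if)

text \<open>
  In coordinates, \<open>L * diag d * L\<^sup>T\<close> goes to \<open>L * diag e * L\<^sup>T\<close>.
\<close>

definition transfer :: "(nat \<Rightarrow> real) \<Rightarrow> (nat \<Rightarrow> real) \<Rightarrow> nat \<Rightarrow> (nat \<times> nat \<Rightarrow> real) \<Rightarrow> nat \<times> nat \<Rightarrow> real" where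
  "transfer d e n a = (\<lambda>(i, j) \<in> tri n.
     e j * d j * (a (i, j) - gram d (chol d a) i j) + gram e (chol d a) i j)"

lemma transfer_apply:
  "j \<le> i \<Longrightarrow> i < n \<Longrightarrow> transfer d e n a (i, j) =
     e j * d j * (a (i, j) - gram d (chol d a) i j) + gram e (chol d a) i j"
  by (simp add: transfer_def)

text \<open>By induction the sums \<open>gram e\<close> cancel, and the two factors
  \<open>e j\<close> square to 1. What remains under the root or in the numerator is literally the
  expression for \<open>chol d a\<close>, so the identity is purely algebraic and holds outside the
  cone as well.\<close>

lemma chol_transfer:
  assumes "signs n e" "j \<le> i" "i < n"
  shows "chol e (transfer d e n a) i j = chol d a i j"
  using assms(2,3)
proof (induction i j rule: chol_induct)
  case (less i j)
  have g: "gram e (chol e (transfer d e n a)) i j = gram e (chol d a) i j"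
    using less by (intro gram_cong) auto
  have c: "chol e (transfer d e n a) j j = chol d a j j" if "j < i"
    using less that by auto
  show ?case
  proof (cases "j < i")
    case True
    then show ?thesis
      using less.prems assms(1)
      by (simp add: chol_below c g transfer_apply mult.assoc signs_mult_cancel)
  next
    case False
    then have "j = i" using less.hyps by simp
    then show ?thesis
      using less.prems assms(1) g
      by (simp add: chol_diag pivot_def transfer_apply mult.assoc signs_mult_cancel)
  qed
qed

lemma pivot_transfer:
  assumes "signs n e" "i < n"
  shows "e i * pivot e (transfer d e n a) i = d i * pivot d a i"
proof -
  have "gram e (chol e (transfer d e n a)) i i = gram e (chol d a) i i"
    using assms by (intro gram_cong chol_transfer) auto
  then show ?thesis
    using assms by (simp add: pivot_def transfer_apply mult.assoc signs_mult_cancel)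
qed

text \<open>Both passes compute the same factor, so the second pass subtracts the sum that the first
  one added and puts back the original one. Extensionality makes agreement on the triangle an
  equality of functions.\<close>

lemma transfer_transfer:
  assumes "signs n d" "signs n e" "a \<in> extensional (tri n)"
  shows "transfer e d n (transfer d e n a) = a"
proof (rule extensionalityI[OF _ assms(3)])
  show "transfer e d n (transfer d e n a) \<in> extensional (tri n)"
    unfolding transfer_def by (rule restrict_extensional)
next
  fix p assume "p \<in> tri n"
  then obtain i j where p: "p = (i, j)" "j \<le> i" "i < n" by (auto simp: tri_def)
  have "gram f (chol e (transfer d e n a)) i j = gram f (chol d a) i j" for f
    using p assms by (intro gram_cong chol_transfer) auto
  then show "transfer e d n (transfer d e n a) p = a p"
    using p by (simp add: transfer_apply mult.assoc signs_mult_cancel[OF assms(1)] signs_mult_cancel[OF assms(2)])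
qed

text \<open>The recursion takes the root of \<open>d i * pivot d a i\<close>; the cone collects the
  vectors for which all these roots are genuine and nonzero.\<close>

definition chol_cone :: "nat \<Rightarrow> (nat \<Rightarrow> real) \<Rightarrow> (nat \<times> nat \<Rightarrow> real) set" where
  "chol_cone n d = {a. \<forall>i<n. 0 < d i * pivot d a i}"

lemma transfer_chol_cone: "signs n e \<Longrightarrow> a \<in> chol_cone n d \<Longrightarrow> transfer d e n a \<in> chol_cone n e"
  by (simp add: chol_cone_def pivot_transfer)

lemma chol_diag_pos: "a \<in> chol_cone n d \<Longrightarrow> i < n \<Longrightarrow> 0 < chol d a i i"
  by (simp add: chol_cone_def chol_diag)

text \<open>Positivity up to \<open>j\<close> makes the quotient and the root in column
  \<open>j\<close> honest. The hypothesis stops at \<open>j\<close> because the formula for minors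
  is applied before the sign of the next pivot is known.\<close>

lemma chol_factor:
  assumes "signs n d" "j \<le> i" "i < n" "\<And>k. k \<le> j \<Longrightarrow> 0 < d k * pivot d a k"
  shows "gram d (chol d a) i j + d j * chol d a i j * chol d a j j = a (i, j)"
proof -
  have pos: "0 < chol d a j j" using assms(4)[of j] by (simp add: chol_diag)
  show ?thesis
  proof (cases "j < i")
    case True
    then show ?thesis
      using pos assms(2,3) by (simp add: chol_below mult.assoc signs_mult_cancel[OF assms(1)])
  next
    case False
    then have "j = i" using assms(2) by simp
    moreover have "d i * (chol d a i i * chol d a i i) = pivot d a i"
      using assms(3) assms(4)[of i] \<open>j = i\<close>
      by (simp add: chol_diag signs_mult_cancel[OF assms(1)])
    ultimately show ?thesis by (simp add: pivot_def mult.assoc)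
  qed
qed

text \<open>The equations determine the entries one after the other: off the diagonal through
  division by \<open>l j j\<close>, on the diagonal because a positive root is unique.\<close>

lemma chol_unique:
  assumes d: "signs n d" and pos: "\<And>i. i < n \<Longrightarrow> 0 < l i i"
    and a: "\<And>i j. j \<le> i \<Longrightarrow> i < n \<Longrightarrow> a (i, j) = gram d l i j + d j * l i j * l j j"
    and ij: "j \<le> i" "i < n"
  shows "chol d a i j = l i j"
  using ij
proof (induction i j rule: chol_induct)
  case (less i j)
  have g: "gram d (chol d a) i j = gram d l i j"
    using less by (intro gram_cong) auto
  have c: "chol d a j j = l j j" if "j < i"
    using less that by auto
  show ?case
  proof (cases "j < i")
    case True
    then show ?thesis
      using less.prems less.hyps pos[of j]
      by (simp add: chol_below c g a mult.assoc signs_mult_cancel[OF d])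
  next
    case False
    then have "j = i" using less.hyps by simp
    then show ?thesis
      using less.prems pos[of i] g
      by (simp add: chol_diag pivot_def a mult.assoc signs_mult_cancel[OF d])
  qed
qed

lemma chol_cone_of_factor:
  assumes d: "signs n d" and pos: "\<And>i. i < n \<Longrightarrow> 0 < l i i"
    and a: "\<And>i j. j \<le> i \<Longrightarrow> i < n \<Longrightarrow> a (i, j) = gram d l i j + d j * l i j * l j j"
  shows "a \<in> chol_cone n d"
proof -
  have c: "chol d a i j = l i j" if "j \<le> i" "i < n" for i j
    by (rule chol_unique[OF d _ _ that]) (simp_all add: pos a)
  have "0 < d i * pivot d a i" if i: "i < n" for i
  proof -
    have "gram d (chol d a) i i = gram d l i i"
      using i by (intro gram_cong c) auto
    then show ?thesis
      using i pos[of i] by (simp add: pivot_def a mult.assoc signs_mult_cancel[OF d])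
  qed
  then show ?thesis by (simp add: chol_cone_def)
qed

section \<open>Measurability and invariance of Lebesgue measure under the transfer\<close>

abbreviation coord_space :: "nat \<Rightarrow> (nat \<times> nat \<Rightarrow> real) measure" where
  "coord_space n \<equiv> \<Pi>\<^sub>M ij \<in> tri n. (lborel :: real measure)"

lemma space_coord_space: "space (coord_space n) = extensional (tri n)"
  by (simp add: space_PiM PiE_UNIV_domain) (auto simp: PiE_def)

lemma measurable_coord: "p \<in> tri n \<Longrightarrow> (\<lambda>a. a p) \<in> borel_measurable (coord_space n)"
  using measurable_component_singleton[of p "tri n" "\<lambda>_. lborel :: real measure"]
  by (simp only: measurable_lborel1)

lemma measurable_chol:
  assumes "j \<le> i" "i < n"
  shows "(\<lambda>a. chol d a i j) \<in> borel_measurable (coord_space n)"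
  using assms
proof (induction i j rule: chol_induct)
  case (less i j)
  have c: "(\<lambda>a. a (i, j)) \<in> borel_measurable (coord_space n)"
    using less.hyps less.prems by (intro measurable_coord) simp
  have g: "(\<lambda>a. gram d (chol d a) i j) \<in> borel_measurable (coord_space n)"
    unfolding gram_def using less.hyps less.prems
    by (intro borel_measurable_sum borel_measurable_times borel_measurable_const less.IH) auto
  show ?case
  proof (cases "j < i")
    case True
    then have [measurable]: "(\<lambda>a. chol d a j j) \<in> borel_measurable (coord_space n)"
      using less.hyps less.prems by (intro less.IH) auto
    note [measurable] = c g
    show ?thesis
      unfolding chol_below[OF True] by measurable
  next
    case False
    then have ji: "j = i" using less.hyps by simp
    note [measurable] = c[unfolded ji] g[unfolded ji]
    show ?thesis
      unfolding ji chol_diag pivot_def by measurable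
  qed
qed

lemma measurable_gram_chol:
  assumes "j \<le> i" "i < n"
  shows "(\<lambda>a. gram f (chol d a) i j) \<in> borel_measurable (coord_space n)"
  unfolding gram_def using assms
  by (intro borel_measurable_sum borel_measurable_times borel_measurable_const measurable_chol) auto

lemma chol_cone_measurable: "chol_cone n d \<inter> space (coord_space n) \<in> sets (coord_space n)"
proof -
  have "(\<lambda>a. d i * pivot d a i) \<in> borel_measurable (coord_space n)" if "i < n" for i
    unfolding pivot_def
    using that by (intro borel_measurable_times borel_measurable_diff borel_measurable_const
      measurable_coord measurable_gram_chol) auto
  then have "{a \<in> space (coord_space n). \<forall>i\<in>{..<n}. 0 < d i * pivot d a i} \<in> sets (coord_space n)"
    by (intro sets.sets_Collect_finite_All) (auto intro!: borel_measurable_less)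
  also have "{a \<in> space (coord_space n). \<forall>i\<in>{..<n}. 0 < d i * pivot d a i} = chol_cone n d \<inter> space (coord_space n)"
    by (auto simp: chol_cone_def)
  finally show ?thesis .
qed

lemma transfer_measurable: "transfer d e n \<in> coord_space n \<rightarrow>\<^sub>M coord_space n"
proof -
  have "(\<lambda>a. case p of (i, j) \<Rightarrow>
      e j * d j * (a (i, j) - gram d (chol d a) i j) + gram e (chol d a) i j)
      \<in> coord_space n \<rightarrow>\<^sub>M lborel" if "p \<in> tri n" for p
    using that unfolding measurable_lborel1
    by (cases p) (simp, intro borel_measurable_times borel_measurable_diff borel_measurable_add
      borel_measurable_const measurable_coord measurable_gram_chol, auto)
  then show ?thesis
    unfolding transfer_def[abs_def] by (rule measurable_restrict)
qed

lemma distr_transfer: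
  assumes d: "signs n d" and e: "signs n e"
  shows "distr (coord_space n) (coord_space n) (transfer d e n) = coord_space n"
proof -
  define s where "s = (\<lambda>(i::nat, j). e j * d j)"
  define h where "h = (\<lambda>(i, j) a. gram e (chol d a) i j - e j * d j * gram d (chol d a) i j)"
  have "distr (coord_space n) (coord_space n) (\<lambda>a. \<lambda>p\<in>tri n. s p * a p + h p a) = coord_space n"
  \<comment> \<open>The shift at (i, j) uses factor entries (i, k) and (j, k) with k < j only. They
    depend on coordinates (p, q) with p \<le> i and q \<le> k, so p + q < i + j.\<close>
  proof (rule distr_triangular[where r = "\<lambda>(i, j). i + j"])
    fix p assume "p \<in> tri n"
    then obtain i j where p: "p = (i, j)" "j \<le> i" "i < n" by (auto simp: tri_def)
    show "\<bar>s p\<bar> = 1" using p d e by (simp add: s_def abs_mult signs_abs)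
    show "h p \<in> borel_measurable (coord_space n)"
      unfolding h_def using p
      by (simp, intro borel_measurable_times borel_measurable_diff borel_measurable_const
        measurable_gram_chol, auto)
    fix a b :: "nat \<times> nat \<Rightarrow> real"
    assume ab: "\<And>k. k \<in> tri n \<Longrightarrow> (case k of (i, j) \<Rightarrow> i + j) < (case p of (i, j) \<Rightarrow> i + j) \<Longrightarrow> a k = b k"
    have "gram f (chol d a) i j = gram f (chol d b) i j" for f
      using p by (intro gram_cong chol_cong ab) auto
    then show "h p a = h p b" by (simp add: h_def p)
  qed simp
  moreover have "(\<lambda>a. \<lambda>p\<in>tri n. s p * a p + h p a) = transfer d e n"
    by (auto simp: fun_eq_iff transfer_def s_def h_def restrict_def algebra_simps)
  ultimately show ?thesis by simp
qed

lemma measure_iso_transfer: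
  assumes "signs n d" "signs n e"
  shows "measure_iso (coord_space n) (coord_space n) (transfer d e n) (transfer e d n)"
  using assms transfer_measurable distr_transfer
  by (simp add: measure_iso_def transfer_transfer space_coord_space)

subsection \<open>Parametrization of the cones\<close>

lemma diag_congruence_index:
  fixes A :: "real mat"
  assumes "A \<in> carrier_mat n m" "i < n" "j < n"
  shows "(A * mat_diag m d * transpose_mat A) $$ (i, j) = (\<Sum>k<m. d k * A $$ (i, k) * A $$ (j, k))"
  using assms
  by (subst mat_diag_mult_right[OF assms(1)])
    (auto simp: scalar_prod_def lessThan_atLeast0 ac_simps intro!: sum.cong)

lemma Phi_low_index:
  assumes "A \<in> carrier_mat n n" "i < n" "j < n"
  shows "Phi_low (mat_diag n d) A $$ (i, j) = (\<Sum>k<n. d k * A $$ (i, k) * A $$ (j, k))"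
  unfolding Phi_low_def using assms by (rule diag_congruence_index)

lemma Phi_low_sym_mats:
  assumes "A \<in> carrier_mat n n"
  shows "Phi_low (mat_diag n d) A \<in> sym_mats n"
proof -
  have c: "Phi_low (mat_diag n d) A \<in> carrier_mat n n"
    unfolding Phi_low_def using assms by (intro mult_carrier_mat[of _ n n]) auto
  moreover have "transpose_mat (Phi_low (mat_diag n d) A) = Phi_low (mat_diag n d) A"
    using c by (intro eq_matI) (auto simp: Phi_low_index[OF assms] intro!: sum.cong)
  ultimately show ?thesis by (simp add: sym_mats_def)
qed

lemma lower_pos_carrier: "L \<in> lower_pos n \<Longrightarrow> L \<in> carrier_mat n n"
  by (simp add: lower_pos_def)

text \<open>Terms beyond \<open>j\<close> vanish because row \<open>j\<close> of \<open>L\<close>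
  ends there, and term \<open>j\<close> is split off. The result is the equation that
  \<open>chol\<close> solves.\<close>

lemma Phi_low_lower:
  assumes L: "L \<in> lower_pos n" and ij: "j \<le> i" "i < n"
  shows "Phi_low (mat_diag n d) L $$ (i, j)
    = gram d (\<lambda>i j. L $$ (i, j)) i j + d j * L $$ (i, j) * L $$ (j, j)"
proof -
  have "(\<Sum>k<n. d k * L $$ (i, k) * L $$ (j, k)) = (\<Sum>k<Suc j. d k * L $$ (i, k) * L $$ (j, k))"
    using L ij by (intro sum.mono_neutral_right) (auto simp: lower_pos_def)
  then show ?thesis
    using ij by (simp add: Phi_low_index[OF lower_pos_carrier[OF L]] gram_def)
qed

definition coords_of :: "nat \<Rightarrow> real mat \<Rightarrow> nat \<times> nat \<Rightarrow> real" where
  "coords_of n A = (\<lambda>p \<in> tri n. A $$ p)"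

lemma coords_of_apply: "j \<le> i \<Longrightarrow> i < n \<Longrightarrow> coords_of n A (i, j) = A $$ (i, j)"
  by (simp add: coords_of_def)

lemma coords_of_extensional: "coords_of n A \<in> extensional (tri n)"
  by (simp add: coords_of_def)

lemma sym_of_coords_index:
  "j \<le> i \<Longrightarrow> i < n \<Longrightarrow> sym_of_coords n a $$ (i, j) = a (i, j)"
  by (simp add: sym_of_coords_def max_def min_def)

lemma sym_of_coords_sym_mats: "sym_of_coords n a \<in> sym_mats n"
  by (auto simp: sym_mats_def sym_of_coords_def max.commute min.commute)

lemma sym_mats_index:
  assumes "A \<in> sym_mats n" "i < n" "j < n"
  shows "A $$ (i, j) = A $$ (j, i)"
proof -
  have "transpose_mat A $$ (i, j) = A $$ (j, i)"
    using assms by (intro index_transpose_mat(1)) (auto simp: sym_mats_def)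
  then show ?thesis using assms(1) by (simp add: sym_mats_def)
qed

lemma sym_mats_eqI:
  assumes A: "A \<in> sym_mats n" and B: "B \<in> sym_mats n"
    and eq: "\<And>i j. j \<le> i \<Longrightarrow> i < n \<Longrightarrow> A $$ (i, j) = B $$ (i, j)"
  shows "A = B"
proof (rule eq_matI)
  fix i j assume ij: "i < dim_row B" "j < dim_col B"
  then have ij: "i < n" "j < n" using B by (auto simp: sym_mats_def)
  show "A $$ (i, j) = B $$ (i, j)"
  proof (cases "j \<le> i")
    case True
    with ij show ?thesis by (intro eq)
  next
    case False
    then have "A $$ (j, i) = B $$ (j, i)" using ij by (intro eq) auto
    with ij show ?thesis by (simp add: sym_mats_index[OF A, of i j] sym_mats_index[OF B, of i j])
  qed
qed (use A B in \<open>auto simp: sym_mats_def\<close>)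

lemma sym_of_coords_coords_of: "A \<in> sym_mats n \<Longrightarrow> sym_of_coords n (coords_of n A) = A"
  by (rule sym_mats_eqI[OF sym_of_coords_sym_mats])
    (auto simp: sym_of_coords_index coords_of_apply)

lemma coords_of_sym_of_coords:
  assumes "a \<in> extensional (tri n)"
  shows "coords_of n (sym_of_coords n a) = a"
proof (rule extensionalityI[OF coords_of_extensional assms])
  fix p assume "p \<in> tri n"
  then show "coords_of n (sym_of_coords n a) p = a p"
    by (cases p) (simp add: sym_of_coords_index coords_of_apply)
qed

lemma inj_on_sym_of_coords: "inj_on (sym_of_coords n) (extensional (tri n))"
  by (rule inj_on_inverseI[where g = "coords_of n"]) (rule coords_of_sym_of_coords)

definition chol_mat :: "nat \<Rightarrow> (nat \<Rightarrow> real) \<Rightarrow> (nat \<times> nat \<Rightarrow> real) \<Rightarrow> real mat" where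
  "chol_mat n d a = Matrix.mat n n (\<lambda>(i, j). chol d a i j)"

lemma chol_mat_lower_pos: "a \<in> chol_cone n d \<Longrightarrow> chol_mat n d a \<in> lower_pos n"
  by (auto simp: chol_mat_def lower_pos_def chol_above chol_diag_pos)

lemma Phi_low_chol_mat:
  assumes d: "signs n d" and a: "a \<in> chol_cone n d"
  shows "Phi_low (mat_diag n d) (chol_mat n d a) = sym_of_coords n a"
proof (rule sym_mats_eqI[OF Phi_low_sym_mats sym_of_coords_sym_mats])
  show "chol_mat n d a \<in> carrier_mat n n" by (simp add: chol_mat_def)
  fix i j assume ij: "j \<le> i" "i < n"
  have "gram d (\<lambda>i j. chol_mat n d a $$ (i, j)) i j = gram d (chol d a) i j"
    using ij by (intro gram_cong) (auto simp: chol_mat_def)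
  moreover have "gram d (chol d a) i j + d j * chol d a i j * chol d a j j = a (i, j)"
    using a ij by (intro chol_factor[OF d]) (auto simp: chol_cone_def)
  ultimately show "Phi_low (mat_diag n d) (chol_mat n d a) $$ (i, j) = sym_of_coords n a $$ (i, j)"
    using ij by (simp add: Phi_low_lower[OF chol_mat_lower_pos[OF a]] sym_of_coords_index)
      (simp add: chol_mat_def)
qed

lemma coords_of_Phi_low:
  assumes L: "L \<in> lower_pos n" and ij: "j \<le> i" "i < n"
  shows "coords_of n (Phi_low (mat_diag n d) L) (i, j)
    = gram d (\<lambda>i j. L $$ (i, j)) i j + d j * L $$ (i, j) * L $$ (j, j)"
  using assms by (simp add: coords_of_apply Phi_low_lower)

lemma coords_of_Phi_low_cone:
  assumes d: "signs n d" and L: "L \<in> lower_pos n"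
  shows "coords_of n (Phi_low (mat_diag n d) L) \<in> chol_cone n d"
  by (rule chol_cone_of_factor[OF d _ coords_of_Phi_low[OF L]]) (use L in \<open>auto simp: lower_pos_def\<close>)

lemma chol_mat_Phi_low:
  assumes d: "signs n d" and L: "L \<in> lower_pos n"
  shows "chol_mat n d (coords_of n (Phi_low (mat_diag n d) L)) = L"
proof (rule eq_matI)
  fix i j assume "i < dim_row L" "j < dim_col L"
  then have ij: "i < n" "j < n" using L by (auto simp: lower_pos_def)
  have "chol d (coords_of n (Phi_low (mat_diag n d) L)) i j = L $$ (i, j)" if "j \<le> i"
    by (rule chol_unique[OF d _ coords_of_Phi_low[OF L] that ij(1)])
      (use L in \<open>auto simp: lower_pos_def\<close>)
  then show "chol_mat n d (coords_of n (Phi_low (mat_diag n d) L)) $$ (i, j) = L $$ (i, j)"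
    using ij L by (cases "j \<le> i") (auto simp: chol_mat_def chol_above lower_pos_def)
qed (use L in \<open>auto simp: chol_mat_def lower_pos_def\<close>)

lemma inj_on_Phi_low: "signs n d \<Longrightarrow> inj_on (Phi_low (mat_diag n d)) (lower_pos n)"
  by (rule inj_on_inverseI[where g = "\<lambda>A. chol_mat n d (coords_of n A)"]) (rule chol_mat_Phi_low)

lemma the_inv_into_Phi_low:
  assumes "signs n d" "a \<in> chol_cone n d"
  shows "the_inv_into (lower_pos n) (Phi_low (mat_diag n d)) (sym_of_coords n a) = chol_mat n d a"
  using assms by (intro the_inv_into_f_eq inj_on_Phi_low Phi_low_chol_mat chol_mat_lower_pos)

text \<open>The leading block is a congruence of the diagonal matrix of pivots by a unit lower
  triangular matrix. The hypothesis covers only the pivots before \<open>i\<close>, so that the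
  formula can be used to find the sign of pivot \<open>i\<close>.\<close>

lemma leading_minor_pivots:
  assumes d: "signs n d" and i: "i < n" and pos: "\<And>k. k < i \<Longrightarrow> 0 < d k * pivot d a k"
  shows "leading_minor (Suc i) (sym_of_coords n a) = (\<Prod>k\<le>i. pivot d a k)"
proof -
  define m where "m = Suc i"
  \<comment> \<open>Cholesky columns divided by their diagonal entries. Below the diagonal only
    columns c < i occur, and their diagonal entries are nonzero; the root of the last pivot never
    enters.\<close>
  define U where "U = Matrix.mat m m (\<lambda>(r, c).
    if c < r then chol d a r c / chol d a c c else if c = r then 1 else 0)"
  define M where "M = Matrix.mat m m (\<lambda>(r, c). sym_of_coords n a $$ (r, c))"
  have U: "U \<in> carrier_mat m m" by (simp add: U_def)
  have nz: "chol d a k k \<noteq> 0" and sq: "chol d a k k * chol d a k k = d k * pivot d a k" if "k < i" for k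
    using pos[OF that] by (auto simp: chol_diag)
  have U_prod: "pivot d a k * U $$ (r, k) * U $$ (c, k) = d k * chol d a r k * chol d a c k"
    if "k < r" "k < c" "r < m" "c < m" for r c k
  proof -
    have "k < i" using that by (simp add: m_def)
    moreover have "pivot d a k = d k * (chol d a k k * chol d a k k)"
      using \<open>k < i\<close> i sq[OF \<open>k < i\<close>] by (simp add: signs_mult_cancel[OF d])
    ultimately show ?thesis using that nz[of k] by (simp add: U_def)
  qed
  have "M = U * mat_diag m (pivot d a) * transpose_mat U"
  proof (rule sym_mats_eqI)
    show "M \<in> sym_mats m"
      using sym_mats_index[OF sym_of_coords_sym_mats, of _ n] i
      by (auto simp: M_def sym_mats_def m_def)
    show "U * mat_diag m (pivot d a) * transpose_mat U \<in> sym_mats m"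
      using Phi_low_sym_mats[OF U] by (simp add: Phi_low_def)
    fix r c assume rc: "c \<le> r" "r < m"
    have "(U * mat_diag m (pivot d a) * transpose_mat U) $$ (r, c)
        = (\<Sum>k<m. pivot d a k * U $$ (r, k) * U $$ (c, k))"
      using rc by (intro diag_congruence_index[OF U]) auto
    also have "\<dots> = (\<Sum>k<Suc c. pivot d a k * U $$ (r, k) * U $$ (c, k))"
      using rc by (intro sum.mono_neutral_right) (auto simp: U_def)
    also have "\<dots> = gram d (chol d a) r c + pivot d a c * U $$ (r, c)"
    proof -
      have "U $$ (c, c) = 1" using rc by (simp add: U_def)
      moreover have "(\<Sum>k<c. pivot d a k * U $$ (r, k) * U $$ (c, k)) = gram d (chol d a) r c"
        unfolding gram_def using rc by (intro sum.cong U_prod) auto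
      ultimately show ?thesis by simp
    qed
    also have "\<dots> = a (r, c)"
    proof (cases "c < r")
      case True
      then have c: "c < i" "c < n" "r < n" using rc i by (auto simp: m_def)
      have "pivot d a c * U $$ (r, c) = d c * chol d a r c * chol d a c c"
        using True rc nz[OF c(1)] sq[OF c(1)] signs_mult_cancel[OF d c(2), of "pivot d a c"]
        by (simp add: U_def field_simps)
      then show ?thesis
        using chol_factor[OF d rc(1) c(3)] pos c by simp
    next
      case False
      then have "c = r" using rc by simp
      then show ?thesis using rc by (simp add: U_def pivot_def)
    qed
    finally show "M $$ (r, c) = (U * mat_diag m (pivot d a) * transpose_mat U) $$ (r, c)"
      using rc i by (simp add: M_def sym_of_coords_index m_def)
  qed
  moreover have "Determinant.det U = 1"
    by (subst det_lower_triangular[OF _ U]) (auto simp: U_def prod_list_diag_prod)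
  moreover have "Determinant.det (mat_diag m (pivot d a)) = (\<Prod>k\<le>i. pivot d a k)"
    by (subst det_lower_triangular[where n = m])
      (auto simp: mat_diag_def prod_list_diag_prod m_def atLeast0LessThan lessThan_Suc_atMost)
  ultimately have "Determinant.det M = (\<Prod>k\<le>i. pivot d a k)"
    using U by (simp add: Determinant.det_mult[where n = m] Determinant.det_transpose)
  then show ?thesis by (simp add: leading_minor_def M_def m_def)
qed

definition sign_entry :: "(nat \<Rightarrow> real) \<Rightarrow> nat \<Rightarrow> real" where
  "sign_entry \<epsilon> i = (if i = 0 then \<epsilon> 1 else \<epsilon> i * \<epsilon> (i + 1))"

lemma sign_diag_eq: "sign_diag n \<epsilon> = mat_diag n (sign_entry \<epsilon>)"
  by (simp add: sign_diag_def sign_entry_def[abs_def])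

lemma sign_patternsD: "\<epsilon> \<in> sign_patterns n \<Longrightarrow> 0 < i \<Longrightarrow> i \<le> n \<Longrightarrow> \<epsilon> i = 1 \<or> \<epsilon> i = -1"
  by (fastforce simp: sign_patterns_def Pi_iff)

lemma signs_sign_entry:
  assumes "\<epsilon> \<in> sign_patterns n"
  shows "signs n (sign_entry \<epsilon>)"
  unfolding signs_def
proof (intro allI impI)
  fix k assume "k < n"
  then show "sign_entry \<epsilon> k = 1 \<or> sign_entry \<epsilon> k = -1"
    using sign_patternsD[OF assms, of k] sign_patternsD[OF assms, of "Suc k"]
    by (auto simp: sign_entry_def)
qed

text \<open>The product telescopes: each inner sign occurs twice.\<close>

lemma prod_sign_entry:
  assumes "\<epsilon> \<in> sign_patterns n" "i < n"
  shows "(\<Prod>k\<le>i. sign_entry \<epsilon> k) = \<epsilon> (Suc i)"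
  using assms(2)
proof (induction i)
  case 0
  then show ?case by (simp add: sign_entry_def)
next
  case (Suc i)
  then show ?case
    using sign_patternsD[OF assms(1), of "Suc i"] by (auto simp: sign_entry_def)
qed

lemma sgn_prod: "sgn (\<Prod>k\<in>A. f k :: real) = (\<Prod>k\<in>A. sgn (f k))"
  by (induction A rule: infinite_finite_induct) (auto simp: sgn_mult)

text \<open>Minors are products of pivots, and \<open>\<epsilon> k\<close> is the product of the
  first \<open>k\<close> entries of the sign diagonal. The converse needs strong induction, since
  the product formula presupposes the signs of the earlier pivots; their product is then
  cancelled.\<close>

lemma chol_cone_iff_leading_minors:
  assumes e: "\<epsilon> \<in> sign_patterns n"
  shows "a \<in> chol_cone n (sign_entry \<epsilon>)
    \<longleftrightarrow> (\<forall>k\<in>{1..n}. sgn (leading_minor k (sym_of_coords n a)) = \<epsilon> k)"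
proof
  let ?d = "sign_entry \<epsilon>"
  note d = signs_sign_entry[OF e]
  assume a: "a \<in> chol_cone n ?d"
  show "\<forall>k\<in>{1..n}. sgn (leading_minor k (sym_of_coords n a)) = \<epsilon> k"
  proof
    fix k assume "k \<in> {1..n}"
    then obtain i where i: "k = Suc i" "i < n" by (cases k) auto
    have "sgn (leading_minor k (sym_of_coords n a)) = (\<Prod>k\<le>i. sgn (pivot ?d a k))"
      unfolding i(1) using a i by (subst leading_minor_pivots[OF d]) (auto simp: chol_cone_def sgn_prod)
    also have "\<dots> = (\<Prod>k\<le>i. ?d k)"
      using a i by (intro prod.cong) (auto simp: chol_cone_def signs_sgn[OF d, symmetric])
    also have "\<dots> = \<epsilon> k" using e i by (simp add: prod_sign_entry)
    finally show "sgn (leading_minor k (sym_of_coords n a)) = \<epsilon> k" .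
  qed
next
  let ?d = "sign_entry \<epsilon>"
  note d = signs_sign_entry[OF e]
  assume m: "\<forall>k\<in>{1..n}. sgn (leading_minor k (sym_of_coords n a)) = \<epsilon> k"
  have "0 < ?d i * pivot ?d a i" if "i < n" for i
    using that
  proof (induction i rule: less_induct)
    case (less i)
    have IH: "0 < ?d k * pivot ?d a k" if "k < i" for k
      using less.IH[OF that] less.prems that by simp
    have "(\<Prod>k\<le>i. ?d k) = sgn (leading_minor (Suc i) (sym_of_coords n a))"
      using m less.prems e by (simp add: prod_sign_entry)
    also have "\<dots> = (\<Prod>k\<le>i. sgn (pivot ?d a k))"
      using leading_minor_pivots[OF d less.prems IH] by (simp add: sgn_prod)
    also have "\<dots> = (\<Prod>k<i. sgn (pivot ?d a k)) * sgn (pivot ?d a i)"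
      by (simp flip: lessThan_Suc_atMost)
    also have "(\<Prod>k<i. sgn (pivot ?d a k)) = (\<Prod>k<i. ?d k)"
      using less.prems IH by (intro prod.cong) (auto simp: signs_sgn[OF d, symmetric])
    finally have "(\<Prod>k<i. ?d k) * ?d i = (\<Prod>k<i. ?d k) * sgn (pivot ?d a i)"
      by (simp flip: lessThan_Suc_atMost)
    moreover have "?d k \<noteq> 0" if "k < i" for k
      using signs_square[OF d, of k] that less.prems by auto
    then have "(\<Prod>k<i. ?d k) \<noteq> 0" by simp
    ultimately have "sgn (pivot ?d a i) = ?d i" by simp
    then show ?case using signs_sgn[OF d less.prems] by simp
  qed
  then show "a \<in> chol_cone n ?d" by (simp add: chol_cone_def)
qed

definition mat_cone :: "nat \<Rightarrow> (nat \<Rightarrow> real) \<Rightarrow> real mat set" where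
  "mat_cone n d = sym_of_coords n ` (chol_cone n d \<inter> extensional (tri n))"

lemma LPM_eq_mat_cone:
  assumes "\<epsilon> \<in> sign_patterns n"
  shows "LPM n \<epsilon> = mat_cone n (sign_entry \<epsilon>)"
proof (intro equalityI subsetI)
  fix A assume "A \<in> LPM n \<epsilon>"
  then have A: "A \<in> sym_mats n" "\<forall>k\<in>{1..n}. sgn (leading_minor k A) = \<epsilon> k"
    by (auto simp: LPM_def)
  then have "coords_of n A \<in> chol_cone n (sign_entry \<epsilon>)"
    by (simp add: chol_cone_iff_leading_minors[OF assms] sym_of_coords_coords_of)
  then show "A \<in> mat_cone n (sign_entry \<epsilon>)"
    unfolding mat_cone_def
    by (intro image_eqI[where x = "coords_of n A"])
      (auto simp: sym_of_coords_coords_of[OF A(1)] coords_of_extensional)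
next
  fix A assume "A \<in> mat_cone n (sign_entry \<epsilon>)"
  then obtain a where "A = sym_of_coords n a" "a \<in> chol_cone n (sign_entry \<epsilon>)"
    by (auto simp: mat_cone_def)
  then show "A \<in> LPM n \<epsilon>"
    using chol_cone_iff_leading_minors[OF assms] by (simp add: LPM_def sym_of_coords_sym_mats)
qed

lemma mat_cone_eq_image_Phi_low:
  assumes d: "signs n d"
  shows "mat_cone n d = Phi_low (mat_diag n d) ` lower_pos n"
proof (intro equalityI subsetI)
  fix A assume "A \<in> mat_cone n d"
  then obtain a where "A = sym_of_coords n a" "a \<in> chol_cone n d" by (auto simp: mat_cone_def)
  then show "A \<in> Phi_low (mat_diag n d) ` lower_pos n"
    by (intro image_eqI[where x = "chol_mat n d a"])
      (simp_all add: Phi_low_chol_mat[OF d] chol_mat_lower_pos)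
next
  fix A assume "A \<in> Phi_low (mat_diag n d) ` lower_pos n"
  then obtain L where L: "A = Phi_low (mat_diag n d) L" "L \<in> lower_pos n" by auto
  then show "A \<in> mat_cone n d"
    unfolding mat_cone_def using coords_of_Phi_low_cone[OF d L(2)]
    by (intro image_eqI[where x = "coords_of n A"])
      (simp_all add: sym_of_coords_coords_of Phi_low_sym_mats lower_pos_carrier coords_of_extensional)
qed

subsection \<open>Spectral theorem and functional calculus\<close>

text \<open>An eigenvalue exists over the complex numbers. It is real by symmetry, and then the real
  and the imaginary part of an eigenvector both satisfy the eigenvalue equation; one of them is
  nonzero.\<close>

lemma symmetric_real_eigenvector:
  assumes A: "A \<in> sym_mats n" and n: "0 < n"
  obtains \<mu> and v :: "nat \<Rightarrow> real" where
    "(\<Sum>i<n. v i * v i) = 1" "\<And>i. i < n \<Longrightarrow> (\<Sum>j<n. A $$ (i, j) * v j) = \<mu> * v i"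
proof -
  define C where "C = Matrix.mat n n (\<lambda>(i, j). complex_of_real (A $$ (i, j)))"
  have C: "C \<in> carrier_mat n n" by (simp add: C_def)
  obtain k where "eigenvalue C k"
    using spectrum_non_empty[OF C] n by (auto simp: spectrum_def)
  then obtain z where "eigenvector C z k" by (auto simp: eigenvalue_def)
  then have z: "z \<in> carrier_vec n" "z \<noteq> 0\<^sub>v n" and eq: "C *\<^sub>v z = k \<cdot>\<^sub>v z"
    using C by (auto simp: eigenvector_def)
  define w where "w i = vec_index z i" for i
  have ev: "(\<Sum>j<n. complex_of_real (A $$ (i, j)) * w j) = k * w i" if "i < n" for i
  proof -
    have "vec_index (C *\<^sub>v z) i = (\<Sum>j<n. complex_of_real (A $$ (i, j)) * w j)"
      using that C z by (simp add: scalar_prod_def C_def w_def lessThan_atLeast0)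
    moreover have "vec_index (k \<cdot>\<^sub>v z) i = k * w i" using that z by (simp add: w_def)
    ultimately show ?thesis using eq by simp
  qed
  obtain m where m: "m < n" "w m \<noteq> 0"
    using z by (metis carrier_vecD eq_vecI index_zero_vec(1,2) w_def)
  define S where "S = (\<Sum>i<n. cnj (w i) * w i)"
  define r where "r = (\<Sum>i<n. (cmod (w i))\<^sup>2)"
  have "S = complex_of_real r"
    unfolding S_def r_def of_real_sum by (intro sum.cong refl) (simp only: complex_norm_square mult.commute)
  moreover have "0 < r"
    unfolding r_def using m by (intro sum_pos2[of _ m]) auto
  ultimately have S: "S \<noteq> 0" "cnj S = S" by auto
  \<comment> \<open>The value of the Hermitian form at \<open>w\<close>. The eigenvalue equation
    gives \<open>k * S\<close>, symmetry gives \<open>cnj T = T\<close>; as \<open>S\<close> is real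
    and nonzero, \<open>k\<close> is real.\<close>
  define T where "T = (\<Sum>i<n. \<Sum>j<n. cnj (w i) * complex_of_real (A $$ (i, j)) * w j)"
  have T: "T = k * S"
    by (simp add: T_def S_def sum_distrib_left mult.assoc ev flip: sum_distrib_left)
      (simp add: sum_distrib_left ac_simps)
  have "cnj T = (\<Sum>i<n. \<Sum>j<n. cnj (w j) * complex_of_real (A $$ (j, i)) * w i)"
    unfolding T_def by (auto simp: ac_simps sym_mats_index[OF A] intro!: sum.cong)
  also have "\<dots> = T" unfolding T_def by (rule sum.swap)
  finally have "cnj k = k" using T S by simp
  then have k: "k = complex_of_real (Re k)" by (simp add: complex_eq_iff)
  have re: "(\<Sum>j<n. A $$ (i, j) * Re (w j)) = Re k * Re (w i)" if "i < n" for i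
    using arg_cong[OF ev[OF that], of Re] by (subst (asm) k) simp
  have im: "(\<Sum>j<n. A $$ (i, j) * Im (w j)) = Re k * Im (w i)" if "i < n" for i
    using arg_cong[OF ev[OF that], of Im] by (subst (asm) k) simp
  obtain x where x: "x m \<noteq> 0" "\<And>i. i < n \<Longrightarrow> (\<Sum>j<n. A $$ (i, j) * x j) = Re k * x i"
  proof (cases "Re (w m) = 0")
    case True
    then have "Im (w m) \<noteq> 0" using m by (simp add: complex_eq_iff)
    then show ?thesis using that[of "\<lambda>i. Im (w i)"] im by simp
  next
    case False
    then show ?thesis using that[of "\<lambda>i. Re (w i)"] re by simp
  qed
  define s where "s = sqrt (\<Sum>i<n. x i * x i)"
  have "0 < (\<Sum>i<n. x i * x i)"
    using m x(1) by (intro sum_pos2[of _ m]) (auto simp: not_sum_squares_lt_zero zero_less_mult_iff linorder_neq_iff)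
  then have s: "s \<noteq> 0" "s * s = (\<Sum>i<n. x i * x i)" by (auto simp: s_def)
  show ?thesis
  proof (rule that[of "\<lambda>i. x i / s" "Re k"])
    have "(\<Sum>i<n. x i / s * (x i / s)) = (\<Sum>i<n. x i * x i) / (s * s)"
      by (simp add: sum_divide_distrib)
    then show "(\<Sum>i<n. x i / s * (x i / s)) = 1"
      unfolding s(2)[symmetric] using s(1) by simp
    show "(\<Sum>j<n. A $$ (i, j) * (x j / s)) = Re k * (x i / s)" if "i < n" for i
      using x(2)[OF that] by (simp flip: sum_divide_distrib)
  qed
qed

definition is_orthogonal :: "nat \<Rightarrow> real mat \<Rightarrow> bool" where
  "is_orthogonal n U \<longleftrightarrow>
     U \<in> carrier_mat n n \<and> U * transpose_mat U = 1\<^sub>m n \<and> transpose_mat U * U = 1\<^sub>m n"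

lemma is_orthogonalD:
  assumes "is_orthogonal n U"
  shows "U \<in> carrier_mat n n" "transpose_mat U \<in> carrier_mat n n"
    "U * transpose_mat U = 1\<^sub>m n" "transpose_mat U * U = 1\<^sub>m n"
  using assms by (auto simp: is_orthogonal_def)

lemma mat_mult_cancel_middle:
  assumes "A \<in> carrier_mat n n" "B \<in> carrier_mat n n" "C \<in> carrier_mat n n" "D \<in> carrier_mat n n"
    and "B * C = 1\<^sub>m n"
  shows "A * B * (C * D) = (A * D :: real mat)"
proof -
  have "A * B * (C * D) = A * (B * C) * D"
    using assms(1-4) by (simp add: assoc_mult_mat[of _ n n _ n _ n])
  then show ?thesis using assms by simp
qed

lemma is_orthogonal_mult:
  assumes U: "is_orthogonal n U" and V: "is_orthogonal n V"
  shows "is_orthogonal n (U * V)"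
proof -
  note u = is_orthogonalD[OF U] and v = is_orthogonalD[OF V]
  have t: "transpose_mat (U * V) = transpose_mat V * transpose_mat U"
    using u v by (intro transpose_mult)
  show ?thesis
    unfolding is_orthogonal_def t
    using u v by (simp add: mat_mult_cancel_middle[of _ n])
qed

text \<open>
  The Householder reflection exchanging the unit vector \<open>v\<close> with \<open>e\<^sub>0\<close>. If \<open>v = e\<^sub>0\<close>, the
  coefficient is \<open>2 / 0 = 0\<close> and the matrix is the identity.
\<close>

definition householder :: "nat \<Rightarrow> (nat \<Rightarrow> real) \<Rightarrow> real mat" where
  "householder n v = (let w = (\<lambda>i. v i - (if i = 0 then 1 else 0)); c = 2 / (\<Sum>i<n. w i * w i)
     in Matrix.mat n n (\<lambda>(i, j). (if i = j then 1 else 0) - c * w i * w j))"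

text \<open>For w = v - e_0 and |v| = 1 one has |w|^2 = -2 w_0. Hence c w_i w_0 = -w_i, and column 0
  is e_0 + w = v.\<close>

lemma householder:
  assumes n: "0 < n" and v: "(\<Sum>i<n. v i * v i) = 1"
  shows "is_orthogonal n (householder n v)" "transpose_mat (householder n v) = householder n v"
    "\<And>i. i < n \<Longrightarrow> householder n v $$ (i, 0) = v i"
proof -
  define w where "w = (\<lambda>i. v i - (if i = 0 then 1 else 0 :: real))"
  define q where "q = (\<Sum>i<n. w i * w i)"
  define c where "c = 2 / q"
  have H: "householder n v = Matrix.mat n n (\<lambda>(i, j). (if i = j then 1 else 0) - c * w i * w j)"
    by (simp add: householder_def w_def q_def c_def)
  show t: "transpose_mat (householder n v) = householder n v"
    unfolding H by (intro eq_matI) auto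
  have q: "q = - 2 * w 0"
  proof -
    have "q = (\<Sum>i<n. v i * v i) + (\<Sum>i<n. if i = 0 then 1 - 2 * v 0 else 0)"
      unfolding q_def w_def sum.distrib[symmetric] by (intro sum.cong) (auto simp: algebra_simps)
    then show ?thesis using n v by (simp add: w_def)
  qed
  have w0: "c * w i * w 0 = - w i" if "i < n" for i
  proof (cases "q = 0")
    case True
    then have "w i * w i = 0"
      using that unfolding q_def by (subst (asm) sum_nonneg_eq_0_iff) auto
    then show ?thesis by simp
  next
    case False
    then show ?thesis using q by (simp add: c_def field_simps)
  qed
  show "householder n v $$ (i, 0) = v i" if "i < n" for i
    using that n w0[OF that] by (simp add: H w_def)
  \<comment> \<open>Also true for \<open>q = 0\<close>, where \<open>c = 0\<close>. It cancels the
    linear against the quadratic terms in the square of the reflection.\<close>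
  have cq: "c * (c * q) = 2 * c" by (simp add: c_def)
  have "householder n v * householder n v = 1\<^sub>m n"
  proof (rule eq_matI)
    fix i j assume "i < dim_row (1\<^sub>m n :: real mat)" "j < dim_col (1\<^sub>m n :: real mat)"
    then have ij: "i < n" "j < n" by auto
    have "(householder n v * householder n v) $$ (i, j)
        = (\<Sum>k<n. ((if i = k then 1 else 0) - c * w i * w k) * ((if k = j then 1 else 0) - c * w k * w j))"
      using ij by (simp add: H scalar_prod_def lessThan_atLeast0)
    also have "\<dots> = (\<Sum>k<n. (if i = k then (if k = j then 1 else 0) else 0)
        - (if i = k then c * w i * w j else 0) - (if k = j then c * w i * w j else 0)
        + c * c * w i * w j * (w k * w k))"
      by (intro sum.cong) (auto simp: algebra_simps)
    also have "\<dots> = (if i = j then 1 else 0) - 2 * (c * w i * w j) + c * c * w i * w j * q"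
      using ij by (simp add: sum.distrib sum_subtractf q_def sum_distrib_left)
    also have "\<dots> = (if i = j then 1 else 0)"
      using cq by (auto simp: algebra_simps)
    finally show "(householder n v * householder n v) $$ (i, j) = 1\<^sub>m n $$ (i, j)"
      using ij by simp
  qed (auto simp: H)
  then show "is_orthogonal n (householder n v)"
    unfolding is_orthogonal_def t by (simp add: H)
qed

lemma sym_mats_carrier: "A \<in> sym_mats n \<Longrightarrow> A \<in> carrier_mat n n"
  by (simp add: sym_mats_def)

lemma sym_mats_congruence:
  assumes A: "A \<in> sym_mats n" and H: "H \<in> carrier_mat n m"
  shows "transpose_mat H * A * H \<in> sym_mats m"
proof -
  have c: "A \<in> carrier_mat n n" "transpose_mat A = A" using A by (auto simp: sym_mats_def)
  have "transpose_mat (transpose_mat H * A * H) = transpose_mat H * (transpose_mat A * H)"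
    using c(1) H by (subst transpose_mult[of _ m n _ m], simp, simp)
      (subst transpose_mult[of _ m n _ n], simp_all)
  also have "\<dots> = transpose_mat H * A * H"
    using c H by (simp add: assoc_mult_mat[of _ m n _ n _ m])
  finally show ?thesis using c H by (simp add: sym_mats_def)
qed

lemma block_diag_mult:
  fixes A :: "'a :: comm_ring_1 mat"
  assumes "A \<in> carrier_mat m m" "C \<in> carrier_mat m m" "B \<in> carrier_mat n n" "D \<in> carrier_mat n n"
  shows "four_block_mat A (0\<^sub>m m n) (0\<^sub>m n m) B * four_block_mat C (0\<^sub>m m n) (0\<^sub>m n m) D
    = four_block_mat (A * C) (0\<^sub>m m n) (0\<^sub>m n m) (B * D)"
  using assms by (subst mult_four_block_mat[of _ m m _ n _ n _ _ m _ n]) auto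

text \<open>Deflation: conjugation by the reflection that takes e_0 to a unit eigenvector turns the
  first column into a multiple of e_0, and by symmetry the first row too. The induction hypothesis
  diagonalizes the remaining block.\<close>

theorem spectral_decomposition:
  assumes "A \<in> sym_mats n"
  shows "\<exists>U d. is_orthogonal n U \<and> A = U * mat_diag n d * transpose_mat U"
  using assms
proof (induction n arbitrary: A)
  case 0
  then show ?case
    by (intro exI[of _ "1\<^sub>m 0"] exI[of _ "\<lambda>_. 0"] conjI)
      (auto simp: is_orthogonal_def sym_mats_def intro!: eq_matI)
next
  case (Suc n)
  let ?N = "Suc n"
  note A = Suc.prems
  obtain \<mu> v where v: "(\<Sum>i<?N. v i * v i) = 1"
    and ev: "\<And>i. i < ?N \<Longrightarrow> (\<Sum>j<?N. A $$ (i, j) * v j) = \<mu> * v i"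
    by (rule symmetric_real_eigenvector[OF A zero_less_Suc]) blast
  define H where "H = householder ?N v"
  have orthH: "is_orthogonal ?N H" and tH: "transpose_mat H = H"
    and H0: "\<And>i. i < ?N \<Longrightarrow> H $$ (i, 0) = v i"
    using householder[of ?N v] v by (auto simp: H_def)
  have H: "H \<in> carrier_mat ?N ?N" and HH: "H * H = 1\<^sub>m ?N"
    using is_orthogonalD[OF orthH] tH by auto
  have cA: "A \<in> carrier_mat ?N ?N" using A by (rule sym_mats_carrier)
  define B where "B = H * A * H"
  have B: "B \<in> sym_mats ?N" using sym_mats_congruence[OF A H] by (simp add: B_def tH)
  have AH0: "(A * H) $$ (i, 0) = \<mu> * H $$ (i, 0)" if "i < ?N" for i
  proof -
    have "(A * H) $$ (i, 0) = (\<Sum>j<?N. A $$ (i, j) * H $$ (j, 0))"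
      using that cA H by (simp add: scalar_prod_def lessThan_atLeast0)
    also have "\<dots> = (\<Sum>j<?N. A $$ (i, j) * v j)" by (intro sum.cong) (auto simp: H0)
    finally show ?thesis using ev[OF that] H0[OF that] by simp
  qed
  have B0: "B $$ (i, 0) = (if i = 0 then \<mu> else 0)" if "i < ?N" for i
  proof -
    have "B $$ (i, 0) = (H * (A * H)) $$ (i, 0)"
      unfolding B_def using cA H by (simp add: assoc_mult_mat[of _ ?N ?N _ ?N _ ?N])
    also have "\<dots> = (\<Sum>j<?N. H $$ (i, j) * (A * H) $$ (j, 0))"
      using that cA H by (simp add: scalar_prod_def lessThan_atLeast0)
    also have "\<dots> = (\<Sum>j<?N. \<mu> * (H $$ (i, j) * H $$ (j, 0)))"
      by (intro sum.cong) (auto simp: AH0)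
    also have "\<dots> = \<mu> * (H * H) $$ (i, 0)"
      using that H by (simp add: scalar_prod_def lessThan_atLeast0 sum_distrib_left distrib_left)
    finally show ?thesis using that by (simp add: HH)
  qed
  define A' where "A' = Matrix.mat n n (\<lambda>(i, j). B $$ (Suc i, Suc j))"
  have A': "A' \<in> sym_mats n"
    using sym_mats_index[OF B] by (auto simp: sym_mats_def A'_def)
  then obtain U d where U: "is_orthogonal n U" and A'_eq: "A' = U * mat_diag n d * transpose_mat U"
    using Suc.IH by blast
  define V where "V = four_block_mat (1\<^sub>m 1) (0\<^sub>m 1 n) (0\<^sub>m n 1) U"
  define D where "D = mat_diag ?N (case_nat \<mu> d)"
  note u = is_orthogonalD[OF U]
  have tV: "transpose_mat V = four_block_mat (1\<^sub>m 1) (0\<^sub>m 1 n) (0\<^sub>m n 1) (transpose_mat U)"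
    unfolding V_def using u by (subst transpose_four_block_mat[of _ 1 1 _ n _ n]) auto
  have D_eq: "D = four_block_mat (mat_diag 1 (\<lambda>_. \<mu>)) (0\<^sub>m 1 n) (0\<^sub>m n 1) (mat_diag n d)"
    by (intro eq_matI) (auto simp: D_def mat_diag_def split: nat.split)
  have B_eq: "B = four_block_mat (mat_diag 1 (\<lambda>_. \<mu>)) (0\<^sub>m 1 n) (0\<^sub>m n 1) A'"
  proof (rule sym_mats_eqI[OF B])
    show "four_block_mat (mat_diag 1 (\<lambda>_. \<mu>)) (0\<^sub>m 1 n) (0\<^sub>m n 1) A' \<in> sym_mats ?N"
      using A' by (auto simp: sym_mats_def transpose_four_block_mat[of _ 1 1 _ n _ n] mat_diag_def intro!: eq_matI)
    fix i j assume "j \<le> i" "i < ?N"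
    then show "B $$ (i, j) = four_block_mat (mat_diag 1 (\<lambda>_. \<mu>)) (0\<^sub>m 1 n) (0\<^sub>m n 1) A' $$ (i, j)"
      using B0[of i] by (auto simp: A'_def mat_diag_def)
  qed
  have orthV: "is_orthogonal ?N V"
    unfolding is_orthogonal_def tV
    unfolding V_def using u four_block_one_mat[of 1 n, where ?'a = real]
    by (subst (1 2) block_diag_mult) auto
  have V: "V \<in> carrier_mat ?N ?N" "transpose_mat V \<in> carrier_mat ?N ?N"
    using is_orthogonalD[OF orthV] by auto
  have VD0: "V * D = four_block_mat (mat_diag 1 (\<lambda>_. \<mu>)) (0\<^sub>m 1 n) (0\<^sub>m n 1) (U * mat_diag n d)"
    unfolding V_def D_eq using u
    by (subst block_diag_mult) (auto simp: left_mult_one_mat[OF mat_diag_dim])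
  have VD: "V * D * transpose_mat V = B"
    unfolding VD0 tV B_eq A'_eq using u
    by (subst block_diag_mult) (auto simp: right_mult_one_mat[OF mat_diag_dim])
  have cD: "D \<in> carrier_mat ?N ?N" by (simp add: D_def)
  have "A = (H * H) * A * (H * H)" using HH cA by simp
  also have "\<dots> = H * B * H"
    unfolding B_def using H cA by (simp add: assoc_mult_mat[of _ ?N ?N _ ?N _ ?N])
  also have "\<dots> = (H * V) * D * (transpose_mat V * H)"
    unfolding VD[symmetric] using H V cD by (simp add: assoc_mult_mat[of _ ?N ?N _ ?N _ ?N])
  also have "transpose_mat V * H = transpose_mat (H * V)"
    using transpose_mult[OF H V(1)] by (simp add: tH)
  finally have "A = (H * V) * mat_diag ?N (case_nat \<mu> d) * transpose_mat (H * V)"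
    by (simp add: D_def)
  then show ?case using is_orthogonal_mult[OF orthH orthV] by blast
qed

section \<open>Uniqueness of the functional calculus\<close>

definition spectral_image :: "nat \<Rightarrow> (real \<Rightarrow> real) \<Rightarrow> real mat \<Rightarrow> real mat \<Rightarrow> bool" where
  "spectral_image n g A B \<longleftrightarrow> (\<exists>U d. is_orthogonal n U \<and>
     A = U * mat_diag n d * transpose_mat U \<and>
     B = U * mat_diag n (\<lambda>i. g (d i)) * transpose_mat U)"

lemma fun_calc_eq_The: "fun_calc n g A = (THE B. spectral_image n g A B)"
  unfolding fun_calc_def spectral_image_def is_orthogonal_def by (simp add: conj_assoc)

text \<open>Entrywise the assumption reads W_ij (d_j - e_i) = 0: either the entry vanishes or the
  two eigenvalues agree, and then so do their values under \<open>g\<close>.\<close>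

lemma diag_intertwine:
  fixes W :: "real mat"
  assumes W: "W \<in> carrier_mat n n" and eq: "W * mat_diag n d = mat_diag n e * W"
  shows "W * mat_diag n (\<lambda>i. g (d i)) = mat_diag n (\<lambda>i. g (e i)) * W"
proof (rule eq_matI)
  fix i j assume "i < dim_row (mat_diag n (\<lambda>i. g (e i)) * W)" "j < dim_col (mat_diag n (\<lambda>i. g (e i)) * W)"
  then have ij: "i < n" "j < n" using W by (auto simp: mat_diag_def)
  have "W $$ (i, j) * d j = e i * W $$ (i, j)"
    using arg_cong[OF eq, of "\<lambda>M. M $$ (i, j)"] ij
    by (simp add: mat_diag_mult_left[OF W] mat_diag_mult_right[OF W])
  then have "W $$ (i, j) = 0 \<or> d j = e i" by auto
  then show "(W * mat_diag n (\<lambda>i. g (d i))) $$ (i, j) = (mat_diag n (\<lambda>i. g (e i)) * W) $$ (i, j)"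
    using ij by (auto simp: mat_diag_mult_left[OF W] mat_diag_mult_right[OF W])
qed (use W in \<open>auto simp: mat_diag_def\<close>)

text \<open>Turns the comparison of two diagonalizations into an intertwining relation. Uniqueness
  reads it forwards for the eigenvalues and backwards for their images under
  \<open>g\<close>.\<close>

lemma orthogonal_diag_shift:
  assumes U: "is_orthogonal n U" and V: "is_orthogonal n V"
    and D: "D \<in> carrier_mat n n" and E: "E \<in> carrier_mat n n"
  shows "U * D * transpose_mat U = V * E * transpose_mat V
    \<longleftrightarrow> (transpose_mat V * U) * D = E * (transpose_mat V * U)"
proof -
  note u = is_orthogonalD[OF U] and v = is_orthogonalD[OF V]
  note assoc = assoc_mult_mat[of _ n n _ n _ n]
  show ?thesis
  proof
    assume *: "U * D * transpose_mat U = V * E * transpose_mat V"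
    have "(transpose_mat V * U) * D = transpose_mat V * (U * D * transpose_mat U) * U"
      using u v D by (simp add: assoc)
    also have "\<dots> = (transpose_mat V * V) * (E * (transpose_mat V * U))"
      unfolding * using u(1,2) v(1,2) E by (simp add: assoc)
    finally show "(transpose_mat V * U) * D = E * (transpose_mat V * U)"
      using u v E by simp
  next
    assume *: "(transpose_mat V * U) * D = E * (transpose_mat V * U)"
    have "U * D * transpose_mat U = (V * transpose_mat V) * U * D * transpose_mat U"
      using u v D by simp
    also have "\<dots> = V * ((transpose_mat V * U) * D) * transpose_mat U"
      using u(1,2) v(1,2) D by (simp add: assoc)
    also have "\<dots> = V * E * (transpose_mat V * (U * transpose_mat U))"
      unfolding * using u(1,2) v(1,2) E by (simp add: assoc)
    finally show "U * D * transpose_mat U = V * E * transpose_mat V"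
      using u v E by simp
  qed
qed

lemma spectral_image_unique:
  assumes "spectral_image n g A B" "spectral_image n g A C"
  shows "B = C"
proof -
  obtain U d where U: "is_orthogonal n U" "A = U * mat_diag n d * transpose_mat U"
    "B = U * mat_diag n (\<lambda>i. g (d i)) * transpose_mat U"
    using assms(1) by (auto simp: spectral_image_def)
  obtain V e where V: "is_orthogonal n V" "A = V * mat_diag n e * transpose_mat V"
    "C = V * mat_diag n (\<lambda>i. g (e i)) * transpose_mat V"
    using assms(2) by (auto simp: spectral_image_def)
  have c: "transpose_mat V * U \<in> carrier_mat n n"
    using is_orthogonalD[OF U(1)] is_orthogonalD[OF V(1)] by auto
  have "(transpose_mat V * U) * mat_diag n d = mat_diag n e * (transpose_mat V * U)"
    using U V by (subst orthogonal_diag_shift[symmetric]) auto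
  from diag_intertwine[OF c this] show ?thesis
    unfolding U(3) V(3) by (subst orthogonal_diag_shift[OF U(1) V(1)]) auto
qed

lemma fun_calc_eqI: "spectral_image n g A B \<Longrightarrow> fun_calc n g A = B"
  unfolding fun_calc_eq_The by (blast intro: the_equality spectral_image_unique)

lemma spectral_image_fun_calc:
  assumes "A \<in> sym_mats n"
  shows "spectral_image n g A (fun_calc n g A)"
proof -
  obtain B where "spectral_image n g A B"
    using spectral_decomposition[OF assms] by (auto simp: spectral_image_def)
  then show ?thesis by (simp add: fun_calc_eqI)
qed

subsection \<open>Lebesgue measure on the cones\<close>

text \<open>The quadratic form is the squared length of \<open>transpose_mat M *\<^sub>v v\<close>.
  General invertible \<open>M\<close> is allowed since reversal leads to an upper triangular
  factor.\<close>

lemma gram_mat_PD: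
  assumes M: "M \<in> carrier_mat n n" and det: "Determinant.det M \<noteq> 0"
  shows "M * transpose_mat M \<in> PD n"
proof -
  have "v \<bullet> (M * transpose_mat M *\<^sub>v v) > 0" if v: "v \<in> carrier_vec n" "v \<noteq> 0\<^sub>v n" for v
  proof -
    let ?w = "transpose_mat M *\<^sub>v v"
    have w: "?w \<in> carrier_vec n" using M by (intro mult_mat_vec_carrier[of _ n n] v) simp
    have tM: "transpose_mat M \<in> carrier_mat n n" using M by simp
    have "Determinant.det (transpose_mat M) \<noteq> 0" using det by (simp add: Determinant.det_transpose[OF M])
    then have "?w \<noteq> 0\<^sub>v n"
      unfolding det_0_iff_vec_prod_zero[OF tM] using v by blast
    then obtain k where k: "k < n" "vec_index ?w k \<noteq> 0"
      using w by (metis carrier_vecD eq_vecI index_zero_vec(1,2))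
    have "v \<bullet> (M * transpose_mat M *\<^sub>v v) = v \<bullet> (M *\<^sub>v ?w)"
      using M v by (simp add: assoc_mult_mat_vec[of _ n n _ n])
    also have "\<dots> = ?w \<bullet> ?w"
      using transpose_vec_mult_scalar[OF M w v(1)] by simp
    also have "\<dots> = (\<Sum>i<n. vec_index ?w i * vec_index ?w i)"
      unfolding scalar_prod_def carrier_vecD[OF w] lessThan_atLeast0 ..
    also have "\<dots> > 0"
      using k by (intro sum_pos2[of _ k]) (auto simp: zero_less_mult_iff linorder_neq_iff)
    finally show ?thesis .
  qed
  moreover have "transpose_mat (M * transpose_mat M) = M * transpose_mat M"
    using M by (subst transpose_mult[of _ n n]) auto
  ultimately show ?thesis using M by (simp add: PD_def sym_mats_def)
qed

lemma det_lower_pos: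
  assumes L: "L \<in> lower_pos n"
  shows "0 < Determinant.det L"
proof -
  have "Determinant.det L = (\<Prod>i = 0..<n. L $$ (i, i))"
    using L by (subst det_lower_triangular[of n]) (auto simp: lower_pos_def prod_list_diag_prod)
  also have "\<dots> > 0" using L by (intro prod_pos) (auto simp: lower_pos_def)
  finally show ?thesis .
qed

lemma quadratic_form_sum:
  fixes A :: "real mat"
  assumes "A \<in> carrier_mat n n" "v \<in> carrier_vec n"
  shows "v \<bullet> (A *\<^sub>v v) = (\<Sum>r<n. \<Sum>c<n. vec_index v r * A $$ (r, c) * vec_index v c)"
  using assms by (simp add: scalar_prod_def lessThan_atLeast0 sum_distrib_left mult.assoc)

text \<open>A unit eigenvector of the leading block, padded with zeros, gives the quadratic form of
  \<open>A\<close> the corresponding eigenvalue as its value. So all eigenvalues of the block are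
  positive, and its determinant is their product.\<close>

lemma PD_leading_minor_pos:
  assumes A: "A \<in> PD n" and k: "k \<le> n"
  shows "0 < leading_minor k A"
proof -
  have sA: "A \<in> sym_mats n"
    and pos: "\<And>v. v \<in> carrier_vec n \<Longrightarrow> v \<noteq> 0\<^sub>v n \<Longrightarrow> v \<bullet> (A *\<^sub>v v) > 0"
    using A by (auto simp: PD_def)
  have cA: "A \<in> carrier_mat n n" using sA by (rule sym_mats_carrier)
  define M where "M = Matrix.mat k k (\<lambda>(i, j). A $$ (i, j))"
  have M: "M \<in> sym_mats k"
    using sym_mats_index[OF sA] k by (auto simp: sym_mats_def M_def)
  have cM: "M \<in> carrier_mat k k" using M by (rule sym_mats_carrier)
  obtain U d where U: "is_orthogonal k U" and eq: "M = U * mat_diag k d * transpose_mat U"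
    using spectral_decomposition[OF M] by auto
  note u = is_orthogonalD[OF U]
  have "M * U = U * mat_diag k d"
    unfolding eq using u(1,2,4)
    by (subst assoc_mult_mat[of "U * mat_diag k d" k k _ k _ k])
      (auto intro!: right_mult_one_mat[of _ k k] mult_carrier_mat[of _ k k])
  then have D: "transpose_mat U * (M * U) = (transpose_mat U * U) * mat_diag k d"
    using u(1,2) by (simp add: assoc_mult_mat[of _ k k _ k _ k])
  have dpos: "0 < d i" if i: "i < k" for i
  proof -
    define v where "v = Matrix.vec n (\<lambda>j. if j < k then U $$ (j, i) else 0)"
    have v: "v \<in> carrier_vec n" by (simp add: v_def)
    have "v \<noteq> 0\<^sub>v n"
    proof
      assume "v = 0\<^sub>v n"
      then have "vec_index v j = 0" if "j < k" for j
        using that k by (simp only: index_zero_vec)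
      then have "U $$ (j, i) = 0" if "j < k" for j
        using that k by (fastforce simp: v_def)
      then have "(transpose_mat U * U) $$ (i, i) = 0"
        using i u(1) by (simp add: scalar_prod_def)
      then show False using u(4) i by simp
    qed
    then have "0 < v \<bullet> (A *\<^sub>v v)" by (intro pos v)
    also have "\<dots> = (\<Sum>r<n. \<Sum>c<n. vec_index v r * A $$ (r, c) * vec_index v c)"
      by (rule quadratic_form_sum[OF cA v])
    also have "\<dots> = (\<Sum>r<k. \<Sum>c<n. vec_index v r * A $$ (r, c) * vec_index v c)"
      using k by (intro sum.mono_neutral_right) (auto simp: v_def)
    also have "\<dots> = (\<Sum>r<k. \<Sum>c<k. vec_index v r * A $$ (r, c) * vec_index v c)"
      using k by (intro sum.cong[OF refl] sum.mono_neutral_right) (auto simp: v_def)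
    also have "\<dots> = (\<Sum>r<k. \<Sum>c<k. U $$ (r, i) * M $$ (r, c) * U $$ (c, i))"
      using k by (intro sum.cong) (auto simp: v_def M_def)
    also have "\<dots> = (transpose_mat U * (M * U)) $$ (i, i)"
      using i u(1) cM by (simp add: scalar_prod_def lessThan_atLeast0 sum_distrib_left mult.assoc)
    also have "transpose_mat U * (M * U) = mat_diag k d"
      unfolding D u(4) by (rule left_mult_one_mat[OF mat_diag_dim])
    finally show ?thesis using i by (simp add: mat_diag_def)
  qed
  have "Determinant.det U * Determinant.det U = Determinant.det (transpose_mat U * U)"
    using u(1,2) by (simp add: Determinant.det_mult[of _ k] Determinant.det_transpose)
  then have detU: "Determinant.det U * Determinant.det U = 1" by (simp add: u(4))
  have "Determinant.det M = Determinant.det U * Determinant.det (mat_diag k d) * Determinant.det U"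
    unfolding eq using u(1,2) by (simp add: Determinant.det_mult[of _ k] Determinant.det_transpose)
  then have "Determinant.det M = Determinant.det (mat_diag k d)"
    using detU by (simp add: mult.commute mult.left_commute)
  also have "\<dots> = (\<Prod>i = 0..<k. d i)"
    by (subst det_lower_triangular[of k]) (auto simp: mat_diag_def prod_list_diag_prod)
  also have "\<dots> > 0" using dpos by (intro prod_pos) auto
  finally show ?thesis by (simp add: leading_minor_def M_def)
qed

text \<open>Sylvester's criterion: positive leading minors give one inclusion, the Cholesky
  factorization the other.\<close>

lemma PD_eq_mat_cone: "PD n = mat_cone n (\<lambda>_. 1)"
proof (intro equalityI subsetI)
  have one: "(\<lambda>_. 1) \<in> sign_patterns n" by (auto simp: sign_patterns_def)
  have entry: "sign_entry (\<lambda>_. 1) = (\<lambda>_. 1)" by (auto simp: sign_entry_def)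
  fix A assume A: "A \<in> PD n"
  then have "A \<in> LPM n (\<lambda>_. 1)"
    using PD_leading_minor_pos[OF A] by (auto simp: LPM_def PD_def)
  then show "A \<in> mat_cone n (\<lambda>_. 1)" by (simp add: LPM_eq_mat_cone[OF one] entry)
next
  fix A assume "A \<in> mat_cone n (\<lambda>_. 1)"
  then obtain L where L: "L \<in> lower_pos n" "A = Phi_low (1\<^sub>m n) L"
    by (auto simp: mat_cone_eq_image_Phi_low signs_def)
  then have "A = L * transpose_mat L" using lower_pos_carrier[OF L(1)] by (simp add: Phi_low_def)
  then show "A \<in> PD n"
    using gram_mat_PD[OF lower_pos_carrier[OF L(1)]] det_lower_pos[OF L(1)] by simp
qed

text \<open>Both coordinate vectors have the same Cholesky factor. Here the map defined through
  \<open>the_inv_into\<close> is identified with the explicit measure preserving one.\<close>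

lemma LPM_to_PD_sym_of_coords:
  assumes d: "\<epsilon> \<in> sign_patterns n" and a: "a \<in> chol_cone n (sign_entry \<epsilon>)"
  shows "LPM_to_PD n \<epsilon> (sym_of_coords n a) = sym_of_coords n (transfer (sign_entry \<epsilon>) (\<lambda>_. 1) n a)"
proof -
  let ?d = "sign_entry \<epsilon>" and ?b = "transfer (sign_entry \<epsilon>) (\<lambda>_. 1) n a"
  note d = signs_sign_entry[OF d]
  have one: "signs n (\<lambda>_. 1)" by (simp add: signs_def)
  have "chol_mat n (\<lambda>_. 1) ?b = chol_mat n ?d a"
  proof (rule eq_matI)
    fix i j assume "i < dim_row (chol_mat n ?d a)" "j < dim_col (chol_mat n ?d a)"
    then show "chol_mat n (\<lambda>_. 1) ?b $$ (i, j) = chol_mat n ?d a $$ (i, j)"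
      by (cases "j \<le> i") (auto simp: chol_mat_def chol_transfer[OF one] chol_above)
  qed (auto simp: chol_mat_def)
  then have "LPM_to_PD n \<epsilon> (sym_of_coords n a) = Phi_low (mat_diag n (\<lambda>_. 1)) (chol_mat n (\<lambda>_. 1) ?b)"
    by (simp add: LPM_to_PD_def sign_diag_eq the_inv_into_Phi_low[OF d a])
  also have "\<dots> = sym_of_coords n ?b"
    by (rule Phi_low_chol_mat[OF one transfer_chol_cone[OF one a]])
  finally show ?thesis .
qed

lemma LPM_to_PD_Phi_low:
  assumes "\<epsilon> \<in> sign_patterns n" "L \<in> lower_pos n"
  shows "LPM_to_PD n \<epsilon> (Phi_low (sign_diag n \<epsilon>) L) = Phi_low (1\<^sub>m n) L"
  using assms by (simp add: LPM_to_PD_def sign_diag_eq the_inv_into_f_f[OF inj_on_Phi_low] signs_sign_entry)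

lemma LPM_eq_image_Phi_low:
  assumes "\<epsilon> \<in> sign_patterns n"
  shows "LPM n \<epsilon> = Phi_low (sign_diag n \<epsilon>) ` lower_pos n"
  using assms by (simp add: LPM_eq_mat_cone mat_cone_eq_image_Phi_low signs_sign_entry sign_diag_eq)

lemma sets_mat_cone: "mat_cone n d \<in> sets (sym_lebesgue n)"
proof -
  have "chol_cone n d \<inter> space (coord_space n) \<in> sets (completion (coord_space n))"
    by (intro sets_completionI_sets chol_cone_measurable)
  then show ?thesis
    unfolding sym_lebesgue_def mat_cone_def space_coord_space by (rule in_sets_embed_measure)
qed

lemma measure_iso_sym_of_coords:
  "measure_iso (completion (coord_space n)) (sym_lebesgue n) (sym_of_coords n) (coords_of n)"
proof -
  have inj: "inj_on (sym_of_coords n) (space (completion (coord_space n)))"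
    using inj_on_sym_of_coords[of n] by (simp add: space_coord_space)
  have "measure_iso (completion (coord_space n)) (sym_lebesgue n) (sym_of_coords n)
      (the_inv_into (space (completion (coord_space n))) (sym_of_coords n))"
    unfolding sym_lebesgue_def using inj by (rule measure_iso_embed)
  then show ?thesis
  proof (rule measure_iso_cong)
    fix A assume "A \<in> space (sym_lebesgue n)"
    then obtain a where "a \<in> extensional (tri n)" "A = sym_of_coords n a"
      by (auto simp: sym_lebesgue_def space_embed_measure space_coord_space)
    then show "coords_of n A = the_inv_into (space (completion (coord_space n))) (sym_of_coords n) A"
      using inj by (simp add: coords_of_sym_of_coords the_inv_into_f_f space_coord_space)
  qed simp
qed

lemma space_sym_lebesgue: "space (sym_lebesgue n) = sym_mats n"
proof
  show "space (sym_lebesgue n) \<subseteq> sym_mats n"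
    by (auto simp: sym_lebesgue_def space_embed_measure sym_of_coords_sym_mats)
  show "sym_mats n \<subseteq> space (sym_lebesgue n)"
  proof
    fix A assume "A \<in> sym_mats n"
    then have "A = sym_of_coords n (coords_of n A)" by (simp add: sym_of_coords_coords_of)
    then show "A \<in> space (sym_lebesgue n)"
      using coords_of_extensional[of n A]
      by (auto simp: sym_lebesgue_def space_embed_measure space_coord_space)
  qed
qed

lemma measure_iso_sym_lebesgue:
  assumes "measure_iso (coord_space n) (coord_space n) F G"
  shows "measure_iso (sym_lebesgue n) (sym_lebesgue n)
    (\<lambda>A. sym_of_coords n (F (coords_of n A))) (\<lambda>A. sym_of_coords n (G (coords_of n A)))"
proof -
  note E = measure_iso_sym_of_coords[of n]
  show ?thesis
    using measure_iso_comp[OF measure_iso_comp[OF measure_iso_sym[OF E]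
        measure_iso_completion[OF assms]] E]
    by (simp add: o_def)
qed

subsection \<open>Reversal\<close>

lemma rev_mat_carrier [simp]: "A \<in> carrier_mat n n \<Longrightarrow> rev_mat n A \<in> carrier_mat n n"
  by (auto simp: rev_mat_def anti_diag_def)

lemma mat_mult_index:
  fixes A :: "real mat"
  assumes "A \<in> carrier_mat n n" "B \<in> carrier_mat n n" "i < n" "j < n"
  shows "(A * B) $$ (i, j) = (\<Sum>k<n. A $$ (i, k) * B $$ (k, j))"
  using assms by (simp add: scalar_prod_def lessThan_atLeast0)

text \<open>Conjugation by the anti-diagonal permutation is a half turn; together with the
  transposition it becomes the reflection in the anti-diagonal.\<close>

lemma rev_mat_index:
  assumes A: "A \<in> carrier_mat n n" and ij: "i < n" "j < n"
  shows "rev_mat n A $$ (i, j) = A $$ (n - Suc j, n - Suc i)"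
proof -
  have P: "anti_diag n \<in> carrier_mat n n" by (simp add: anti_diag_def)
  have P_index: "anti_diag n $$ (k, l) = (if l = n - Suc k then 1 else 0)"
    "anti_diag n $$ (k, l) = (if k = n - Suc l then 1 else 0)" if "k < n" "l < n" for k l
    using that by (auto simp: anti_diag_def)
  have PA: "(anti_diag n * A) $$ (k, l) = A $$ (n - Suc k, l)" if "k < n" "l < n" for k l
  proof -
    have "(anti_diag n * A) $$ (k, l) = (\<Sum>r<n. anti_diag n $$ (k, r) * A $$ (r, l))"
      using that by (intro mat_mult_index A P)
    also have "\<dots> = (\<Sum>r<n. if r = n - Suc k then A $$ (r, l) else 0)"
      using that by (intro sum.cong) (auto simp: P_index(1))
    finally show ?thesis using that by simp
  qed
  have "rev_mat n A $$ (i, j) = (anti_diag n * A * anti_diag n) $$ (j, i)"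
    using A P ij by (simp add: rev_mat_def)
  also have "\<dots> = (\<Sum>r<n. (anti_diag n * A) $$ (j, r) * anti_diag n $$ (r, i))"
    using ij by (intro mat_mult_index mult_carrier_mat[OF P A] P)
  also have "\<dots> = (\<Sum>r<n. if r = n - Suc i then A $$ (n - Suc j, r) else 0)"
    using ij by (intro sum.cong) (auto simp: P_index(2) PA)
  finally show ?thesis using ij by simp
qed

lemma rev_mat_eqI:
  assumes "A \<in> carrier_mat n n" "B \<in> carrier_mat n n"
    and "\<And>i j. i < n \<Longrightarrow> j < n \<Longrightarrow> A $$ (n - Suc j, n - Suc i) = B $$ (i, j)"
  shows "rev_mat n A = B"
proof (rule eq_matI)
  fix i j assume "i < dim_row B" "j < dim_col B"
  then show "rev_mat n A $$ (i, j) = B $$ (i, j)" using assms by (simp add: rev_mat_index)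
qed (use assms rev_mat_carrier[OF assms(1)] in \<open>auto simp del: rev_mat_carrier\<close>)

lemma rev_mat_rev_mat [simp]: "A \<in> carrier_mat n n \<Longrightarrow> rev_mat n (rev_mat n A) = A"
  by (rule rev_mat_eqI) (auto simp: rev_mat_index)

lemma rev_mat_mult:
  assumes A: "A \<in> carrier_mat n n" and B: "B \<in> carrier_mat n n"
  shows "rev_mat n (A * B) = rev_mat n B * rev_mat n A"
proof (rule rev_mat_eqI)
  fix i j assume ij: "i < n" "j < n"
  have "(A * B) $$ (n - Suc j, n - Suc i) = (\<Sum>k<n. A $$ (n - Suc j, k) * B $$ (k, n - Suc i))"
    using ij by (intro mat_mult_index A B) auto
  also have "\<dots> = (\<Sum>k<n. A $$ (n - Suc j, n - Suc k) * B $$ (n - Suc k, n - Suc i))"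
    by (rule sum.nat_diff_reindex[symmetric])
  also have "\<dots> = (\<Sum>k<n. rev_mat n B $$ (i, k) * rev_mat n A $$ (k, j))"
    using ij by (intro sum.cong) (auto simp: rev_mat_index[OF A] rev_mat_index[OF B])
  also have "\<dots> = (rev_mat n B * rev_mat n A) $$ (i, j)"
    using ij by (intro mat_mult_index[symmetric] rev_mat_carrier A B)
  finally show "(A * B) $$ (n - Suc j, n - Suc i) = (rev_mat n B * rev_mat n A) $$ (i, j)" .
qed (use A B in \<open>auto intro: mult_carrier_mat rev_mat_carrier\<close>)

lemma rev_mat_transpose:
  assumes A: "A \<in> carrier_mat n n"
  shows "rev_mat n (transpose_mat A) = transpose_mat (rev_mat n A)"
proof (rule rev_mat_eqI)
  fix i j assume ij: "i < n" "j < n"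
  then show "transpose_mat A $$ (n - Suc j, n - Suc i) = transpose_mat (rev_mat n A) $$ (i, j)"
    using A rev_mat_carrier[OF A] by (simp add: rev_mat_index del: rev_mat_carrier)
qed (use A in auto)

lemma rev_mat_diag: "rev_mat n (mat_diag n d) = mat_diag n (\<lambda>i. d (n - Suc i))"
  by (rule rev_mat_eqI) (auto simp: mat_diag_def)

lemma rev_mat_one: "rev_mat n (1\<^sub>m n) = 1\<^sub>m n"
  using rev_mat_diag[of n "\<lambda>_. 1"] by simp

lemma rev_mat_sym_mats: "A \<in> sym_mats n \<Longrightarrow> rev_mat n A \<in> sym_mats n"
  using rev_mat_transpose[of A n] by (simp add: sym_mats_def)

lemma rev_mat_lower_pos: "L \<in> lower_pos n \<Longrightarrow> rev_mat n L \<in> lower_pos n"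
  by (auto simp: lower_pos_def rev_mat_index)

lemma det_rev_mat:
  assumes A: "A \<in> carrier_mat n n"
  shows "Determinant.det (rev_mat n A) = Determinant.det A"
proof -
  have P: "anti_diag n \<in> carrier_mat n n" by (simp add: anti_diag_def)
  have "anti_diag n * anti_diag n = 1\<^sub>m n"
  proof -
    \<comment> \<open>That the permutation squares to the identity is read off from the reversal of
      the identity matrix.\<close>
    have "transpose_mat (anti_diag n * 1\<^sub>m n * anti_diag n) = 1\<^sub>m n"
      using rev_mat_one[of n] by (simp add: rev_mat_def)
    then have "transpose_mat (transpose_mat (anti_diag n * anti_diag n)) = transpose_mat (1\<^sub>m n)"
      using right_mult_one_mat[OF P] by simp
    then show ?thesis by simp
  qed
  then have "Determinant.det (anti_diag n) * Determinant.det (anti_diag n) = 1"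
    using Determinant.det_mult[OF P P] by simp
  moreover have "Determinant.det (rev_mat n A)
      = Determinant.det (anti_diag n) * Determinant.det A * Determinant.det (anti_diag n)"
    unfolding rev_mat_def using A P
    by (simp add: Determinant.det_transpose[of _ n] Determinant.det_mult[of _ n])
  ultimately show ?thesis by (simp add: mult.commute mult.left_commute)
qed

lemma mat_tr_rev_mat:
  assumes A: "A \<in> carrier_mat n n"
  shows "mat_tr (rev_mat n A) = mat_tr A"
proof -
  have "mat_tr (rev_mat n A) = (\<Sum>i<n. A $$ (n - Suc i, n - Suc i))"
    using rev_mat_carrier[OF A] by (simp add: mat_tr_def rev_mat_index[OF A] del: rev_mat_carrier)
  also have "\<dots> = (\<Sum>i<n. A $$ (i, i))" by (rule sum.nat_diff_reindex)
  finally show ?thesis using A by (simp add: mat_tr_def)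
qed

text \<open>The trailing block of a reversed matrix is the reversal, in size \<open>k\<close>, of
  the leading block, and reversal keeps determinants.\<close>

lemma trailing_minor_rev_mat:
  assumes A: "A \<in> carrier_mat n n" and k: "k \<le> n"
  shows "trailing_minor n k (rev_mat n A) = leading_minor k A"
proof -
  let ?M = "Matrix.mat k k (\<lambda>(i, j). A $$ (i, j))"
  have "rev_mat k ?M = Matrix.mat k k (\<lambda>(i, j). rev_mat n A $$ (n - k + i, n - k + j))"
    using k by (intro rev_mat_eqI) (auto simp: rev_mat_index[OF A] intro!: arg_cong[of _ _ "($$) A"])
  then show ?thesis
    using det_rev_mat[of ?M k] by (simp add: trailing_minor_def leading_minor_def)
qed

lemma rev_mat_LPM: "A \<in> LPM n \<epsilon> \<Longrightarrow> rev_mat n A \<in> TPM n \<epsilon>"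
  by (auto simp: LPM_def TPM_def rev_mat_sym_mats trailing_minor_rev_mat sym_mats_carrier)

lemma rev_mat_TPM:
  assumes B: "B \<in> TPM n \<epsilon>"
  shows "rev_mat n B \<in> LPM n \<epsilon>"
proof -
  have "B \<in> carrier_mat n n" using B by (auto simp: TPM_def intro: sym_mats_carrier)
  then have c: "rev_mat n B \<in> carrier_mat n n" "B \<in> carrier_mat n n" by simp_all
  show ?thesis
    using B trailing_minor_rev_mat[OF c(1)] c
    by (auto simp: LPM_def TPM_def rev_mat_sym_mats)
qed

lemma rev_mat_PD:
  assumes A: "A \<in> PD n"
  shows "rev_mat n A \<in> PD n"
proof -
  obtain L where L: "L \<in> lower_pos n" "A = Phi_low (1\<^sub>m n) L"
    using A by (auto simp: PD_eq_mat_cone mat_cone_eq_image_Phi_low signs_def)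
  note c = lower_pos_carrier[OF L(1)]
  let ?K = "transpose_mat (rev_mat n L)"
  have "rev_mat n A = ?K * transpose_mat ?K"
    using c L(2) by (simp add: Phi_low_def rev_mat_mult rev_mat_transpose)
  moreover have "Determinant.det ?K \<noteq> 0"
    using det_lower_pos[OF L(1)] c by (simp add: Determinant.det_transpose[of _ n] det_rev_mat)
  ultimately show ?thesis using gram_mat_PD[of ?K n] c by simp
qed

lemma Phi_up_rev_mat:
  assumes D: "D \<in> carrier_mat n n" and L: "L \<in> carrier_mat n n"
  shows "Phi_up (rev_mat n D) (rev_mat n L) = rev_mat n (Phi_low D L)"
proof -
  have "rev_mat n (L * D * transpose_mat L) = rev_mat n (transpose_mat L) * rev_mat n (L * D)"
    using D L by (intro rev_mat_mult) auto
  also have "\<dots> = transpose_mat (rev_mat n L) * (rev_mat n D * rev_mat n L)"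
    using D L by (simp only: rev_mat_mult rev_mat_transpose)
  also have "\<dots> = transpose_mat (rev_mat n L) * rev_mat n D * rev_mat n L"
    using rev_mat_carrier[OF D] rev_mat_carrier[OF L]
    by (intro assoc_mult_mat[symmetric, of _ n n _ n _ n]) auto
  finally show ?thesis by (simp add: Phi_up_def Phi_low_def)
qed

lemma sign_diag_carrier: "sign_diag n \<epsilon> \<in> carrier_mat n n"
  by (simp add: sign_diag_eq)

lemma sign_diag_rev_pattern:
  assumes e: "\<epsilon> \<in> sign_patterns n"
  shows "sign_diag n (rev_pattern n \<epsilon>) = rev_mat n (sign_diag n \<epsilon>)"
proof -
  have "sign_entry (rev_pattern n \<epsilon>) i = sign_entry \<epsilon> (n - Suc i)" if i: "i < n" for i
  proof -
    have sq: "\<epsilon> n * \<epsilon> n = 1" using sign_patternsD[OF e, of n] i by auto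
    \<comment> \<open>\<open>sign_entry\<close> branches at its first index and
      \<open>rev_pattern\<close> at \<open>k = n\<close>. For i > 0 two factors
      \<open>\<epsilon> n\<close> occur and cancel.\<close>
    consider "i = 0" "n = 1" | "i = 0" "1 < n" | "0 < i" "Suc i = n" | "0 < i" "Suc i < n"
      using i by linarith
    then show ?thesis
    proof cases
      case 3
      then have "n - i = 1" by simp
      with 3 show ?thesis
        using sq by (auto simp: sign_entry_def rev_pattern_def)
    next
      case 4
      then have "n - i = Suc (n - Suc i)" by simp
      with 4 show ?thesis
        using sq by (auto simp: sign_entry_def rev_pattern_def)
    qed (auto simp: sign_entry_def rev_pattern_def mult.commute)
  qed
  then show ?thesis
    unfolding sign_diag_eq rev_mat_diag by (intro eq_matI) (auto simp: mat_diag_def)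
qed

lemma Phi_up_sign_diag:
  assumes "\<epsilon> \<in> sign_patterns n" "K \<in> carrier_mat n n"
  shows "Phi_up (sign_diag n (rev_pattern n \<epsilon>)) K = rev_mat n (Phi_low (sign_diag n \<epsilon>) (rev_mat n K))"
  using Phi_up_rev_mat[of "sign_diag n \<epsilon>" n "rev_mat n K"] assms
  by (simp add: sign_diag_rev_pattern sign_diag_carrier)

text \<open>Reversal turns \<open>Phi_up\<close> into \<open>Phi_low\<close> on the same set
  \<open>lower_pos n\<close>. Injectivity has to be carried over too, as it gives
  \<open>the_inv_into\<close> its meaning.\<close>

lemma TPM_to_PD_eq:
  assumes e: "\<epsilon> \<in> sign_patterns n" and B: "B \<in> TPM n \<epsilon>"
  shows "TPM_to_PD n \<epsilon> B = rev_mat n (LPM_to_PD n \<epsilon> (rev_mat n B))"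
proof -
  let ?D = "sign_diag n \<epsilon>" and ?E = "sign_diag n (rev_pattern n \<epsilon>)"
  have cB: "B \<in> carrier_mat n n" using B by (auto simp: TPM_def intro: sym_mats_carrier)
  obtain L where L: "L \<in> lower_pos n" "rev_mat n B = Phi_low ?D L"
    using rev_mat_TPM[OF B] by (auto simp: LPM_eq_image_Phi_low[OF e])
  note cL = lower_pos_carrier[OF L(1)]
  have inj: "inj_on (Phi_up ?E) (lower_pos n)"
  proof (rule inj_onI)
    fix K K' assume K: "K \<in> lower_pos n" "K' \<in> lower_pos n" and eq: "Phi_up ?E K = Phi_up ?E K'"
    note c = lower_pos_carrier[OF K(1)] lower_pos_carrier[OF K(2)]
    have Phi: "Phi_low ?D X \<in> carrier_mat n n" if "X \<in> carrier_mat n n" for X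
      unfolding sign_diag_eq by (rule sym_mats_carrier[OF Phi_low_sym_mats[OF that]])
    have "Phi_low ?D (rev_mat n K) = Phi_low ?D (rev_mat n K')"
      using arg_cong[OF eq, of "rev_mat n"] c Phi by (simp add: Phi_up_sign_diag[OF e])
    then have "rev_mat n K = rev_mat n K'"
      using inj_on_Phi_low[OF signs_sign_entry[OF e]] K
      unfolding sign_diag_eq by (auto dest: inj_onD intro: rev_mat_lower_pos)
    then show "K = K'" using c by (metis rev_mat_rev_mat)
  qed
  have "Phi_up ?E (rev_mat n L) = B"
    using cL cB by (simp add: Phi_up_sign_diag[OF e] flip: L(2))
  then have "the_inv_into (lower_pos n) (Phi_up ?E) B = rev_mat n L"
    using inj L(1) by (intro the_inv_into_f_eq rev_mat_lower_pos)
  then have "TPM_to_PD n \<epsilon> B = Phi_up (1\<^sub>m n) (rev_mat n L)" by (simp add: TPM_to_PD_def)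
  also have "\<dots> = rev_mat n (Phi_low (1\<^sub>m n) L)"
    using Phi_up_rev_mat[OF one_carrier_mat cL] by (simp add: rev_mat_one)
  also have "Phi_low (1\<^sub>m n) L = LPM_to_PD n \<epsilon> (rev_mat n B)"
    unfolding L(2) by (rule LPM_to_PD_Phi_low[OF e L(1), symmetric])
  finally show ?thesis .
qed

text \<open>All factors are equal, so a box pulls back to a box of the same volume with permuted
  sides.\<close>

lemma measure_iso_PiM_involution:
  assumes I: "finite I" and s: "\<And>i. i \<in> I \<Longrightarrow> \<sigma> i \<in> I" "\<And>i. i \<in> I \<Longrightarrow> \<sigma> (\<sigma> i) = i"
  shows "measure_iso (PiM I (\<lambda>_. lborel :: real measure)) (PiM I (\<lambda>_. lborel))
    (\<lambda>x. \<lambda>i\<in>I. x (\<sigma> i)) (\<lambda>x. \<lambda>i\<in>I. x (\<sigma> i))"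
proof -
  interpret product_sigma_finite "\<lambda>_. lborel :: real measure" by (rule sigma_finite_lborel_product)
  let ?M = "PiM I (\<lambda>_. lborel :: real measure)" and ?T = "\<lambda>x. \<lambda>i\<in>I. x (\<sigma> i)"
  have T: "?T \<in> ?M \<rightarrow>\<^sub>M ?M"
    by (intro measurable_restrict measurable_component_singleton s)
  have bij: "bij_betw \<sigma> I I" using s by (intro bij_betwI[where g = \<sigma>]) auto
  have "distr ?M ?M ?T = ?M"
  proof (rule PiM_eqI[OF I])
    fix A :: "'a \<Rightarrow> real set" assume A: "\<And>i. i \<in> I \<Longrightarrow> A i \<in> sets lborel"
    have "?T -` Pi\<^sub>E I A \<inter> space ?M = Pi\<^sub>E I (\<lambda>i. A (\<sigma> i))"
    proof (intro equalityI subsetI)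
      fix x assume "x \<in> ?T -` Pi\<^sub>E I A \<inter> space ?M"
      then have x: "\<And>i. i \<in> I \<Longrightarrow> x (\<sigma> i) \<in> A i" "x \<in> extensional I"
        by (auto simp: space_PiM PiE_iff)
      show "x \<in> Pi\<^sub>E I (\<lambda>i. A (\<sigma> i))"
        using x(2) x(1)[OF s(1)] s(2) by (auto simp: PiE_iff)
    next
      fix x assume "x \<in> Pi\<^sub>E I (\<lambda>i. A (\<sigma> i))"
      then have x: "\<And>i. i \<in> I \<Longrightarrow> x i \<in> A (\<sigma> i)" "x \<in> extensional I"
        by (auto simp: PiE_iff)
      show "x \<in> ?T -` Pi\<^sub>E I A \<inter> space ?M"
        using x(2) x(1)[OF s(1)] s(2) by (auto simp: PiE_iff space_PiM)
    qed
    then have "emeasure (distr ?M ?M ?T) (Pi\<^sub>E I A) = emeasure ?M (Pi\<^sub>E I (\<lambda>i. A (\<sigma> i)))"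
      using T A I by (subst emeasure_distr) (auto intro!: sets_PiM_I_finite)
    also have "\<dots> = (\<Prod>i\<in>I. emeasure lborel (A (\<sigma> i)))"
      using A s by (intro emeasure_PiM I) auto
    also have "\<dots> = (\<Prod>i\<in>I. emeasure lborel (A i))"
      by (rule prod.reindex_bij_betw[OF bij])
    finally show "emeasure (distr ?M ?M ?T) (Pi\<^sub>E I A) = (\<Prod>i\<in>I. emeasure lborel (A i))" .
  qed simp
  moreover have "?T (?T x) = x" if "x \<in> space ?M" for x
  proof (rule extensionalityI[of _ I])
    show "x \<in> extensional I" using that by (auto simp: space_PiM PiE_iff)
    fix i assume i: "i \<in> I"
    then show "?T (?T x) i = x i" using s(1)[OF i] s(2)[OF i] by simp
  qed simp
  ultimately show ?thesis using T unfolding measure_iso_def by blast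
qed

lemma measure_iso_rev_mat: "measure_iso (sym_lebesgue n) (sym_lebesgue n) (rev_mat n) (rev_mat n)"
proof -
  \<comment> \<open>The reflection in the anti-diagonal maps the lower triangle onto itself, so it
    permutes the coordinates without any recourse to the upper triangle.\<close>
  define \<sigma> where "\<sigma> = (\<lambda>(i, j). (n - Suc j, n - Suc i))"
  let ?T = "\<lambda>x. \<lambda>p\<in>tri n. x (\<sigma> p)"
  have iso: "measure_iso (coord_space n) (coord_space n) ?T ?T"
    by (rule measure_iso_PiM_involution) (auto simp: \<sigma>_def)
  have "rev_mat n A = sym_of_coords n (?T (coords_of n A))" if A: "A \<in> sym_mats n" for A
  proof (rule sym_mats_eqI[OF rev_mat_sym_mats[OF A] sym_of_coords_sym_mats])
    fix i j assume ij: "j \<le> i" "i < n"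
    have "rev_mat n A $$ (i, j) = A $$ (n - Suc j, n - Suc i)"
      using ij by (intro rev_mat_index sym_mats_carrier A) auto
    then show "rev_mat n A $$ (i, j) = sym_of_coords n (?T (coords_of n A)) $$ (i, j)"
      using ij by (simp add: sym_of_coords_index \<sigma>_def coords_of_apply)
  qed
  then show ?thesis
    using measure_iso_sym_lebesgue[OF iso] by (rule_tac measure_iso_cong) (auto simp: space_sym_lebesgue)
qed

subsection \<open>The Jacobian matrix\<close>

lemma lex_coords_Suc: "lex_coords (Suc n) = lex_coords n @ map (\<lambda>j. (n, j)) [0..<Suc n]"
  by (simp add: lex_coords_def)

lemma set_lex_coords: "set (lex_coords n) = tri n"
proof (induction n)
  case 0
  then show ?case by (simp add: lex_coords_def tri_def)
next
  case (Suc n)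
  have "set (lex_coords (Suc n)) = tri n \<union> Pair n ` {0..<Suc n}"
    by (simp only: lex_coords_Suc set_append set_map set_upt Suc)
  then show ?case by (auto simp: tri_def less_Suc_eq image_iff)
qed

lemma sorted_lex_coords: "sorted_wrt (\<lambda>(i, j) (k, l). i < k \<or> i = k \<and> j < l) (lex_coords n)"
proof (induction n)
  case 0
  then show ?case by (simp add: lex_coords_def)
next
  case (Suc n)
  have "sorted_wrt (\<lambda>i j. i < j) [0..<Suc n]" by (rule sorted_wrt_upt)
  then have "sorted_wrt (\<lambda>(i, j) (k, l). i < k \<or> i = k \<and> j < l) (map (\<lambda>j. (n, j)) [0..<Suc n])"
    by (simp only: sorted_wrt_map) simp
  with Suc show ?case
    unfolding lex_coords_Suc sorted_wrt_append set_lex_coords by (auto simp: tri_def)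
qed

text \<open>Product rule for \<Sum>r. d_r l_ir l_jr with respect to l_kl. The two summands coincide
  for i = j = k, which is the origin of the factor 2 on n diagonal places.\<close>

definition Phi_low_jacobian :: "nat \<Rightarrow> (nat \<Rightarrow> real) \<Rightarrow> real mat \<Rightarrow> nat \<times> nat \<Rightarrow> nat \<times> nat \<Rightarrow> real" where
  "Phi_low_jacobian n d L = (\<lambda>(i, j) (k, l).
     d l * ((if i = k then L $$ (j, l) else 0) + (if j = k then L $$ (i, l) else 0)))"

lemma Phi_low_has_derivative_entry:
  assumes L: "L \<in> carrier_mat n n" and ij: "i < n" "j < n" and kl: "k < n" "l < n"
  shows "((\<lambda>t. Phi_low (mat_diag n d) (upd_entry L (k, l) t) $$ (i, j)) has_real_derivative
    Phi_low_jacobian n d L (i, j) (k, l)) (at (L $$ (k, l)))"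
proof -
  define X where "X r s t = (if (r, s) = (k, l) then t else L $$ (r, s))" for r s t
  have X: "((\<lambda>t. X r s t) has_real_derivative (if (r, s) = (k, l) then 1 else 0)) (at t)" for r s t
    by (cases "(r, s) = (k, l)") (auto simp: X_def)
  have X0: "X r s (L $$ (k, l)) = L $$ (r, s)" for r s by (simp add: X_def)
  have "Phi_low (mat_diag n d) (upd_entry L (k, l) t) $$ (i, j) = (\<Sum>r<n. d r * X i r t * X j r t)" for t
  proof -
    have "upd_entry L (k, l) t \<in> carrier_mat n n" using L by (simp add: upd_entry_def)
    from Phi_low_index[OF this ij] show ?thesis
      using L ij by (simp add: upd_entry_def X_def)
  qed
  moreover have "((\<lambda>t. \<Sum>r<n. d r * X i r t * X j r t) has_real_derivative
      (\<Sum>r<n. d r * (if (i, r) = (k, l) then 1 else 0) * L $$ (j, r)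
        + d r * L $$ (i, r) * (if (j, r) = (k, l) then 1 else 0))) (at (L $$ (k, l)))"
    by (rule DERIV_sum, rule DERIV_cong, rule DERIV_mult[OF DERIV_cmult[OF X] X])
      (simp add: X0)
  moreover have "(\<Sum>r<n. d r * (if (i, r) = (k, l) then 1 else 0) * L $$ (j, r)
        + d r * L $$ (i, r) * (if (j, r) = (k, l) then 1 else 0))
      = (\<Sum>r<n. if r = l then Phi_low_jacobian n d L (i, j) (k, l) else 0)"
    by (intro sum.cong) (auto simp: Phi_low_jacobian_def algebra_simps)
  ultimately show ?thesis using kl by simp
qed

text \<open>If i < k, then neither \<open>i\<close> nor \<open>j\<close> equals \<open>k\<close>. If
  i = k and j < l, then j < k as well, and the remaining summand contains an entry of
  \<open>L\<close> above the diagonal.\<close>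

lemma Phi_low_jacobian_lower:
  assumes "L \<in> lower_pos n" "j \<le> i" "l \<le> k" "k < n" "i < k \<or> i = k \<and> j < l"
  shows "Phi_low_jacobian n d L (i, j) (k, l) = 0"
  using assms by (auto simp: Phi_low_jacobian_def lower_pos_def)

text \<open>Row \<open>i\<close> contributes 2 x_0 ... x_i. The factor x_j occurs in the n - j rows
  from \<open>j\<close> on.\<close>

lemma prod_lex_coords:
  fixes f :: "nat \<times> nat \<Rightarrow> real" and x :: "nat \<Rightarrow> real"
  assumes "\<And>i j. j \<le> i \<Longrightarrow> i < n \<Longrightarrow> \<bar>f (i, j)\<bar> = (if j = i then 2 else 1) * x j"
  shows "\<bar>prod_list (map f (lex_coords n))\<bar> = 2 ^ n * (\<Prod>j<n. x j ^ (n - j))"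
  using assms
proof (induction n)
  case 0
  then show ?case by (simp add: lex_coords_def)
next
  case (Suc n)
  have row: "\<bar>prod_list (map (\<lambda>j. f (n, j)) [0..<Suc n])\<bar> = 2 * (\<Prod>j<Suc n. x j)"
  proof -
    have "\<bar>prod_list (map (\<lambda>j. f (n, j)) [0..<Suc n])\<bar> = (\<Prod>j<Suc n. \<bar>f (n, j)\<bar>)"
      by (simp only: prod.distinct_set_conv_list[OF distinct_upt, symmetric] abs_prod
        atLeast0LessThan set_upt)
    also have "\<dots> = (\<Prod>j<Suc n. (if j = n then 2 else 1) * x j)"
      using Suc.prems by (intro prod.cong) auto
    finally show ?thesis by (simp add: prod.distrib)
  qed
  have IH: "\<bar>prod_list (map f (lex_coords n))\<bar> = 2 ^ n * (\<Prod>j<n. x j ^ (n - j))"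
    using Suc.prems by (intro Suc.IH) auto
  have split: "prod_list (map f (lex_coords (Suc n)))
      = prod_list (map f (lex_coords n)) * prod_list (map (\<lambda>j. f (n, j)) [0..<Suc n])"
    by (simp only: lex_coords_Suc map_append prod_list.append map_map o_def)
  have "(\<Prod>j<Suc n. x j ^ (Suc n - j)) = (\<Prod>j<Suc n. x j * x j ^ (n - j))"
    by (intro prod.cong) (auto simp: Suc_diff_le)
  also have "\<dots> = (\<Prod>j<Suc n. x j) * (\<Prod>j<n. x j ^ (n - j))"
    by (simp add: prod.distrib)
  finally have powers: "(\<Prod>j<Suc n. x j ^ (Suc n - j)) = (\<Prod>j<Suc n. x j) * (\<Prod>j<n. x j ^ (n - j))" .
  show ?case
    unfolding split abs_mult IH row powers by (simp only: power_Suc ac_simps)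
qed

lemma Phi_low_jacobian_matrix:
  assumes d: "signs n d" and L: "L \<in> lower_pos n"
  shows "\<exists>J. is_jacobian n (Phi_low (mat_diag n d)) L J \<and> is_lower_triangular J \<and>
    \<bar>Determinant.det J\<bar> = 2 ^ n * (\<Prod>j = 1..n. (L $$ (j - 1, j - 1)) ^ (n + 1 - j))"
proof -
  define c where "c = lex_coords n"
  define m where "m = length c"
  define J where "J = Matrix.mat m m (\<lambda>(p, q). Phi_low_jacobian n d L (c ! p) (c ! q))"
  have J: "J \<in> carrier_mat m m" by (simp add: J_def)
  have c_tri: "c ! p \<in> tri n" if "p < m" for p
    using nth_mem[of p c] that by (simp add: c_def m_def set_lex_coords)
  have jac: "is_jacobian n (Phi_low (mat_diag n d)) L J"
    unfolding is_jacobian_def Let_def c_def[symmetric] m_def[symmetric]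
  proof (intro conjI allI impI J)
    fix p q assume pq: "p < m" "q < m"
    obtain i j k l where "c ! p = (i, j)" "c ! q = (k, l)" by (meson surj_pair)
    then show "((\<lambda>t. Phi_low (mat_diag n d) (upd_entry L (c ! q) t) $$ (c ! p)) has_real_derivative
        J $$ (p, q)) (at (L $$ (c ! q)))"
      using Phi_low_has_derivative_entry[OF lower_pos_carrier[OF L], of i j k l d]
        c_tri[OF pq(1)] c_tri[OF pq(2)] pq by (simp add: J_def)
  qed
  have low: "J $$ (p, q) = 0" if "p < q" "q < m" for p q
  proof -
    obtain i j k l where ijkl: "c ! p = (i, j)" "c ! q = (k, l)" by (meson surj_pair)
    have "i < k \<or> i = k \<and> j < l"
      using sorted_wrt_nth_less[OF sorted_lex_coords[of n, folded c_def], of p q] that ijkl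
      by (simp add: m_def)
    then show ?thesis
      using Phi_low_jacobian_lower[OF L, of j i l k d] c_tri[of p] c_tri[of q] that ijkl
      by (simp add: J_def)
  qed
  have tri: "is_lower_triangular J"
    using low by (auto simp: is_lower_triangular_def J_def)
  let ?f = "\<lambda>p. Phi_low_jacobian n d L p p"
  have "diag_mat J = map ?f c"
    unfolding diag_mat_def by (rule nth_equalityI) (auto simp: J_def m_def)
  then have "\<bar>Determinant.det J\<bar> = \<bar>prod_list (map ?f (lex_coords n))\<bar>"
    using low by (subst det_lower_triangular[OF _ J]) (auto simp: c_def)
  also have "\<dots> = 2 ^ n * (\<Prod>j<n. (L $$ (j, j)) ^ (n - j))"
  proof (rule prod_lex_coords)
    fix i j :: nat assume ij: "j \<le> i" "i < n"
    then have "0 < L $$ (j, j)" using L by (auto simp: lower_pos_def)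
    then show "\<bar>?f (i, j)\<bar> = (if j = i then 2 else 1) * L $$ (j, j)"
      using ij signs_abs[OF d, of j] by (auto simp: Phi_low_jacobian_def abs_mult)
  qed
  \<comment> \<open>Passage to indices starting at 1 turns the exponent n - j into n + 1 -
    j.\<close>
  also have "(\<Prod>j<n. (L $$ (j, j)) ^ (n - j)) = (\<Prod>j = 1..n. (L $$ (j - 1, j - 1)) ^ (n + 1 - j))"
    by (simp add: prod.atLeast1_atMost_eq)
  finally show ?thesis using jac tri by blast
qed

subsection \<open>Transfer distributions\<close>

lemma measure_iso_sym_lebesgue_on:
  assumes iso: "measure_iso (sym_lebesgue n) (sym_lebesgue n) f g"
    and S: "S \<in> sets (sym_lebesgue n)" and T: "T \<in> sets (sym_lebesgue n)"
    and fS: "\<And>x. x \<in> S \<Longrightarrow> f x \<in> T" and gT: "\<And>y. y \<in> T \<Longrightarrow> g y \<in> S"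
  shows "measure_iso (sym_lebesgue_on n S) (sym_lebesgue_on n T) f g"
  unfolding sym_lebesgue_on_def using assms by (rule measure_iso_restrict)

lemma space_sym_lebesgue_on:
  assumes "S \<subseteq> sym_mats n"
  shows "space (sym_lebesgue_on n S) = S"
  using assms by (auto simp: sym_lebesgue_on_def space_restrict_space space_sym_lebesgue)

lemma LPM_subset: "LPM n \<epsilon> \<subseteq> sym_mats n"
  by (auto simp: LPM_def)

lemma TPM_subset: "TPM n \<epsilon> \<subseteq> sym_mats n"
  by (auto simp: TPM_def)

lemma PD_subset: "PD n \<subseteq> sym_mats n"
  by (auto simp: PD_def)

lemma sets_TPM:
  assumes "\<epsilon> \<in> sign_patterns n"
  shows "TPM n \<epsilon> \<in> sets (sym_lebesgue n)"
proof -
  have "TPM n \<epsilon> \<subseteq> rev_mat n ` LPM n \<epsilon>"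
  proof
    fix B assume B: "B \<in> TPM n \<epsilon>"
    then have "B = rev_mat n (rev_mat n B)"
      using TPM_subset sym_mats_carrier by (metis rev_mat_rev_mat subsetD)
    then show "B \<in> rev_mat n ` LPM n \<epsilon>" using rev_mat_TPM[OF B] by (rule image_eqI)
  qed
  then have "TPM n \<epsilon> = rev_mat n ` LPM n \<epsilon>" using rev_mat_LPM by blast
  then show ?thesis
    using measure_iso_image_sets[OF measure_iso_rev_mat sets_mat_cone] LPM_eq_mat_cone[OF assms] by simp
qed

text \<open>Given by the coordinate formula instead of by inverting parametrizations, so that it is
  defined and measurable on all symmetric matrices.\<close>

definition PD_to_LPM :: "nat \<Rightarrow> (nat \<Rightarrow> real) \<Rightarrow> real mat \<Rightarrow> real mat" where
  "PD_to_LPM n \<epsilon> A = sym_of_coords n (transfer (\<lambda>_. 1) (sign_entry \<epsilon>) n (coords_of n A))"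

lemma mat_cone_coords:
  assumes "A \<in> mat_cone n d"
  shows "coords_of n A \<in> chol_cone n d" "sym_of_coords n (coords_of n A) = A"
  using assms by (auto simp: mat_cone_def coords_of_sym_of_coords)

lemma sym_of_coords_mat_cone:
  "a \<in> chol_cone n d \<Longrightarrow> a \<in> extensional (tri n) \<Longrightarrow> sym_of_coords n a \<in> mat_cone n d"
  by (auto simp: mat_cone_def)

lemma transfer_extensional: "transfer d e n a \<in> extensional (tri n)"
  by (simp add: transfer_def)

text \<open>The transfer preserves the signs \<open>d i * pivot d a i\<close>, so the global
  isomorphism exchanges the two cones and restricts to them. The statements on transfer
  probabilities and Wishart laws follow from this.\<close>

lemma measure_iso_LPM_PD:
  assumes e: "\<epsilon> \<in> sign_patterns n"
  shows "measure_iso (sym_lebesgue_on n (LPM n \<epsilon>)) (sym_lebesgue_on n (PD n))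
    (LPM_to_PD n \<epsilon>) (PD_to_LPM n \<epsilon>)"
proof -
  let ?d = "sign_entry \<epsilon>"
  note d = signs_sign_entry[OF e]
  have one: "signs n (\<lambda>_. 1)" by (simp add: signs_def)
  have "measure_iso (sym_lebesgue_on n (mat_cone n ?d)) (sym_lebesgue_on n (mat_cone n (\<lambda>_. 1)))
    (\<lambda>A. sym_of_coords n (transfer ?d (\<lambda>_. 1) n (coords_of n A))) (PD_to_LPM n \<epsilon>)"
  proof (rule measure_iso_sym_lebesgue_on[OF _ sets_mat_cone sets_mat_cone])
    show "measure_iso (sym_lebesgue n) (sym_lebesgue n)
      (\<lambda>A. sym_of_coords n (transfer ?d (\<lambda>_. 1) n (coords_of n A))) (PD_to_LPM n \<epsilon>)"
      unfolding PD_to_LPM_def[abs_def]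
      by (rule measure_iso_sym_lebesgue[OF measure_iso_transfer[OF d one]])
  qed (auto simp: PD_to_LPM_def
      intro!: sym_of_coords_mat_cone transfer_chol_cone d one transfer_extensional mat_cone_coords)
  then have "measure_iso (sym_lebesgue_on n (LPM n \<epsilon>)) (sym_lebesgue_on n (PD n))
    (\<lambda>A. sym_of_coords n (transfer ?d (\<lambda>_. 1) n (coords_of n A))) (PD_to_LPM n \<epsilon>)"
    by (simp add: LPM_eq_mat_cone[OF e] PD_eq_mat_cone)
  then show ?thesis
  proof (rule measure_iso_cong)
    fix A assume "A \<in> space (sym_lebesgue_on n (LPM n \<epsilon>))"
    then have "A \<in> LPM n \<epsilon>" by (simp add: space_sym_lebesgue_on[OF LPM_subset])
    then have A: "A \<in> mat_cone n ?d" by (simp add: LPM_eq_mat_cone[OF e])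
    show "LPM_to_PD n \<epsilon> A = sym_of_coords n (transfer ?d (\<lambda>_. 1) n (coords_of n A))"
      using LPM_to_PD_sym_of_coords[OF e mat_cone_coords(1)[OF A]] mat_cone_coords(2)[OF A] by simp
  qed simp
qed

lemma measure_iso_rev_LPM_TPM:
  assumes e: "\<epsilon> \<in> sign_patterns n"
  shows "measure_iso (sym_lebesgue_on n (LPM n \<epsilon>)) (sym_lebesgue_on n (TPM n \<epsilon>)) (rev_mat n) (rev_mat n)"
proof (rule measure_iso_sym_lebesgue_on[OF measure_iso_rev_mat])
  show "LPM n \<epsilon> \<in> sets (sym_lebesgue n)" by (simp add: LPM_eq_mat_cone[OF e] sets_mat_cone)
  show "TPM n \<epsilon> \<in> sets (sym_lebesgue n)" using e by (rule sets_TPM)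
qed (auto intro: rev_mat_LPM rev_mat_TPM)

text \<open>The final reversal of \<open>PD n\<close> onto itself accounts for
  \<open>K\<^sup>T * K\<close> in place of \<open>L * L\<^sup>T\<close>.\<close>

lemma measure_iso_TPM_PD:
  assumes e: "\<epsilon> \<in> sign_patterns n"
  shows "measure_iso (sym_lebesgue_on n (TPM n \<epsilon>)) (sym_lebesgue_on n (PD n))
    (TPM_to_PD n \<epsilon>) (\<lambda>A. rev_mat n (PD_to_LPM n \<epsilon> (rev_mat n A)))"
proof -
  have PD: "measure_iso (sym_lebesgue_on n (PD n)) (sym_lebesgue_on n (PD n)) (rev_mat n) (rev_mat n)"
    by (rule measure_iso_sym_lebesgue_on[OF measure_iso_rev_mat])
      (auto simp: PD_eq_mat_cone[symmetric] intro: rev_mat_PD sets_mat_cone[of n "\<lambda>_. 1", folded PD_eq_mat_cone])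
  have "measure_iso (sym_lebesgue_on n (TPM n \<epsilon>)) (sym_lebesgue_on n (PD n))
      (rev_mat n \<circ> (LPM_to_PD n \<epsilon> \<circ> rev_mat n)) ((rev_mat n \<circ> PD_to_LPM n \<epsilon>) \<circ> rev_mat n)"
    by (rule measure_iso_comp[OF measure_iso_comp[OF
      measure_iso_sym[OF measure_iso_rev_LPM_TPM[OF e]] measure_iso_LPM_PD[OF e]] PD])
  then show ?thesis
    by (rule measure_iso_cong) (auto simp: space_sym_lebesgue_on[OF TPM_subset] TPM_to_PD_eq[OF e])
qed

lemma is_density_of_measure_iso:
  assumes iso: "measure_iso (sym_lebesgue_on n S) (sym_lebesgue_on n T) f g"
    and S: "S \<subseteq> sym_mats n" and T: "T \<subseteq> sym_mats n"
    and h: "is_density_of n T h Q"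
  shows "is_density_of n S (\<lambda>A. h (f A)) (density (sym_lebesgue_on n S) (\<lambda>A. ennreal (h (f A))))"
    and "\<A> \<in> sets (sym_lebesgue_on n S) \<Longrightarrow> f ` \<A> \<in> sets Q \<and>
      measure (density (sym_lebesgue_on n S) (\<lambda>A. ennreal (h (f A)))) \<A> = measure Q (f ` \<A>)"
proof -
  note i = measure_isoD[OF iso]
  have hm: "h \<in> borel_measurable (sym_lebesgue_on n T)" and nn: "\<And>A. A \<in> T \<Longrightarrow> 0 \<le> h A"
    and Q: "Q = density (sym_lebesgue_on n T) (\<lambda>A. ennreal (h A))" and P: "prob_space Q"
    using h by (auto simp: is_density_of_def)
  have hm': "(\<lambda>A. ennreal (h A)) \<in> borel_measurable (sym_lebesgue_on n T)"
    using hm by simp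
  have hf: "(\<lambda>A. h (f A)) \<in> borel_measurable (sym_lebesgue_on n S)"
    using i(1) hm by (rule measurable_compose)
  let ?R = "density (sym_lebesgue_on n S) (\<lambda>A. ennreal (h (f A)))"
  have "distr ?R (sym_lebesgue_on n T) f = Q"
    unfolding Q by (rule measure_iso_density[OF iso hm'])
  moreover have fR: "f \<in> ?R \<rightarrow>\<^sub>M sym_lebesgue_on n T" using i(1) by simp
  \<comment> \<open>Total mass 1 is inherited from the image measure \<open>Q\<close>.\<close>
  ultimately have "prob_space ?R"
    using P prob_space_distrD[OF fR] by simp
  moreover have "0 \<le> h (f A)" if "A \<in> S" for A
    using that i(6)[of A] by (intro nn) (simp add: space_sym_lebesgue_on S T)
  ultimately show "is_density_of n S (\<lambda>A. h (f A)) ?R"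
    using hf by (simp add: is_density_of_def)
  assume A: "\<A> \<in> sets (sym_lebesgue_on n S)"
  show "f ` \<A> \<in> sets Q \<and> measure ?R \<A> = measure Q (f ` \<A>)"
    using measure_iso_image_sets[OF iso A] measure_iso_density_image[OF iso hm' A] by (simp add: Q)
qed

section \<open>Wishart densities under reversal\<close>

lemma det_PD_pos:
  assumes A: "A \<in> PD n"
  shows "0 < Determinant.det A"
proof -
  have "A \<in> carrier_mat n n" using A PD_subset sym_mats_carrier by blast
  then have "Matrix.mat n n (\<lambda>(i, j). A $$ (i, j)) = A" by (intro eq_matI) auto
  then show ?thesis using PD_leading_minor_pos[OF A order_refl] by (simp add: leading_minor_def)
qed

text \<open>A right inverse forces a nonzero determinant, so the elimination algorithm succeeds, and
  the left inverse that it returns must be \<open>B\<close>.\<close>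

lemma mat_inverse_eqI:
  fixes A :: "real mat"
  assumes A: "A \<in> carrier_mat n n" and B: "B \<in> carrier_mat n n" and AB: "A * B = 1\<^sub>m n"
  shows "mat_inverse A = Some B"
proof -
  have "Determinant.det A * Determinant.det B = 1"
    using Determinant.det_mult[OF A B] AB by simp
  then have "A \<in> Units (ring_mat TYPE(real) n ())"
    by (intro det_non_zero_imp_unit[OF A]) auto
  then obtain C where C: "mat_inverse A = Some C"
    using mat_inverse(1)[OF A, of "()"] by (cases "mat_inverse A") auto
  then have c: "C * A = 1\<^sub>m n" "C \<in> carrier_mat n n" using mat_inverse(2)[OF A] by auto
  have "C = C * (A * B)" using AB c by simp
  also have "\<dots> = (C * A) * B" by (rule assoc_mult_mat[OF c(2) A B, symmetric])
  finally show ?thesis using B c C by simp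
qed

text \<open>The density depends on determinants and on a trace. Reversal keeps determinants,
  commutes with inversion, and swaps the factors under the trace, which is cyclic.\<close>

lemma wishart_density_rev_mat:
  assumes S: "\<Sigma> \<in> PD n" and A: "A \<in> carrier_mat n n"
  shows "wishart_density n (rev_mat n \<Sigma>) N (rev_mat n A) = wishart_density n \<Sigma> N A"
proof -
  have c: "\<Sigma> \<in> carrier_mat n n" using S PD_subset sym_mats_carrier by blast
  have "\<Sigma> \<in> Units (ring_mat TYPE(real) n ())"
    using det_PD_pos[OF S] by (intro det_non_zero_imp_unit[OF c]) auto
  then obtain B where B: "mat_inverse \<Sigma> = Some B"
    using mat_inverse(1)[OF c, of "()"] by (cases "mat_inverse \<Sigma>") auto
  then have b: "B * \<Sigma> = 1\<^sub>m n" "\<Sigma> * B = 1\<^sub>m n" "B \<in> carrier_mat n n"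
    using mat_inverse(2)[OF c] by auto
  have "mat_inverse (rev_mat n \<Sigma>) = Some (rev_mat n B)"
  proof (rule mat_inverse_eqI)
    show "rev_mat n \<Sigma> * rev_mat n B = 1\<^sub>m n"
      using rev_mat_mult[OF b(3) c] b(1) by (simp add: rev_mat_one)
  qed (use b c in simp_all)
  moreover have "mat_tr (rev_mat n B * rev_mat n A) = mat_tr (B * A)"
  proof -
    have "mat_tr (rev_mat n B * rev_mat n A) = mat_tr (A * B)"
      using mat_tr_rev_mat[of "A * B" n] A b(3) by (simp add: rev_mat_mult)
    also have "\<dots> = (\<Sum>i<n. \<Sum>k<n. A $$ (i, k) * B $$ (k, i))"
      using A b(3) by (simp add: mat_tr_def mat_mult_index[OF A b(3)] del: index_mult_mat(1))
    also have "\<dots> = (\<Sum>k<n. \<Sum>i<n. B $$ (k, i) * A $$ (i, k))"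
      by (subst sum.swap) (simp add: mult.commute)
    also have "\<dots> = mat_tr (B * A)"
      using A b(3) by (simp add: mat_tr_def mat_mult_index[OF b(3) A] del: index_mult_mat(1))
    finally show ?thesis .
  qed
  ultimately show ?thesis
    using B by (simp add: wishart_density_def det_rev_mat[OF c] det_rev_mat[OF A])
qed

lemma TPM_density_wishart_rev_mat:
  assumes e: "\<epsilon> \<in> sign_patterns n" and S: "\<Sigma> \<in> PD n" and A: "A \<in> LPM n \<epsilon>"
  shows "TPM_density n \<epsilon> (wishart_density n (rev_mat n \<Sigma>) N) (rev_mat n A)
    = LPM_density n \<epsilon> (wishart_density n \<Sigma> N) A"
proof -
  have c: "A \<in> carrier_mat n n" using A LPM_subset sym_mats_carrier by blast
  have "LPM_to_PD n \<epsilon> A \<in> PD n"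
    using measure_isoD(6)[OF measure_iso_LPM_PD[OF e], of A] A
    by (simp add: space_sym_lebesgue_on LPM_subset PD_subset)
  then have c': "LPM_to_PD n \<epsilon> A \<in> carrier_mat n n" using PD_subset sym_mats_carrier by blast
  show ?thesis
    using c wishart_density_rev_mat[OF S c']
    by (simp add: TPM_density_def LPM_density_def TPM_to_PD_eq[OF e rev_mat_LPM[OF A]])
qed

lemma wishart_TPM_rev_mat:
  assumes e: "\<epsilon> \<in> sign_patterns n" and S: "\<Sigma> \<in> PD n" and M: "wishart_LPM P n \<epsilon> \<Sigma> N M"
  shows "wishart_TPM P n \<epsilon> (rev_mat n \<Sigma>) N (\<lambda>\<omega>. rev_mat n (M \<omega>))"
proof -
  let ?h = "LPM_density n \<epsilon> (wishart_density n \<Sigma> N)"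
  have "distributed P (sym_lebesgue_on n (TPM n \<epsilon>)) (\<lambda>\<omega>. rev_mat n (M \<omega>))
      (\<lambda>B. ennreal (?h (rev_mat n B)))"
    using distributed_measure_iso[OF measure_iso_rev_LPM_TPM[OF e]] M
    by (simp add: wishart_LPM_def has_density_def)
  moreover have "?h (rev_mat n B) = TPM_density n \<epsilon> (wishart_density n (rev_mat n \<Sigma>) N) B"
    if "B \<in> TPM n \<epsilon>" for B
    using TPM_density_wishart_rev_mat[OF e S rev_mat_TPM[OF that]] that TPM_subset sym_mats_carrier
    by (metis rev_mat_rev_mat subsetD)
  ultimately show ?thesis
    unfolding wishart_TPM_def has_density_def
    by (subst distributed_cong[where Y = "\<lambda>\<omega>. rev_mat n (M \<omega>)"
        and k = "\<lambda>B. ennreal (?h (rev_mat n B))"])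
      (auto simp: space_sym_lebesgue_on TPM_subset)
qed

text \<open>\<open>M\<close> is recovered by reversing twice. This gives back the original value for
  matrices of size n x n, whence the assumption \<open>carrier\<close>.\<close>

lemma wishart_LPM_of_rev_mat:
  assumes e: "\<epsilon> \<in> sign_patterns n" and S: "\<Sigma> \<in> PD n"
    and carrier: "\<And>\<omega>. \<omega> \<in> space P \<Longrightarrow> M \<omega> \<in> carrier_mat n n"
    and M: "wishart_TPM P n \<epsilon> (rev_mat n \<Sigma>) N (\<lambda>\<omega>. rev_mat n (M \<omega>))"
  shows "wishart_LPM P n \<epsilon> \<Sigma> N M"
proof -
  let ?h = "TPM_density n \<epsilon> (wishart_density n (rev_mat n \<Sigma>) N)"
  have "distributed P (sym_lebesgue_on n (LPM n \<epsilon>)) (\<lambda>\<omega>. rev_mat n (rev_mat n (M \<omega>)))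
      (\<lambda>A. ennreal (?h (rev_mat n A)))"
    using distributed_measure_iso[OF measure_iso_sym[OF measure_iso_rev_LPM_TPM[OF e]]] M
    by (simp add: wishart_TPM_def has_density_def)
  then show ?thesis
    unfolding wishart_LPM_def has_density_def
    by (subst distributed_cong[where Y = "\<lambda>\<omega>. rev_mat n (rev_mat n (M \<omega>))"
        and k = "\<lambda>A. ennreal (?h (rev_mat n A))"])
      (auto simp: space_sym_lebesgue_on LPM_subset carrier TPM_density_wishart_rev_mat[OF e S])
qed

section \<open>Bartlett decompositions\<close>

lemma lower_pos_mult:
  assumes L: "L \<in> lower_pos n" and K: "K \<in> lower_pos n"
  shows "L * K \<in> lower_pos n"
proof -
  note c = lower_pos_carrier[OF L] lower_pos_carrier[OF K]
  have "(L * K) $$ (i, j) = 0" if ij: "i < j" "j < n" for i j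
  proof -
    have zero: "L $$ (i, k) * K $$ (k, j) = 0" if "k < n" for k
      using L K that ij by (cases "i < k") (auto simp: lower_pos_def)
    have "(L * K) $$ (i, j) = (\<Sum>k<n. L $$ (i, k) * K $$ (k, j))"
      using ij by (intro mat_mult_index c) auto
    also have "\<dots> = 0" by (intro sum.neutral ballI zero) simp
    finally show ?thesis .
  qed
  moreover have "(L * K) $$ (i, i) > 0" if i: "i < n" for i
  proof -
    have "(L * K) $$ (i, i) = (\<Sum>k<n. if k = i then L $$ (i, i) * K $$ (i, i) else 0)"
      unfolding mat_mult_index[OF c i i] using L K i
      by (intro sum.cong) (auto simp: lower_pos_def neq_iff)
    then show ?thesis using L K i by (simp add: lower_pos_def)
  qed
  ultimately show ?thesis using c by (simp add: lower_pos_def del: index_mult_mat(1))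
qed

lemma Phi_low_mult:
  assumes "L \<in> carrier_mat n n" "K \<in> carrier_mat n n" "D \<in> carrier_mat n n"
  shows "L * K * D * transpose_mat K * transpose_mat L = Phi_low D (L * K)"
proof -
  have "Phi_low D (L * K) = L * K * D * (transpose_mat K * transpose_mat L)"
    unfolding Phi_low_def using assms by (subst transpose_mult[of _ n n]) auto
  also have "\<dots> = L * K * D * transpose_mat K * transpose_mat L"
    using assms by (intro assoc_mult_mat[symmetric, of _ n n _ n _ n] mult_carrier_mat[of _ n n]) auto
  finally show ?thesis ..
qed

text \<open>\<open>L * K \<omega>\<close> is again lower triangular with positive diagonal, so it is
  the Cholesky factor of \<open>M \<omega>\<close>. Inserting the sign diagonal is therefore the
  same as applying \<open>PD_to_LPM\<close>, which transports the density.\<close>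

lemma wishart_LPM_bartlett:
  assumes e: "\<epsilon> \<in> sign_patterns n" and L: "L \<in> lower_pos n" and M: "wishart P n \<Sigma> N M"
    and K: "\<And>\<omega>. \<omega> \<in> space P \<Longrightarrow> K \<omega> \<in> lower_pos n"
    and M_eq: "\<And>\<omega>. \<omega> \<in> space P \<Longrightarrow> M \<omega> = L * K \<omega> * transpose_mat (K \<omega>) * transpose_mat L"
  shows "wishart_LPM P n \<epsilon> \<Sigma> N
    (\<lambda>\<omega>. L * K \<omega> * sign_diag n \<epsilon> * transpose_mat (K \<omega>) * transpose_mat L)"
proof -
  let ?h = "wishart_density n \<Sigma> N"
  note iso = measure_iso_LPM_PD[OF e]
  have "distributed P (sym_lebesgue_on n (LPM n \<epsilon>)) (\<lambda>\<omega>. PD_to_LPM n \<epsilon> (M \<omega>))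
      (\<lambda>A. ennreal (?h (LPM_to_PD n \<epsilon> A)))"
    using distributed_measure_iso[OF measure_iso_sym[OF iso]] M
    by (simp add: wishart_def has_density_def)
  moreover have "L * K \<omega> * sign_diag n \<epsilon> * transpose_mat (K \<omega>) * transpose_mat L = PD_to_LPM n \<epsilon> (M \<omega>)"
    if w: "\<omega> \<in> space P" for \<omega>
  proof -
    note c = lower_pos_carrier[OF L] lower_pos_carrier[OF K[OF w]]
    have LK: "L * K \<omega> \<in> lower_pos n" by (rule lower_pos_mult[OF L K[OF w]])
    have LPM: "Phi_low (sign_diag n \<epsilon>) (L * K \<omega>) \<in> LPM n \<epsilon>"
      unfolding LPM_eq_image_Phi_low[OF e] using LK by (rule imageI)
    have "M \<omega> = Phi_low (1\<^sub>m n) (L * K \<omega>)"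
      using Phi_low_mult[OF c one_carrier_mat] right_mult_one_mat[OF lower_pos_carrier[OF LK]] M_eq[OF w]
      by simp
    also have "\<dots> = LPM_to_PD n \<epsilon> (Phi_low (sign_diag n \<epsilon>) (L * K \<omega>))"
      by (rule LPM_to_PD_Phi_low[OF e LK, symmetric])
    \<comment> \<open>The value of \<open>PD_to_LPM\<close> comes from its being a left inverse of
      \<open>LPM_to_PD\<close> on \<open>LPM n \<epsilon>\<close>; no coordinates are
      computed.\<close>
    finally have "PD_to_LPM n \<epsilon> (M \<omega>) = Phi_low (sign_diag n \<epsilon>) (L * K \<omega>)"
      using measure_isoD(4)[OF iso] LPM by (simp add: space_sym_lebesgue_on[OF LPM_subset])
    then show ?thesis using Phi_low_mult[OF c sign_diag_carrier] by simp
  qed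
  ultimately show ?thesis
    unfolding wishart_LPM_def has_density_def LPM_density_def
    by (subst distributed_cong[where Y = "\<lambda>\<omega>. PD_to_LPM n \<epsilon> (M \<omega>)"
        and k = "\<lambda>A. ennreal (?h (LPM_to_PD n \<epsilon> A))"]) auto
qed

lemma rev_mat_bartlett:
  assumes e: "\<epsilon> \<in> sign_patterns n" and L: "L \<in> carrier_mat n n" and K: "K \<in> carrier_mat n n"
  shows "transpose_mat (rev_mat n L) * transpose_mat (rev_mat n K) * sign_diag n (rev_pattern n \<epsilon>)
      * rev_mat n K * rev_mat n L
    = rev_mat n (L * K * sign_diag n \<epsilon> * transpose_mat K * transpose_mat L)"
proof -
  have cLK: "L * K \<in> carrier_mat n n" using L K by (rule mult_carrier_mat)
  have rc: "rev_mat n K \<in> carrier_mat n n" "rev_mat n L \<in> carrier_mat n n" using L K by simp_all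
  have "rev_mat n (Phi_low (sign_diag n \<epsilon>) (L * K))
      = Phi_up (sign_diag n (rev_pattern n \<epsilon>)) (rev_mat n K * rev_mat n L)"
    by (rule Phi_up_sign_diag[OF e rev_mat_carrier[OF cLK],
      unfolded rev_mat_rev_mat[OF cLK], unfolded rev_mat_mult[OF L K], symmetric])
  also have "\<dots> = (transpose_mat (rev_mat n L) * transpose_mat (rev_mat n K)
      * sign_diag n (rev_pattern n \<epsilon>)) * (rev_mat n K * rev_mat n L)"
    unfolding Phi_up_def transpose_mult[OF rc] ..
  also have "\<dots> = transpose_mat (rev_mat n L) * transpose_mat (rev_mat n K)
      * sign_diag n (rev_pattern n \<epsilon>) * rev_mat n K * rev_mat n L"
    using rc by (intro assoc_mult_mat[symmetric, of _ n n _ n _ n] mult_carrier_mat[of _ n n])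
      (auto simp: sign_diag_carrier)
  finally show ?thesis using Phi_low_mult[OF L K sign_diag_carrier] by simp
qed

section \<open>Functional calculus and expectations of reversed matrices\<close>

lemma fun_calc_rev_mat:
  assumes A: "A \<in> sym_mats n"
  shows "fun_calc n g (rev_mat n A) = rev_mat n (fun_calc n g A)"
proof (rule fun_calc_eqI)
  obtain U d where U: "is_orthogonal n U" and A_eq: "A = U * mat_diag n d * transpose_mat U"
    and B_eq: "fun_calc n g A = U * mat_diag n (\<lambda>i. g (d i)) * transpose_mat U"
    using spectral_image_fun_calc[OF A, of g] by (auto simp: spectral_image_def)
  note u = is_orthogonalD[OF U]
  \<comment> \<open>The transposed reversal of \<open>U\<close> is orthogonal again and diagonalizes
    the reversed matrix, with the eigenvalues in the opposite order.\<close>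
  let ?V = "transpose_mat (rev_mat n U)"
  have rev: "rev_mat n (U * mat_diag n x * transpose_mat U)
      = ?V * mat_diag n (\<lambda>i. x (n - Suc i)) * transpose_mat ?V" for x
    using Phi_up_rev_mat[OF mat_diag_dim u(1), of x]
    by (simp add: Phi_up_def Phi_low_def rev_mat_diag)
  have A': "rev_mat n A = ?V * mat_diag n (\<lambda>i. d (n - Suc i)) * transpose_mat ?V"
    using rev[of d] by (simp only: A_eq[symmetric])
  have B': "rev_mat n (fun_calc n g A) = ?V * mat_diag n (\<lambda>i. g (d (n - Suc i))) * transpose_mat ?V"
    using rev[of "\<lambda>i. g (d i)"] by (simp only: B_eq[symmetric])
  have V: "is_orthogonal n ?V"
    using u(1) rev_mat_mult[OF u(1,2), symmetric] rev_mat_mult[OF u(2,1), symmetric]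
    unfolding u(3,4) rev_mat_transpose[OF u(1)] rev_mat_one by (simp add: is_orthogonal_def)
  show "spectral_image n g (rev_mat n A) (rev_mat n (fun_calc n g A))"
    unfolding spectral_image_def
    by (intro exI[of _ ?V] exI[of _ "\<lambda>i. d (n - Suc i)"] conjI V A' B')
qed

lemma fun_calc_carrier:
  assumes A: "A \<in> sym_mats n"
  shows "fun_calc n g A \<in> carrier_mat n n"
proof -
  obtain U d where U: "is_orthogonal n U" "fun_calc n g A = U * mat_diag n d * transpose_mat U"
    using spectral_image_fun_calc[OF A, of g] by (auto simp: spectral_image_def)
  note u = is_orthogonalD[OF U(1)]
  show ?thesis unfolding U(2) by (intro mult_carrier_mat[of _ n n] u mat_diag_dim)
qed

lemma mat_expectation_rev_mat:
  assumes eq: "\<And>\<omega>. \<omega> \<in> space P \<Longrightarrow> Y \<omega> = rev_mat n (X \<omega>)"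
    and carrier: "\<And>\<omega>. \<omega> \<in> space P \<Longrightarrow> X \<omega> \<in> carrier_mat n n"
  shows "has_mat_expectation P n Y \<longleftrightarrow> has_mat_expectation P n X"
    and "mat_expectation P n Y = rev_mat n (mat_expectation P n X)"
proof -
  \<comment> \<open>Reversal only permutes entries, so it commutes with integration entry by
    entry.\<close>
  have index: "Y \<omega> $$ (i, j) = X \<omega> $$ (n - Suc j, n - Suc i)"
    if "\<omega> \<in> space P" "i < n" "j < n" for \<omega> i j
    using that by (simp add: eq rev_mat_index[OF carrier])
  have int: "integrable P (\<lambda>\<omega>. Y \<omega> $$ (i, j)) \<longleftrightarrow> integrable P (\<lambda>\<omega>. X \<omega> $$ (n - Suc j, n - Suc i))"
    if "i < n" "j < n" for i j
    using that by (intro Bochner_Integration.integrable_cong refl index)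
  show "has_mat_expectation P n Y \<longleftrightarrow> has_mat_expectation P n X"
  proof
    assume Y: "has_mat_expectation P n Y"
    have "integrable P (\<lambda>\<omega>. X \<omega> $$ (i, j))" if "i < n" "j < n" for i j
      using Y int[of "n - Suc j" "n - Suc i"] that by (simp add: has_mat_expectation_def)
    then show "has_mat_expectation P n X" by (simp add: has_mat_expectation_def)
  qed (auto simp: has_mat_expectation_def int)
  have "(\<integral>\<omega>. Y \<omega> $$ (i, j) \<partial>P) = (\<integral>\<omega>. X \<omega> $$ (n - Suc j, n - Suc i) \<partial>P)"
    if "i < n" "j < n" for i j
    using that by (intro Bochner_Integration.integral_cong refl index)
  then show "mat_expectation P n Y = rev_mat n (mat_expectation P n X)"
    by (intro rev_mat_eqI[symmetric]) (auto simp: mat_expectation_def)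
qed

theorem theorem8:
  fixes n :: nat and Q :: "real mat measure" and f\<^sub>Q :: "real mat \<Rightarrow> real"
  assumes "n \<ge> 1"
    and "is_density_of n (PD n) f\<^sub>Q Q"
  shows
    "(\<comment> \<open>(1)\<close>
      \<forall>\<epsilon> \<in> sign_patterns n.
        is_density_of n (LPM n \<epsilon>) (LPM_density n \<epsilon> f\<^sub>Q) (LPM_transfer n \<epsilon> f\<^sub>Q) \<and>
        (\<forall>\<A> \<in> sets (sym_lebesgue_on n (LPM n \<epsilon>)).
           LPM_to_PD n \<epsilon> ` \<A> \<in> sets Q \<and>
           measure (LPM_transfer n \<epsilon> f\<^sub>Q) \<A> = measure Q (LPM_to_PD n \<epsilon> ` \<A>)) \<and>
        (\<forall>L \<in> lower_pos n. \<exists>J.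
           is_jacobian n (Phi_low (sign_diag n \<epsilon>)) L J \<and>
           is_lower_triangular J \<and>
           \<bar>Determinant.det J\<bar> = 2 ^ n * (\<Prod>j = 1..n. (L $$ (j - 1, j - 1)) ^ (n + 1 - j))))
     \<and>
     (\<comment> \<open>(2)\<close>
      \<forall>\<epsilon> \<in> sign_patterns n. \<forall>\<Sigma> \<in> PD n. \<forall>N \<ge> n. \<forall>L\<^sub>0 \<in> lower_pos n.
        \<forall>(P :: 'w measure) M\<^sub>1 K\<^sub>1.
          prob_space P \<and> \<Sigma> = L\<^sub>0 * transpose_mat L\<^sub>0 \<and> wishart P n \<Sigma> N M\<^sub>1 \<and>
          (\<forall>\<omega> \<in> space P. K\<^sub>1 \<omega> \<in> lower_pos n \<and>
             M\<^sub>1 \<omega> = L\<^sub>0 * K\<^sub>1 \<omega> * transpose_mat (K\<^sub>1 \<omega>) * transpose_mat L\<^sub>0) \<longrightarrow>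
          wishart_LPM P n \<epsilon> \<Sigma> N
            (\<lambda>\<omega>. L\<^sub>0 * K\<^sub>1 \<omega> * sign_diag n \<epsilon> * transpose_mat (K\<^sub>1 \<omega>) * transpose_mat L\<^sub>0))
     \<and>
     (\<comment> \<open>(3)\<close>
      \<forall>\<epsilon> \<in> sign_patterns n.
        is_density_of n (TPM n \<epsilon>) (TPM_density n \<epsilon> f\<^sub>Q) (TPM_transfer n \<epsilon> f\<^sub>Q) \<and>
        (\<forall>\<B> \<in> sets (sym_lebesgue_on n (TPM n \<epsilon>)).
           TPM_to_PD n \<epsilon> ` \<B> \<in> sets Q \<and>
           measure (TPM_transfer n \<epsilon> f\<^sub>Q) \<B> = measure Q (TPM_to_PD n \<epsilon> ` \<B>)) \<and>
        (\<forall>\<Sigma> \<in> PD n. \<forall>N \<ge> n. \<forall>L\<^sub>0 \<in> lower_pos n. \<forall>(P :: 'w measure) M\<^sub>1 K\<^sub>1.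
          prob_space P \<and> \<Sigma> = L\<^sub>0 * transpose_mat L\<^sub>0 \<and> wishart P n \<Sigma> N M\<^sub>1 \<and>
          (\<forall>\<omega> \<in> space P. K\<^sub>1 \<omega> \<in> lower_pos n \<and>
             M\<^sub>1 \<omega> = L\<^sub>0 * K\<^sub>1 \<omega> * transpose_mat (K\<^sub>1 \<omega>) * transpose_mat L\<^sub>0) \<longrightarrow>
          wishart_TPM P n \<epsilon> (rev_mat n \<Sigma>) N
            (\<lambda>\<omega>. transpose_mat (rev_mat n L\<^sub>0) * transpose_mat (rev_mat n (K\<^sub>1 \<omega>))
                   * sign_diag n (rev_pattern n \<epsilon>) * rev_mat n (K\<^sub>1 \<omega>) * rev_mat n L\<^sub>0)))
     \<and>
     (\<comment> \<open>(4)\<close>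
      \<forall>\<epsilon> \<in> sign_patterns n. \<forall>\<Sigma> \<in> PD n. \<forall>N \<ge> n. \<forall>(P :: 'w measure) M.
        prob_space P \<and> (\<forall>\<omega> \<in> space P. M \<omega> \<in> carrier_mat n n) \<longrightarrow>
        (wishart_LPM P n \<epsilon> \<Sigma> N M \<longleftrightarrow>
         wishart_TPM P n \<epsilon> (rev_mat n \<Sigma>) N (\<lambda>\<omega>. rev_mat n (M \<omega>))))
     \<and>
     (\<comment> \<open>(5)\<close>
      \<forall>\<epsilon> \<in> sign_patterns n. \<forall>\<Sigma> \<in> PD n. \<forall>N \<ge> n. \<forall>(P :: 'w measure) M.
        \<forall>g \<in> borel_measurable lebesgue.
          prob_space P \<and> wishart_LPM P n \<epsilon> \<Sigma> N M \<and>
          wishart_TPM P n \<epsilon> (rev_mat n \<Sigma>) N (\<lambda>\<omega>. rev_mat n (M \<omega>)) \<longrightarrow>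
          (has_mat_expectation P n (\<lambda>\<omega>. fun_calc n g (rev_mat n (M \<omega>))) \<longleftrightarrow>
           has_mat_expectation P n (\<lambda>\<omega>. fun_calc n g (M \<omega>))) \<and>
          (has_mat_expectation P n (\<lambda>\<omega>. fun_calc n g (M \<omega>)) \<longrightarrow>
           mat_expectation P n (\<lambda>\<omega>. fun_calc n g (rev_mat n (M \<omega>))) =
           rev_mat n (mat_expectation P n (\<lambda>\<omega>. fun_calc n g (M \<omega>)))))"
proof (intro conjI ballI allI impI; (elim conjE)?)
  fix \<epsilon> assume e: "\<epsilon> \<in> sign_patterns n"
  note L = is_density_of_measure_iso[OF measure_iso_LPM_PD[OF e] LPM_subset PD_subset assms(2)]
  show "is_density_of n (LPM n \<epsilon>) (LPM_density n \<epsilon> f\<^sub>Q) (LPM_transfer n \<epsilon> f\<^sub>Q)"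
    using L(1) by (simp add: LPM_density_def[abs_def] LPM_transfer_def)
  fix \<A> assume "\<A> \<in> sets (sym_lebesgue_on n (LPM n \<epsilon>))"
  from L(2)[OF this] show "LPM_to_PD n \<epsilon> ` \<A> \<in> sets Q"
    "measure (LPM_transfer n \<epsilon> f\<^sub>Q) \<A> = measure Q (LPM_to_PD n \<epsilon> ` \<A>)"
    by (simp_all add: LPM_density_def[abs_def] LPM_transfer_def)
next
  fix \<epsilon> L assume e: "\<epsilon> \<in> sign_patterns n" and L: "L \<in> lower_pos n"
  show "\<exists>J. is_jacobian n (Phi_low (sign_diag n \<epsilon>)) L J \<and> is_lower_triangular J \<and>
      \<bar>Determinant.det J\<bar> = 2 ^ n * (\<Prod>j = 1..n. (L $$ (j - 1, j - 1)) ^ (n + 1 - j))"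
    unfolding sign_diag_eq by (rule Phi_low_jacobian_matrix[OF signs_sign_entry[OF e] L])
next
  fix \<epsilon> \<Sigma> N L\<^sub>0 and P :: "'w measure" and M\<^sub>1 K\<^sub>1
  assume "\<epsilon> \<in> sign_patterns n" "L\<^sub>0 \<in> lower_pos n" "wishart P n \<Sigma> N M\<^sub>1"
    "\<forall>\<omega> \<in> space P. K\<^sub>1 \<omega> \<in> lower_pos n \<and>
      M\<^sub>1 \<omega> = L\<^sub>0 * K\<^sub>1 \<omega> * transpose_mat (K\<^sub>1 \<omega>) * transpose_mat L\<^sub>0"
  then show "wishart_LPM P n \<epsilon> \<Sigma> N
      (\<lambda>\<omega>. L\<^sub>0 * K\<^sub>1 \<omega> * sign_diag n \<epsilon> * transpose_mat (K\<^sub>1 \<omega>) * transpose_mat L\<^sub>0)"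
    by (intro wishart_LPM_bartlett[where M = M\<^sub>1]) auto
next
  fix \<epsilon> assume e: "\<epsilon> \<in> sign_patterns n"
  note T = is_density_of_measure_iso[OF measure_iso_TPM_PD[OF e] TPM_subset PD_subset assms(2)]
  show "is_density_of n (TPM n \<epsilon>) (TPM_density n \<epsilon> f\<^sub>Q) (TPM_transfer n \<epsilon> f\<^sub>Q)"
    using T(1) by (simp add: TPM_density_def[abs_def] TPM_transfer_def)
  fix \<B> assume "\<B> \<in> sets (sym_lebesgue_on n (TPM n \<epsilon>))"
  from T(2)[OF this] show "TPM_to_PD n \<epsilon> ` \<B> \<in> sets Q"
    "measure (TPM_transfer n \<epsilon> f\<^sub>Q) \<B> = measure Q (TPM_to_PD n \<epsilon> ` \<B>)"
    by (simp_all add: TPM_density_def[abs_def] TPM_transfer_def)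
next
  fix \<epsilon> \<Sigma> N L\<^sub>0 and P :: "'w measure" and M\<^sub>1 K\<^sub>1
  assume e: "\<epsilon> \<in> sign_patterns n" and S: "\<Sigma> \<in> PD n" and L: "L\<^sub>0 \<in> lower_pos n"
    and M: "wishart P n \<Sigma> N M\<^sub>1"
    and K: "\<forall>\<omega> \<in> space P. K\<^sub>1 \<omega> \<in> lower_pos n \<and>
      M\<^sub>1 \<omega> = L\<^sub>0 * K\<^sub>1 \<omega> * transpose_mat (K\<^sub>1 \<omega>) * transpose_mat L\<^sub>0"
  have "wishart_LPM P n \<epsilon> \<Sigma> N
      (\<lambda>\<omega>. L\<^sub>0 * K\<^sub>1 \<omega> * sign_diag n \<epsilon> * transpose_mat (K\<^sub>1 \<omega>) * transpose_mat L\<^sub>0)"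
    using e L M K by (intro wishart_LPM_bartlett[where M = M\<^sub>1]) auto
  note wishart_TPM_rev_mat[OF e S this]
  then show "wishart_TPM P n \<epsilon> (rev_mat n \<Sigma>) N
      (\<lambda>\<omega>. transpose_mat (rev_mat n L\<^sub>0) * transpose_mat (rev_mat n (K\<^sub>1 \<omega>))
         * sign_diag n (rev_pattern n \<epsilon>) * rev_mat n (K\<^sub>1 \<omega>) * rev_mat n L\<^sub>0)"
    unfolding wishart_TPM_def has_density_def
    by (rule distributed_cong[THEN iffD2, rotated 2])
      (use K L in \<open>auto intro!: rev_mat_bartlett[OF e] lower_pos_carrier\<close>)
next
  fix \<epsilon> \<Sigma> N and P :: "'w measure" and M :: "'w \<Rightarrow> real mat"
  assume e: "\<epsilon> \<in> sign_patterns n" and S: "\<Sigma> \<in> PD n"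
    and M: "\<forall>\<omega> \<in> space P. M \<omega> \<in> carrier_mat n n"
  show "wishart_LPM P n \<epsilon> \<Sigma> N M \<longleftrightarrow>
      wishart_TPM P n \<epsilon> (rev_mat n \<Sigma>) N (\<lambda>\<omega>. rev_mat n (M \<omega>))"
  proof
    assume "wishart_LPM P n \<epsilon> \<Sigma> N M"
    then show "wishart_TPM P n \<epsilon> (rev_mat n \<Sigma>) N (\<lambda>\<omega>. rev_mat n (M \<omega>))"
      by (rule wishart_TPM_rev_mat[OF e S])
  next
    assume "wishart_TPM P n \<epsilon> (rev_mat n \<Sigma>) N (\<lambda>\<omega>. rev_mat n (M \<omega>))"
    then show "wishart_LPM P n \<epsilon> \<Sigma> N M"
      using M by (intro wishart_LPM_of_rev_mat[OF e S]) simp_all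
  qed
next
  fix \<epsilon> \<Sigma> N and P :: "'w measure" and M :: "'w \<Rightarrow> real mat" and g :: "real \<Rightarrow> real"
  assume "wishart_LPM P n \<epsilon> \<Sigma> N M"
  \<comment> \<open>Measurability into the restricted space places \<open>M \<omega>\<close> in
    \<open>LPM n \<epsilon>\<close> at every point. So it is symmetric, and the identities of the
    functional calculus hold pointwise.\<close>
  then have meas: "M \<in> P \<rightarrow>\<^sub>M sym_lebesgue_on n (LPM n \<epsilon>)"
    by (simp add: wishart_LPM_def has_density_def distributed_def)
  have M: "M \<omega> \<in> sym_mats n" if "\<omega> \<in> space P" for \<omega>
  proof -
    have "M \<omega> \<in> LPM n \<epsilon>"
      using measurable_space[OF meas that] by (simp only: space_sym_lebesgue_on[OF LPM_subset])
    then show ?thesis using LPM_subset by (rule subsetD[rotated])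
  qed
  note E = mat_expectation_rev_mat[of P "\<lambda>\<omega>. fun_calc n g (rev_mat n (M \<omega>))" n "\<lambda>\<omega>. fun_calc n g (M \<omega>)",
      OF fun_calc_rev_mat[OF M] fun_calc_carrier[OF M]]
  show "has_mat_expectation P n (\<lambda>\<omega>. fun_calc n g (rev_mat n (M \<omega>))) \<longleftrightarrow>
      has_mat_expectation P n (\<lambda>\<omega>. fun_calc n g (M \<omega>))"
    "mat_expectation P n (\<lambda>\<omega>. fun_calc n g (rev_mat n (M \<omega>))) =
      rev_mat n (mat_expectation P n (\<lambda>\<omega>. fun_calc n g (M \<omega>)))"
    using E by auto
qed

end
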